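(* Assume $d\ge 3$. Then for every $x\in\mathbb{Z}^d$, $\mu(|\mathcal{C}_x|<\infty)=1$, where $\mathcal{C}_x(\eta)=\{y\in\mathbb{Z}^d: N(x,y,\eta)>0\}$ is the avalanche cluster caused by adding a grain at $x$.
   Context: Abelian sandpile on $\mathbb{Z}^d$: $\Delta_{xx}=2d$, $\Delta_{xy}=-1$ if $|x-y|=1$, $0$ otherwise; $\Delta_V$ is its restriction to $V\times V$ for finite $V$. $\Omega=\{1,\dots,2d\}^{\mathbb{Z}^d}$ (product topology), $\Omega_V=\{1,\dots,2d\}^V$. For finite $V$, toppling $z\in V$ maps $\xi$ to $\xi-(\Delta_V)_{z\cdot}$, legal if $\xi(z)>2d$; stabilization means performing legal topplings until the configuration is stable (i.e. all heights $\le 2d$); the addition operator is $a_{x,V}\xi$ = stabilization of $\xi+\delta_x$. The recurrent set $\mathcal{R}_V\subset\Omega_V$ is the set of recurrent states of the Markov chain on $\Omega_V$ which at each step applies $a_{X,V}$ with $X$ drawn i.i.d. from a fixed strictly positive distribution on $V$; $\mu_V$ is the uniform measure on $\mathcal{R}_V$. It is known that $\mu_V$ converges weakly (as $V\uparrow\mathbb{Z}^d$) to a probability measure $\mu$ on $\Omega$. For $\eta\in\Omega$ and finite $V\ni x$, $N_V(x,y,\eta)$ is the number of topplings at $y$ needed to stabilize $\eta_V+\delta_x$ in $V$ (grains leaving $V$ disappear); it is non-decreasing in $V$, and $N(x,y,\eta)=\sup_V N_V(x,y,\eta)\in\{0,1,\dots,\infty\}$. *)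

theory Defs
  imports "HOL-Probability.Probability"
begin

text \<open>Sites of Z^d are functions 'd => int for a finite index type 'd, d = CARD('d).
  Configurations are functions from sites to int heights.\<close>

type_synonym 'd site = "'d \<Rightarrow> int"
type_synonym 'd config = "'d site \<Rightarrow> int"

definition dim :: "'d::finite site \<Rightarrow> int" where
  "dim x = int CARD('d)"

definition adjacent :: "'d::finite site \<Rightarrow> 'd site \<Rightarrow> bool" where
  "adjacent x y \<longleftrightarrow> (\<Sum>i\<in>UNIV. \<bar>x i - y i\<bar>) = 1"

definition Lap :: "'d::finite site \<Rightarrow> 'd site \<Rightarrow> int" where
  "Lap x y = (if x = y then 2 * int CARD('d) else if adjacent x y then -1 else 0)"

definition Omega :: "'d::finite config set" where
  "Omega = {\<eta>. \<forall>y. 1 \<le> \<eta> y \<and> \<eta> y \<le> 2 * int CARD('d)}"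

definition OmegaV :: "'d::finite site set \<Rightarrow> 'd config set" where
  "OmegaV V = {\<xi>. (\<forall>y\<in>V. 1 \<le> \<xi> y \<and> \<xi> y \<le> 2 * int CARD('d)) \<and> (\<forall>y. y \<notin> V \<longrightarrow> \<xi> y = 0)}"

definition restr :: "'d site set \<Rightarrow> 'd config \<Rightarrow> 'd config" where
  "restr V \<eta> = (\<lambda>y. if y \<in> V then \<eta> y else 0)"

definition topple :: "'d::finite site set \<Rightarrow> 'd site \<Rightarrow> 'd config \<Rightarrow> 'd config" where
  "topple V z \<xi> = (\<lambda>y. if y \<in> V then \<xi> y - Lap z y else \<xi> y)"

definition stable :: "'d::finite site set \<Rightarrow> 'd config \<Rightarrow> bool" where
  "stable V \<xi> \<longleftrightarrow> (\<forall>y\<in>V. \<xi> y \<le> 2 * int CARD('d))"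

inductive legal_seq :: "'d::finite site set \<Rightarrow> 'd config \<Rightarrow> 'd site list \<Rightarrow> 'd config \<Rightarrow> bool"
  for V where
  nil: "legal_seq V \<xi> [] \<xi>"
| cons: "z \<in> V \<Longrightarrow> \<xi> z > 2 * int CARD('d) \<Longrightarrow> legal_seq V (topple V z \<xi>) zs \<xi>'
         \<Longrightarrow> legal_seq V \<xi> (z # zs) \<xi>'"

definition stab :: "'d::finite site set \<Rightarrow> 'd config \<Rightarrow> 'd config" where
  "stab V \<xi> = (THE \<xi>'. \<exists>zs. legal_seq V \<xi> zs \<xi>' \<and> stable V \<xi>')"

definition addop :: "'d::finite site \<Rightarrow> 'd site set \<Rightarrow> 'd config \<Rightarrow> 'd config" where
  "addop x V \<xi> = stab V (\<xi>(x := \<xi> x + 1))"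

text \<open>One-step transition relation of the Markov chain (every x in V has positive probability).\<close>
definition chain_step :: "'d::finite site set \<Rightarrow> ('d config \<times> 'd config) set" where
  "chain_step V = {(\<xi>, addop x V \<xi>) | \<xi> x. \<xi> \<in> OmegaV V \<and> x \<in> V}"

definition Rec :: "'d::finite site set \<Rightarrow> 'd config set" where
  "Rec V = {\<xi> \<in> OmegaV V. \<forall>\<xi>'. (\<xi>, \<xi>') \<in> (chain_step V)\<^sup>* \<longrightarrow> (\<xi>', \<xi>) \<in> (chain_step V)\<^sup>*}"

definition muV :: "'d::finite site set \<Rightarrow> 'd config measure" where
  "muV V = measure_pmf (pmf_of_set (Rec V))"

definition sandpile_limit :: "'d::finite config measure \<Rightarrow> bool" where
  "sandpile_limit \<mu> \<longleftrightarrow> prob_space \<mu> \<and> sets \<mu> = sets borel \<and> emeasure \<mu> Omega = 1 \<and>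
     (\<forall>f :: 'd config \<Rightarrow> real. continuous_on UNIV f \<and> bounded (range f) \<longrightarrow>
        ((\<lambda>V. \<integral>\<xi>. f \<xi> \<partial>muV V) \<longlongrightarrow> (\<integral>\<eta>. f \<eta> \<partial>\<mu>)) (finite_subsets_at_top UNIV))"

definition NV :: "'d::finite site set \<Rightarrow> 'd site \<Rightarrow> 'd site \<Rightarrow> 'd config \<Rightarrow> nat" where
  "NV V x y \<eta> = (THE n. \<exists>zs \<xi>'. legal_seq V ((restr V \<eta>)(x := restr V \<eta> x + 1)) zs \<xi>'
                              \<and> stable V \<xi>' \<and> count_list zs y = n)"

definition Ntop :: "'d::finite site \<Rightarrow> 'd site \<Rightarrow> 'd config \<Rightarrow> enat" where
  "Ntop x y \<eta> = (SUP V\<in>{V. finite V \<and> x \<in> V}. enat (NV V x y \<eta>))"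

definition cluster :: "'d::finite site \<Rightarrow> 'd config \<Rightarrow> 'd site set" where
  "cluster x \<eta> = {y. Ntop x y \<eta> > 0}"

end

theory Submission
  imports Defs
begin

text \<open>An avalanche started at \<open>x\<close> is a succession of waves, and the wave emitted by a configuration \<open>\<xi>\<close> is the
  set burnt from \<open>x\<close> when \<open>\<xi>\<close> is restricted to \<open>V - {x}\<close>. Sending a recurrent configuration to a wave of its avalanche
  that leaves a cube is injective, because a wave determines the final stable configuration and addition operators are
  injective on recurrent configurations. So it suffices to count the allowed configurations on \<open>V - {x}\<close> whose burnt set is large,
  relative to the number of recurrent configurations on \<open>V\<close>.

  Reveal the burnt set edge by edge. The number of allowed configurations satisfies deletion-contraction, its ratio for
  \<open>V\<close> and \<open>V - {w}\<close> is an effective conductance, and the conductance \<open>M\<close> between the burnt part and the root (with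
  closed edges removed) is a supermartingale. If the part burnt inside a cube meets its boundary in \<open>k\<close> sites, then \<open>M\<close> is large
  when \<open>k\<close> is: outside the cube there are half-spaces, where a Sobolev inequality holds because \<open>d \<ge> 3\<close>. Hence \<open>k\<close> is bounded with
  high probability; and while \<open>k\<close> is bounded, transience of half-spaces gives a fixed positive chance that
  all edges leaving the cube are closed. So the probability of reaching radius \<open>n\<close> tends to 0 uniformly in \<open>V\<close>.\<close>

section \<open>Deletion and contraction for allowed configurations\<close>

text \<open>Within one wave no site topples twice, so a wave is a single burning process; keeping
  just one far wave per configuration removes any need to bound the number of waves. Behind the
  counts is a two-rooted spanning forest: allowed configurations on \<open>V - {x}\<close> are as
  numerous as spanning forests rooted at \<open>x\<close> and at the outside of \<open>V\<close>,
  and the set burnt from \<open>x\<close> plays the part of the tree of \<open>x\<close>. Since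
  \<open>num_allowed\<close> on \<open>V - {x}\<close> times the conductance from \<open>x\<close>
  is \<open>num_allowed\<close> on \<open>V\<close>, the supermartingale starts exactly at the
  number of recurrent configurations, the very quantity to compare with. The obstacle is that
  exploration deletes edges inside the cube, so no lattice estimate survives there. The half-spaces
  beyond its faces are untouched, which is why the Sobolev inequality is proved with a free
  boundary; the dimension enters through its three coordinate directions. Its constant 4096 is 16
  cubed, one factor 16 per direction from Cauchy-Schwarz.\<close>

text \<open>A graph is a finite symmetric set of ordered pairs; all vertices outside \<open>W\<close> play the role of the root (sink).\<close>

definition allowed :: "('v \<times> 'v) set \<Rightarrow> 'v set \<Rightarrow> ('v \<Rightarrow> int) \<Rightarrow> bool" where
  "allowed H W \<zeta> \<longleftrightarrow> (\<forall>F. F \<subseteq> W \<and> F \<noteq> {} \<longrightarrow> (\<exists>y\<in>F. int (card (H `` {y} \<inter> F)) < \<zeta> y))"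

text \<open>As many as the spanning trees of \<open>H\<close> with everything outside
  \<open>W\<close> glued into one root. The height bound is the degree in \<open>H\<close> itself,
  so that deleting an edge shrinks the set; the value 0 off \<open>W\<close> keeps it finite for
  finite \<open>W\<close>.\<close>

definition allowed_confs :: "('v \<times> 'v) set \<Rightarrow> 'v set \<Rightarrow> ('v \<Rightarrow> int) set" where
  "allowed_confs H W = {\<zeta>. (\<forall>y. y \<notin> W \<longrightarrow> \<zeta> y = 0) \<and> (\<forall>y\<in>W. \<zeta> y \<le> int (card (H `` {y}))) \<and> allowed H W \<zeta>}"

abbreviation num_allowed :: "('v \<times> 'v) set \<Rightarrow> 'v set \<Rightarrow> nat" where
  "num_allowed H W \<equiv> card (allowed_confs H W)"

definition del_edge :: "('v \<times> 'v) set \<Rightarrow> 'v \<Rightarrow> 'v \<Rightarrow> ('v \<times> 'v) set" where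
  "del_edge H u w = H - {(u, w), (w, u)}"

definition bilin :: "('v \<times> 'v) set \<Rightarrow> ('v \<Rightarrow> real) \<Rightarrow> ('v \<Rightarrow> real) \<Rightarrow> real" where
  "bilin H f g = (\<Sum>(y, z)\<in>H. (f y - f z) * (g y - g z)) / 2"

definition energy :: "('v \<times> 'v) set \<Rightarrow> ('v \<Rightarrow> real) \<Rightarrow> real" where
  "energy H f = bilin H f f"

definition potentials :: "'v set \<Rightarrow> 'v set \<Rightarrow> ('v \<Rightarrow> real) set" where
  "potentials K V = {f. (\<forall>y\<in>K. f y = 1) \<and> (\<forall>y. y \<notin> V \<longrightarrow> f y = 0)}"

text \<open>Dirichlet's principle: the effective conductance between \<open>K\<close> and the root
  when every edge has conductance 1.\<close>

definition conductance :: "('v \<times> 'v) set \<Rightarrow> 'v set \<Rightarrow> 'v set \<Rightarrow> real" where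
  "conductance H K V = Inf (energy H ` potentials K V)"

lemma allowed_pos: "allowed H W \<zeta> \<Longrightarrow> y \<in> W \<Longrightarrow> 1 \<le> \<zeta> y"
  unfolding allowed_def by (drule spec[of _ "{y}"]) auto

lemma allowed_mono:
  "allowed H W \<zeta> \<Longrightarrow> W' \<subseteq> W \<Longrightarrow> (\<And>y. y \<in> W' \<Longrightarrow> \<zeta> y \<le> \<xi> y) \<Longrightarrow> allowed H W' \<xi>"
  unfolding allowed_def by (meson order_less_le_trans order_trans subset_iff)

text \<open>Used for an edge deleted at \<open>w\<close>: once \<open>w\<close> has moved into the
  root, that edge joins two root vertices and is invisible.\<close>

lemma allowed_confs_cong:
  assumes "\<And>y. y \<in> W \<Longrightarrow> H `` {y} = H' `` {y}"
  shows "allowed_confs H W = allowed_confs H' W"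
proof -
  have "allowed H W \<zeta> \<longleftrightarrow> allowed H' W \<zeta>" for \<zeta>
  proof -
    have "(\<exists>y\<in>F. int (card (H `` {y} \<inter> F)) < \<zeta> y) \<longleftrightarrow> (\<exists>y\<in>F. int (card (H' `` {y} \<inter> F)) < \<zeta> y)"
      if "F \<subseteq> W" for F
      using that assms by (intro bex_cong) auto
    then show ?thesis unfolding allowed_def by blast
  qed
  then show ?thesis using assms unfolding allowed_confs_def by auto
qed

lemma finite_allowed_confs:
  assumes "finite W"
  shows "finite (allowed_confs H W)"
proof -
  define m where "m = (\<Sum>y\<in>W. int (card (H `` {y})))"
  have "int (card (H `` {y})) \<le> m" if "y \<in> W" for y
    unfolding m_def by (rule member_le_sum) (use that assms in auto)
  then have "allowed_confs H W \<subseteq> {f. \<forall>x. (x \<in> W \<longrightarrow> f x \<in> {1..m}) \<and> (x \<notin> W \<longrightarrow> f x = 0)}"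
    unfolding allowed_confs_def using allowed_pos order_trans by fastforce
  then show ?thesis
    using finite_set_of_finite_funs[OF assms, of "{1..m}" 0] finite_subset by blast
qed

lemma sym_del_edge: "sym H \<Longrightarrow> sym (del_edge H u w)"
  unfolding del_edge_def sym_def by auto

text \<open>Sort by the height at \<open>w\<close>. If it is maximal, no forbidden set can contain
  \<open>w\<close>, because \<open>u\<close> is always missing from it, so \<open>w\<close> may be
  absorbed into the root. If not, lowering the bound at \<open>w\<close> by one amounts to deleting
  the edge to \<open>u\<close>, which no subset of \<open>W\<close> sees. Sums are needed because
  the exploration weighs each configuration.\<close>

lemma sum_allowed_confs_split:
  fixes f :: "('v \<Rightarrow> int) \<Rightarrow> real"
  assumes H: "finite H" "sym H" and W: "finite W" "w \<in> W" and e: "(u, w) \<in> H" "u \<notin> W"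
  shows "sum f (allowed_confs H W) =
    (\<Sum>\<zeta>\<in>allowed_confs H (W - {w}). f (\<zeta>(w := int (card (H `` {w}))))) + sum f (allowed_confs (del_edge H u w) W)"
proof -
  let ?d = "int (card (H `` {w}))"
  have fin: "finite (H `` {y})" for y
    using H(1) by (simp add: finite_Image)
  have uw: "u \<in> H `` {w}" using e H(2) by (auto dest: symD)
  have del_w: "del_edge H u w `` {w} = H `` {w} - {u}"
    using e W unfolding del_edge_def by auto
  have del_y: "del_edge H u w `` {y} = H `` {y}" if "y \<in> W" "y \<noteq> w" for y
    using that e unfolding del_edge_def by auto
  have card_w: "int (card (del_edge H u w `` {w})) = ?d - 1"
  proof -
    have "card (H `` {w}) \<ge> 1" using uw fin[of w] by (simp add: Suc_le_eq card_gt_0_iff) blast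
    then show ?thesis using uw by (simp add: del_w card_Diff_singleton of_nat_diff)
  qed
  have inter: "del_edge H u w `` {y} \<inter> F = H `` {y} \<inter> F" if "y \<in> F" "F \<subseteq> W" for y F
    using that e del_w del_y by (cases "y = w") auto
  have allowed_del: "allowed (del_edge H u w) W \<zeta> \<longleftrightarrow> allowed H W \<zeta>" for \<zeta>
    unfolding allowed_def using inter by (metis (no_types, lifting))
  have low: "{\<zeta> \<in> allowed_confs H W. \<zeta> w < ?d} = allowed_confs (del_edge H u w) W"
  proof -
    have "(\<forall>y\<in>W. \<zeta> y \<le> int (card (del_edge H u w `` {y}))) \<longleftrightarrow>
          (\<forall>y\<in>W. \<zeta> y \<le> int (card (H `` {y}))) \<and> \<zeta> w < ?d" for \<zeta> :: "'v \<Rightarrow> int"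
    proof -
      have "(\<forall>y\<in>W. \<zeta> y \<le> int (card (del_edge H u w `` {y}))) \<longleftrightarrow>
         (\<forall>y\<in>W-{w}. \<zeta> y \<le> int (card (del_edge H u w `` {y}))) \<and> \<zeta> w \<le> ?d - 1"
        using W(2) card_w by auto
      also have "\<dots> \<longleftrightarrow> (\<forall>y\<in>W-{w}. \<zeta> y \<le> int (card (H `` {y}))) \<and> \<zeta> w \<le> ?d - 1"
        using del_y by auto
      also have "\<dots> \<longleftrightarrow> (\<forall>y\<in>W. \<zeta> y \<le> int (card (H `` {y}))) \<and> \<zeta> w < ?d"
        using W(2) by force
      finally show ?thesis .
    qed
    then show ?thesis
      unfolding allowed_confs_def using allowed_del by auto
  qed
  have high: "bij_betw (\<lambda>\<zeta>. \<zeta>(w := ?d)) (allowed_confs H (W - {w})) {\<zeta> \<in> allowed_confs H W. \<zeta> w = ?d}"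
  proof (rule bij_betw_byWitness[where f' = "\<lambda>\<zeta>. \<zeta>(w := 0)"])
    show "(\<lambda>\<zeta>. \<zeta>(w := 0)) ` {\<zeta> \<in> allowed_confs H W. \<zeta> w = ?d} \<subseteq> allowed_confs H (W - {w})"
    proof (rule image_subsetI)
      fix \<zeta> assume "\<zeta> \<in> {\<zeta> \<in> allowed_confs H W. \<zeta> w = ?d}"
      then have "allowed H W \<zeta>" "\<forall>y. y \<notin> W \<longrightarrow> \<zeta> y = 0" "\<forall>y\<in>W. \<zeta> y \<le> int (card (H `` {y}))"
        unfolding allowed_confs_def by auto
      moreover have "allowed H (W - {w}) (\<zeta>(w := 0))"
        using \<open>allowed H W \<zeta>\<close> by (rule allowed_mono) auto
      ultimately show "\<zeta>(w := 0) \<in> allowed_confs H (W - {w})"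
        unfolding allowed_confs_def by auto
    qed
    show "(\<lambda>\<zeta>. \<zeta>(w := ?d)) ` allowed_confs H (W - {w}) \<subseteq> {\<zeta> \<in> allowed_confs H W. \<zeta> w = ?d}"
    proof (rule image_subsetI)
      fix \<zeta> assume \<zeta>: "\<zeta> \<in> allowed_confs H (W - {w})"
      have "allowed H W (\<zeta>(w := ?d))"
        unfolding allowed_def
      proof (intro allI impI, elim conjE)
        fix F assume F: "F \<subseteq> W" "F \<noteq> {}"
        show "\<exists>y\<in>F. int (card (H `` {y} \<inter> F)) < (\<zeta>(w := ?d)) y"
        proof (cases "w \<in> F")
          case True
          have "H `` {w} \<inter> F \<subset> H `` {w}" using uw e F by auto
          then have "card (H `` {w} \<inter> F) < card (H `` {w})"
            using fin by (intro psubset_card_mono)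
          then show ?thesis using True by auto
        next
          case False
          then have "F \<subseteq> W - {w}" using F by auto
          then obtain y where y: "y \<in> F" "int (card (H `` {y} \<inter> F)) < \<zeta> y"
            using \<zeta> F(2) unfolding allowed_confs_def allowed_def by blast
          moreover have "y \<noteq> w" using y(1) False by blast
          ultimately show ?thesis by (intro bexI[of _ y]) simp_all
        qed
      qed
      then show "\<zeta>(w := ?d) \<in> {\<zeta> \<in> allowed_confs H W. \<zeta> w = ?d}"
        using \<zeta> W unfolding allowed_confs_def by auto
    qed
  qed (auto simp: allowed_confs_def fun_eq_iff)
  have "allowed_confs H W = {\<zeta> \<in> allowed_confs H W. \<zeta> w = ?d} \<union> {\<zeta> \<in> allowed_confs H W. \<zeta> w < ?d}"
    unfolding allowed_confs_def using W(2) by (auto simp: order_le_less)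
  moreover have "sum f ({\<zeta> \<in> allowed_confs H W. \<zeta> w = ?d} \<union> {\<zeta> \<in> allowed_confs H W. \<zeta> w < ?d}) =
      sum f {\<zeta> \<in> allowed_confs H W. \<zeta> w = ?d} + sum f {\<zeta> \<in> allowed_confs H W. \<zeta> w < ?d}"
    using finite_allowed_confs[OF W(1), of H] by (intro sum.union_disjoint) auto
  moreover have "sum f {\<zeta> \<in> allowed_confs H W. \<zeta> w = ?d} = (\<Sum>\<zeta>\<in>allowed_confs H (W - {w}). f (\<zeta>(w := ?d)))"
    using sum.reindex_bij_betw[OF high, of f] by simp
  ultimately show ?thesis
    using low by simp
qed

lemma num_allowed_deletion_contraction:
  assumes "finite H" "sym H" "finite W" "w \<in> W" "(u, w) \<in> H" "u \<notin> W"
  shows "num_allowed H W = num_allowed H (W - {w}) + num_allowed (del_edge H u w) W"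
  using sum_allowed_confs_split[OF assms, of "\<lambda>_. 1"] by simp

text \<open>Without edges to the root \<open>W\<close> itself is forbidden: the criterion would ask
  for a height above the degree.\<close>

lemma num_allowed_no_root:
  assumes W: "finite W" "W \<noteq> {}" and root: "\<And>y. y \<in> W \<Longrightarrow> H `` {y} \<subseteq> W"
  shows "num_allowed H W = 0"
proof -
  have "allowed_confs H W = {}"
  proof (rule ccontr)
    assume "allowed_confs H W \<noteq> {}"
    then obtain \<zeta> where "\<zeta> \<in> allowed_confs H W" by blast
    then have a: "\<And>y. y \<in> W \<Longrightarrow> \<zeta> y \<le> int (card (H `` {y}))" "allowed H W \<zeta>"
      by (auto simp: allowed_confs_def)
    from a(2) W obtain y where y: "y \<in> W" "int (card (H `` {y} \<inter> W)) < \<zeta> y"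
      unfolding allowed_def by blast
    have "H `` {y} \<inter> W = H `` {y}" using root[OF y(1)] by auto
    then show False using a(1)[OF y(1)] y by simp
  qed
  then show ?thesis by simp
qed

section \<open>Dirichlet energy, harmonic functions and conductance\<close>

lemma bilin_sym: "bilin H f g = bilin H g f"
  unfolding bilin_def by (simp add: mult.commute)

lemma bilin_add: "bilin H (\<lambda>y. f y + g y) h = bilin H f h + bilin H g h"
  unfolding bilin_def by (simp add: algebra_simps sum.distrib sum_subtractf case_prod_beta flip: add_divide_distrib diff_divide_distrib)

lemma bilin_scale: "bilin H (\<lambda>y. c * f y) h = c * bilin H f h"
proof -
  have "bilin H (\<lambda>y. c * f y) h = (\<Sum>(y, z)\<in>H. c * ((f y - f z) * (h y - h z))) / 2"
    unfolding bilin_def by (simp add: algebra_simps)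
  then show ?thesis
    unfolding bilin_def by (simp add: sum_distrib_left case_prod_beta)
qed

lemma energy_add_scale:
  "energy H (\<lambda>y. f y + t * g y) = energy H f + 2 * t * bilin H f g + t\<^sup>2 * energy H g"
proof -
  have "energy H (\<lambda>y. f y + t * g y) = bilin H f (\<lambda>y. f y + t * g y) + t * bilin H g (\<lambda>y. f y + t * g y)"
    unfolding energy_def by (simp add: bilin_add bilin_scale)
  also have "bilin H f (\<lambda>y. f y + t * g y) = bilin H f f + t * bilin H f g"
    by (subst bilin_sym) (simp add: bilin_add bilin_scale bilin_sym[of H g f])
  also have "bilin H g (\<lambda>y. f y + t * g y) = bilin H f g + t * bilin H g g"
    by (subst bilin_sym) (simp add: bilin_add bilin_scale)
  finally show ?thesis unfolding energy_def by (simp add: algebra_simps power2_eq_square)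
qed

lemma energy_add:
  "bilin H f g = 0 \<Longrightarrow> energy H (\<lambda>y. f y + g y) = energy H f + energy H g"
  using energy_add_scale[of H f 1 g] by simp

lemma energy_eq: "energy H f = (\<Sum>(y, z)\<in>H. (f y - f z)\<^sup>2) / 2"
  unfolding energy_def bilin_def by (simp add: power2_eq_square)

lemma energy_nonneg: "0 \<le> energy H f"
  unfolding energy_eq by (auto intro!: sum_nonneg)

text \<open>Deletions may cut a piece off from the root; energies then vanish and minimisation would
  divide by 0. This degenerate Cauchy-Schwarz inequality covers those cases.\<close>

lemma bilin_null:
  assumes "finite H" "energy H g = 0"
  shows "bilin H f g = 0"
proof -
  have "\<forall>p\<in>H. (g (fst p) - g (snd p))\<^sup>2 = 0"
    using assms by (subst sum_nonneg_eq_0_iff[symmetric]) (auto simp: energy_eq case_prod_beta)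
  then have "\<forall>p\<in>H. (f (fst p) - f (snd p)) * (g (fst p) - g (snd p)) = 0" by auto
  then show ?thesis unfolding bilin_def case_prod_beta by (simp only: sum.neutral)
qed

text \<open>Vertices are freed one at a time. A test function on the enlarged set is a multiple of
  \<open>\<theta>\<close>, the extension of the value 1 at \<open>u\<close>, plus a test function on
  \<open>U\<close>, so a single orthogonality condition remains at each stage.\<close>

lemma harmonic_extension:
  assumes "finite H" "finite U"
  shows "\<exists>\<phi>. (\<forall>y. y \<notin> U \<longrightarrow> \<phi> y = g y) \<and> (\<forall>\<psi>. (\<forall>y. y \<notin> U \<longrightarrow> \<psi> y = 0) \<longrightarrow> bilin H \<phi> \<psi> = 0)"
  using assms(2)
proof (induction U arbitrary: g)
  case empty
  have "bilin H g \<psi> = 0" if "\<forall>y. \<psi> y = 0" for \<psi>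
    using that unfolding bilin_def by simp
  then show ?case by (intro exI[of _ g]) auto
next
  case (insert u U)
  obtain \<phi> where \<phi>: "\<And>y. y \<notin> U \<Longrightarrow> \<phi> y = g y"
      "\<And>\<psi>. (\<And>y. y \<notin> U \<Longrightarrow> \<psi> y = 0) \<Longrightarrow> bilin H \<phi> \<psi> = 0"
    using insert.IH[of g] by blast
  obtain \<theta> where \<theta>: "\<And>y. y \<notin> U \<Longrightarrow> \<theta> y = of_bool (y = u)"
      "\<And>\<psi>. (\<And>y. y \<notin> U \<Longrightarrow> \<psi> y = 0) \<Longrightarrow> bilin H \<theta> \<psi> = 0"
    using insert.IH[of "\<lambda>y. of_bool (y = u)"] by blast
  \<comment> \<open>If \<open>\<theta>\<close> has energy 0, division by zero gives
    \<open>a = 0\<close>, which is harmless since then every product with \<open>\<theta>\<close>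
    vanishes.\<close>
  define a where "a = - bilin H \<phi> \<theta> / energy H \<theta>"
  define h where "h = (\<lambda>y. \<phi> y + a * \<theta> y)"
  have bil: "bilin H h \<psi> = bilin H \<phi> \<psi> + a * bilin H \<theta> \<psi>" for \<psi>
    unfolding h_def by (simp add: bilin_add bilin_scale)
  have "bilin H h \<theta> = 0"
  proof (cases "energy H \<theta> = 0")
    case True
    then show ?thesis by (rule bilin_null[OF assms(1)])
  next
    case False
    then show ?thesis unfolding bil by (simp add: a_def energy_def)
  qed
  moreover have "bilin H h \<psi> = \<psi> u * bilin H h \<theta>" if "\<forall>y. y \<notin> insert u U \<longrightarrow> \<psi> y = 0" for \<psi>
  proof -
    define \<psi>' where "\<psi>' = (\<lambda>y. \<psi> y + (- \<psi> u) * \<theta> y)"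
    have "\<psi>' y = 0" if "y \<notin> U" for y
      using that \<theta>(1)[OF that] \<open>\<forall>y. y \<notin> insert u U \<longrightarrow> \<psi> y = 0\<close> unfolding \<psi>'_def by auto
    then have "bilin H h \<psi>' = 0" unfolding bil using \<phi>(2) \<theta>(2) by simp
    moreover have "bilin H h \<psi>' = bilin H h \<psi> + (- \<psi> u) * bilin H h \<theta>"
      unfolding \<psi>'_def by (subst (1 2 3) bilin_sym) (simp only: bilin_add bilin_scale)
    ultimately show ?thesis by simp
  qed
  ultimately have "\<forall>\<psi>. (\<forall>y. y \<notin> insert u U \<longrightarrow> \<psi> y = 0) \<longrightarrow> bilin H h \<psi> = 0" by simp
  moreover have "\<forall>y. y \<notin> insert u U \<longrightarrow> h y = g y"
    unfolding h_def using \<phi>(1) \<theta>(1) by auto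
  ultimately show ?case by blast
qed

text \<open>The harmonic function with value 1 on \<open>K\<close> is orthogonal to its difference
  from any competitor, so Pythagoras makes it minimal.\<close>

lemma conductance_attained:
  assumes "finite H" "finite V" "K \<subseteq> V"
  obtains \<phi> where "\<phi> \<in> potentials K V" "conductance H K V = energy H \<phi>"
    "\<And>f. f \<in> potentials K V \<Longrightarrow> energy H \<phi> \<le> energy H f"
proof -
  obtain \<phi> where \<phi>: "\<And>y. y \<notin> V - K \<Longrightarrow> \<phi> y = of_bool (y \<in> K)"
      "\<And>\<psi>. (\<And>y. y \<notin> V - K \<Longrightarrow> \<psi> y = 0) \<Longrightarrow> bilin H \<phi> \<psi> = 0"
    using harmonic_extension[OF assms(1), of "V - K" "\<lambda>y. of_bool (y \<in> K)"] assms by blast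
  have pot: "\<phi> \<in> potentials K V"
    unfolding potentials_def using \<phi>(1) assms(3) by auto
  have min: "energy H \<phi> \<le> energy H f" if "f \<in> potentials K V" for f
  proof -
    define \<psi> where "\<psi> = (\<lambda>y. f y - \<phi> y)"
    have "bilin H \<phi> \<psi> = 0"
      by (rule \<phi>(2)) (use that pot in \<open>auto simp: \<psi>_def potentials_def\<close>)
    moreover have "energy H f = energy H (\<lambda>y. \<phi> y + \<psi> y)"
      by (simp add: \<psi>_def)
    ultimately show ?thesis
      using energy_nonneg[of H \<psi>] by (simp add: energy_add)
  qed
  have "conductance H K V = energy H \<phi>"
    unfolding conductance_def
    by (rule cInf_eq_minimum) (use pot min in auto)
  then show ?thesis using that pot min by blast
qed

lemma conductance_le:
  "f \<in> potentials K V \<Longrightarrow> conductance H K V \<le> energy H f"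
  unfolding conductance_def
  by (rule cInf_lower) (auto intro!: bdd_belowI[of _ 0] simp: energy_nonneg)

lemma conductance_nonneg:
  assumes "finite H" "finite V" "K \<subseteq> V"
  shows "0 \<le> conductance H K V"
  by (rule conductance_attained[OF assms]) (simp add: energy_nonneg)

lemma conductance_greatest:
  assumes "finite H" "finite V" "K \<subseteq> V" "\<And>f. f \<in> potentials K V \<Longrightarrow> c \<le> energy H f"
  shows "c \<le> conductance H K V"
  by (rule conductance_attained[OF assms(1-3)]) (simp add: assms(4))

text \<open>Both products are the Gram determinant of the harmonic functions with values (1, 0) and
  (0, 1) at \<open>v\<close> and \<open>w\<close>: with one vertex grounded the conductance is an
  energy, with it free a Schur complement. The determinant does not see the order of the two
  vertices.\<close>

lemma conductance_pair:
  assumes H: "finite H" and W: "finite W" "v \<in> W" "w \<in> W" "v \<noteq> w"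
  obtains \<phi> \<theta> where
    "conductance H {v} W * conductance H {w} (W - {v}) = energy H \<phi> * energy H \<theta> - (bilin H \<phi> \<theta>)\<^sup>2"
    "conductance H {w} W * conductance H {v} (W - {w}) = energy H \<phi> * energy H \<theta> - (bilin H \<phi> \<theta>)\<^sup>2"
proof -
  have ex: "\<exists>\<phi>. (\<forall>y. y \<notin> W - {v, w} \<longrightarrow> \<phi> y = of_bool (y = p)) \<and>
      (\<forall>\<psi>. (\<forall>y. y \<notin> W - {v, w} \<longrightarrow> \<psi> y = 0) \<longrightarrow> bilin H \<phi> \<psi> = 0)" for p
    by (rule harmonic_extension[OF H]) (use W in auto)
  obtain \<phi> where \<phi>: "\<And>y. y \<notin> W - {v, w} \<Longrightarrow> \<phi> y = of_bool (y = v)"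
      "\<And>\<psi>. (\<And>y. y \<notin> W - {v, w} \<Longrightarrow> \<psi> y = 0) \<Longrightarrow> bilin H \<phi> \<psi> = 0"
    using ex[of v] by blast
  obtain \<theta> where \<theta>: "\<And>y. y \<notin> W - {v, w} \<Longrightarrow> \<theta> y = of_bool (y = w)"
      "\<And>\<psi>. (\<And>y. y \<notin> W - {v, w} \<Longrightarrow> \<psi> y = 0) \<Longrightarrow> bilin H \<theta> \<psi> = 0"
    using ex[of w] by blast
  have gen: "conductance H {p} W * conductance H {q} (W - {p}) = energy H f * energy H g - (bilin H f g)\<^sup>2"
    if pq: "{p, q} = {v, w}" "p \<noteq> q"
      and f: "\<And>y. y \<notin> W - {p, q} \<Longrightarrow> f y = of_bool (y = p)"
      "\<And>\<psi>. (\<And>y. y \<notin> W - {p, q} \<Longrightarrow> \<psi> y = 0) \<Longrightarrow> bilin H f \<psi> = 0"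
      and g: "\<And>y. y \<notin> W - {p, q} \<Longrightarrow> g y = of_bool (y = q)"
      "\<And>\<psi>. (\<And>y. y \<notin> W - {p, q} \<Longrightarrow> \<psi> y = 0) \<Longrightarrow> bilin H g \<psi> = 0" for p q f g
  proof -
    have pqW: "p \<in> W" "q \<in> W" using pq W by auto
    have g_pot: "g \<in> potentials {q} (W - {p})"
      unfolding potentials_def using g(1) pq(2) pqW by auto
    have low: "energy H (\<lambda>y. f y + b * g y) \<le> energy H h"
      if h: "\<And>y. y \<notin> W \<Longrightarrow> h y = 0" "h p = 1" "h q = b" for h b
    proof -
      define \<psi> where "\<psi> = (\<lambda>y. h y - (f y + b * g y))"
      have z: "\<psi> y = 0" if "y \<notin> W - {p, q}" for y
        using that h f(1)[OF that] g(1)[OF that] pq(2) unfolding \<psi>_def by auto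
      have "bilin H (\<lambda>y. f y + b * g y) \<psi> = 0"
        using f(2)[OF z] g(2)[OF z] by (simp add: bilin_add bilin_scale)
      moreover have "energy H h = energy H (\<lambda>y. (f y + b * g y) + \<psi> y)"
        by (simp add: \<psi>_def)
      ultimately show ?thesis
        using energy_nonneg[of H \<psi>] by (simp add: energy_add)
    qed
    have Cq: "conductance H {q} (W - {p}) = energy H g"
    proof (rule antisym)
      show "energy H g \<le> conductance H {q} (W - {p})"
      proof (rule conductance_greatest)
        fix h assume h: "h \<in> potentials {q} (W - {p})"
        define \<psi> where "\<psi> = (\<lambda>y. h y - g y)"
        have "bilin H g \<psi> = 0"
          by (rule g(2)) (use h g_pot in \<open>auto simp: \<psi>_def potentials_def\<close>)
        moreover have "energy H h = energy H (\<lambda>y. g y + \<psi> y)"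
          by (simp add: \<psi>_def)
        ultimately show "energy H g \<le> energy H h"
          using energy_nonneg[of H \<psi>] by (simp add: energy_add)
      qed (use H W pq(2) pqW in auto)
    qed (rule conductance_le[OF g_pot])
    \<comment> \<open>The value at \<open>q\<close> that minimises the energy when \<open>q\<close>
      is left free.\<close>
    define b where "b = - bilin H f g / energy H g"
    have fb_pot: "(\<lambda>y. f y + t * g y) \<in> potentials {p} W" for t
      unfolding potentials_def using f(1) g(1) pq(2) pqW by auto
    have Cp: "conductance H {p} W = energy H (\<lambda>y. f y + b * g y)"
    proof (rule antisym)
      show "energy H (\<lambda>y. f y + b * g y) \<le> conductance H {p} W"
      proof (rule conductance_greatest)
        fix h assume h: "h \<in> potentials {p} W"
        have "energy H (\<lambda>y. f y + b * g y) \<le> energy H (\<lambda>y. f y + h q * g y)"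
        proof (cases "energy H g = 0")
          case True
          then show ?thesis
            using bilin_null[OF H True] by (simp add: energy_add_scale)
        next
          case False
          then have "energy H g > 0" using energy_nonneg[of H g] by simp
          moreover have "energy H (\<lambda>y. f y + h q * g y) - energy H (\<lambda>y. f y + b * g y) =
              energy H g * (h q - b)\<^sup>2"
          proof -
            have X: "bilin H f g = - b * energy H g" using False by (simp add: b_def)
            show ?thesis unfolding energy_add_scale X by (simp add: algebra_simps power2_eq_square)
          qed
          ultimately show ?thesis
            by (smt (verit, ccfv_threshold) mult_nonneg_nonneg zero_le_power2)
        qed
        also have "\<dots> \<le> energy H h"
          by (rule low) (use h in \<open>auto simp: potentials_def\<close>)
        finally show "energy H (\<lambda>y. f y + b * g y) \<le> energy H h" .
      qed (use H W pqW in auto)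
    qed (rule conductance_le[OF fb_pot])
    show ?thesis
    proof (cases "energy H g = 0")
      case True
      then show ?thesis using bilin_null[OF H True] by (simp add: Cp Cq)
    next
      case False
      then show ?thesis
        unfolding Cp Cq energy_add_scale b_def by (simp add: field_simps power2_eq_square)
    qed
  qed
  have "conductance H {v} W * conductance H {w} (W - {v}) = energy H \<phi> * energy H \<theta> - (bilin H \<phi> \<theta>)\<^sup>2"
    by (rule gen) (use \<phi> \<theta> W in auto)
  moreover have "conductance H {w} W * conductance H {v} (W - {w}) = energy H \<theta> * energy H \<phi> - (bilin H \<theta> \<phi>)\<^sup>2"
    by (rule gen) (use \<phi> \<theta> W in \<open>auto simp: insert_commute\<close>)
  ultimately show ?thesis using that by (simp add: bilin_sym[of H \<theta> \<phi>] mult.commute)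
qed

lemma energy_del_edge:
  assumes "finite H" "(u, w) \<in> H" "(w, u) \<in> H" "u \<noteq> w"
  shows "energy H f = energy (del_edge H u w) f + (f u - f w)\<^sup>2"
proof -
  have "(\<Sum>(y, z)\<in>H. (f y - f z)\<^sup>2) =
     (\<Sum>(y, z)\<in>del_edge H u w. (f y - f z)\<^sup>2) + (\<Sum>(y, z)\<in>{(u, w), (w, u)}. (f y - f z)\<^sup>2)"
    unfolding del_edge_def by (rule sum.subset_diff) (use assms in auto)
  then show ?thesis
    using assms(4) unfolding energy_eq by (simp add: power2_commute[of "f w"] add_divide_distrib)
qed

text \<open>Every competitor is 0 at \<open>u\<close> and 1 at \<open>w\<close>, so the edge adds
  exactly 1 to each energy and hence to the minimum.\<close>

lemma conductance_del_root_edge: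
  assumes "finite H" "sym H" "finite W" "w \<in> W" "(u, w) \<in> H" "u \<notin> W"
  shows "conductance H {w} W = conductance (del_edge H u w) {w} W + 1"
proof -
  have E: "energy H f = energy (del_edge H u w) f + 1" if "f \<in> potentials {w} W" for f
    using energy_del_edge[of H u w f] assms that unfolding potentials_def
    by (auto dest: symD)
  have fin: "finite (del_edge H u w)" using assms(1) by (simp add: del_edge_def)
  obtain \<phi> where \<phi>: "\<phi> \<in> potentials {w} W" "conductance (del_edge H u w) {w} W = energy (del_edge H u w) \<phi>"
    using conductance_attained[OF fin assms(3), of "{w}"] assms(4) by blast
  obtain \<theta> where \<theta>: "\<theta> \<in> potentials {w} W" "conductance H {w} W = energy H \<theta>"
    using conductance_attained[OF assms(1) assms(3), of "{w}"] assms(4) by blast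
  show ?thesis
    using conductance_le[OF \<phi>(1), of H] conductance_le[OF \<theta>(1), of "del_edge H u w"] E[OF \<phi>(1)] E[OF \<theta>(1)] \<phi> \<theta>
    by linarith
qed

text \<open>This is the matrix-tree theorem in disguise: both sides obey the same deletion-contraction
  recursion in the diagonal entry at a vertex joined to the root, and two vertices may be
  eliminated in either order.\<close>

lemma num_allowed_eq_conductance:
  assumes "finite H" "sym H" "irrefl H" "finite W" "w \<in> W"
  shows "real (num_allowed H W) = conductance H {w} W * real (num_allowed H (W - {w}))"
  using assms
proof (induction "card W + card H" arbitrary: W H w rule: less_induct)
  case less
  note H = less.prems(1-3) and W = less.prems(4,5)
  show ?case
  proof (cases "\<exists>v\<in>W. \<exists>u. (u, v) \<in> H \<and> u \<notin> W")
    case False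
    then have noroot: "\<And>y. y \<in> W \<Longrightarrow> H `` {y} \<subseteq> W" using H(2) by (auto dest: symD)
    \<comment> \<open>With no edge to the root the indicator of \<open>W\<close> costs no energy, so
      both sides of the claim are 0.\<close>
    define f :: "'a \<Rightarrow> real" where "f = (\<lambda>y. of_bool (y \<in> W))"
    have "f y = f z" if "(y, z) \<in> H" for y z
      using False that noroot unfolding f_def by auto
    then have "energy H f = 0" unfolding energy_eq by (auto intro!: sum.neutral)
    moreover have "f \<in> potentials {w} W" using W by (auto simp: f_def potentials_def)
    ultimately have "conductance H {w} W \<le> 0" using conductance_le[of f "{w}" W H] by simp
    then have "conductance H {w} W = 0" using conductance_nonneg[of H W "{w}"] H W by auto
    then show ?thesis using num_allowed_no_root[OF W(1) _ noroot] W by auto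
  next
    case True
    have root: "real (num_allowed H W) = conductance H {v} W * real (num_allowed H (W - {v}))"
      if v: "v \<in> W" "(u, v) \<in> H" "u \<notin> W" for u v
    proof -
      let ?H = "del_edge H u v"
      have fin: "finite ?H" using H by (simp add: del_edge_def)
      have "card ?H < card H"
        using H v unfolding del_edge_def by (intro psubset_card_mono) auto
      then have "real (num_allowed ?H W) = conductance ?H {v} W * real (num_allowed ?H (W - {v}))"
        using less.hyps[of W ?H v] H W v fin sym_del_edge[OF H(2)] by (auto simp: irrefl_def del_edge_def)
      moreover have "allowed_confs ?H (W - {v}) = allowed_confs H (W - {v})"
        by (rule allowed_confs_cong) (use v in \<open>auto simp: del_edge_def\<close>)
      ultimately have "real (num_allowed H W) = (1 + conductance ?H {v} W) * real (num_allowed H (W - {v}))"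
        using num_allowed_deletion_contraction[OF H(1,2) W(1) v] by (simp add: algebra_simps)
      then show ?thesis
        using conductance_del_root_edge[OF H(1,2) W(1) v] by simp
    qed
    obtain v u where v: "v \<in> W" "(u, v) \<in> H" "u \<notin> W" using True by blast
    show ?thesis
    proof (cases "v = w")
      case True
      then show ?thesis using root v by blast
    next
      case False
      obtain a where a: "conductance H {v} W * conductance H {w} (W - {v}) = a"
          "conductance H {w} W * conductance H {v} (W - {w}) = a"
        using conductance_pair[OF H(1) W(1) v(1) W(2) False] by metis
      have IH: "real (num_allowed H (W - {p})) = conductance H {q} (W - {p}) * real (num_allowed H (W - {p} - {q}))"
        if "p \<in> W" "q \<in> W" "p \<noteq> q" for p q
      proof -
        have "card (W - {p}) < card W" using that W by (meson card_Diff1_less)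
        then show ?thesis using less.hyps[of "W - {p}" H q] H W that by auto
      qed
      have swap: "W - {v} - {w} = W - {w} - {v}" by auto
      have "real (num_allowed H W) = conductance H {v} W * (conductance H {w} (W - {v}) * real (num_allowed H (W - {v} - {w})))"
        using root[OF v] IH[OF v(1) W(2) False] by simp
      also have "\<dots> = a * real (num_allowed H (W - {w} - {v}))"
        unfolding a(1)[symmetric] swap by simp
      also have "\<dots> = conductance H {w} W * (conductance H {v} (W - {w}) * real (num_allowed H (W - {w} - {v})))"
        unfolding a(2)[symmetric] by simp
      also have "\<dots> = conductance H {w} W * real (num_allowed H (W - {w}))"
        using IH[OF W(2) v(1)] False by simp
      finally show ?thesis .
    qed
  qed
qed

section \<open>Exploration of the burnt set\<close>

text \<open>The queried edge is open with weight 1 and closed with weight \<open>C\<close>. Starting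
  from \<open>f\<close>, optimal before the query, both outcomes are tested on \<open>f\<close> plus
  \<open>t\<close> times \<open>\<phi>\<close>: \<open>t = 1 - a\<close> raises \<open>w\<close> to
  1, and \<open>t = b\<close> is the best correction after deletion. What is lost is the square of
  \<open>1 - a - X\<close>.\<close>

lemma conductance_edge_step:
  assumes H: "finite H" "sym H" and V: "finite V" "K \<subseteq> V"
    and e: "(u, w) \<in> H" "u \<in> K" "w \<in> V - K"
  defines "H' \<equiv> del_edge H u w"
  defines "C \<equiv> conductance H' {w} (V - K)"
  shows "conductance H (insert w K) V + C * conductance H' K V \<le> (1 + C) * conductance H K V"
proof -
  have finH': "finite H'" using H(1) by (simp add: H'_def del_edge_def)
  have VK: "finite (V - K)" "{w} \<subseteq> V - K" using V e by auto
  obtain \<phi> where \<phi>: "\<phi> \<in> potentials {w} (V - K)" "C = energy H' \<phi>"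
    unfolding C_def by (rule conductance_attained[OF finH' VK])
  obtain f where f: "f \<in> potentials K V" "conductance H K V = energy H f"
    by (rule conductance_attained[OF H(1) V])
  define X where "X = bilin H' f \<phi>"
  define a where "a = f w"
  define b where "b = - X / C"
  have E: "energy H h = energy H' h + (h u - h w)\<^sup>2" for h
    unfolding H'_def using energy_del_edge[of H u w h] H e by (auto dest: symD)
  have f_pot: "(\<lambda>y. f y + t * \<phi> y) \<in> potentials K V" for t
    using f(1) \<phi>(1) unfolding potentials_def by auto
  have o: "(\<lambda>y. f y + (1 - a) * \<phi> y) \<in> potentials (insert w K) V"
    using f_pot[of "1 - a"] \<phi>(1) unfolding potentials_def a_def by auto
  have "conductance H (insert w K) V \<le> energy H (\<lambda>y. f y + (1 - a) * \<phi> y)"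
    by (rule conductance_le[OF o])
  also have "\<dots> = energy H' f + 2 * (1 - a) * X + (1 - a)\<^sup>2 * C"
    using o e unfolding E potentials_def by (simp add: energy_add_scale X_def \<phi>(2))
  finally have opened: "conductance H (insert w K) V \<le> energy H' f + 2 * (1 - a) * X + (1 - a)\<^sup>2 * C" .
  have C0: "0 \<le> C" unfolding \<phi>(2) by (rule energy_nonneg)
  have "conductance H' K V \<le> energy H' f + 2 * b * X + b\<^sup>2 * C"
    using conductance_le[OF f_pot, of H' b] by (simp add: energy_add_scale X_def \<phi>(2))
  then have "C * conductance H' K V \<le> C * (energy H' f + 2 * b * X + b\<^sup>2 * C)"
    using C0 by (rule mult_left_mono)
  also have "\<dots> = C * energy H' f - X\<^sup>2"
  proof (cases "C = 0")
    case True
    then show ?thesis using bilin_null[OF finH', of \<phi> f] by (simp add: X_def \<phi>(2))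
  next
    case False
    then show ?thesis unfolding b_def by (simp add: field_simps power2_eq_square)
  qed
  finally have closed: "C * conductance H' K V \<le> C * energy H' f - X\<^sup>2" .
  have "f u = 1" using f(1) e unfolding potentials_def by auto
  then have cond: "conductance H K V = energy H' f + (1 - a)\<^sup>2"
    unfolding f(2) E a_def by simp
  have "(1 + C) * (energy H' f + (1 - a)\<^sup>2) - (energy H' f + 2 * (1 - a) * X + (1 - a)\<^sup>2 * C) - (C * energy H' f - X\<^sup>2)
      = ((1 - a) - X)\<^sup>2"
    by (simp add: algebra_simps power2_eq_square)
  then have "energy H' f + 2 * (1 - a) * X + (1 - a)\<^sup>2 * C + (C * energy H' f - X\<^sup>2) \<le> (1 + C) * (energy H' f + (1 - a)\<^sup>2)"
    using zero_le_power2[of "(1 - a) - X"] by linarith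
  then show ?thesis using opened closed unfolding cond by linarith
qed

text \<open>The odds of closed against open for the queried edge are the conductance from
  \<open>w\<close> to everything outside \<open>W\<close> in the graph without that edge.\<close>

lemma num_allowed_del_edge:
  assumes "finite H" "sym H" "irrefl H" "finite W" "w \<in> W" "(u, w) \<in> H" "u \<notin> W"
  shows "real (num_allowed (del_edge H u w) W) =
    conductance (del_edge H u w) {w} W * real (num_allowed H (W - {w}))"
proof -
  have "allowed_confs (del_edge H u w) (W - {w}) = allowed_confs H (W - {w})"
    by (rule allowed_confs_cong) (use assms in \<open>auto simp: del_edge_def\<close>)
  then show ?thesis
    using num_allowed_eq_conductance[of "del_edge H u w" W w] assms sym_del_edge[of H u w]
    by (auto simp: del_edge_def irrefl_def)
qed

text \<open>The conductance from the explored set to the root is a supermartingale under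
  edge-by-edge exploration of a uniform allowed configuration.\<close>

lemma num_allowed_conductance_step:
  assumes H: "finite H" "sym H" "irrefl H" and V: "finite V" "K \<subseteq> V"
    and e: "(u, w) \<in> H" "u \<in> K" "w \<in> V - K"
  shows "real (num_allowed H (V - insert w K)) * conductance H (insert w K) V
      + real (num_allowed (del_edge H u w) (V - K)) * conductance (del_edge H u w) K V
    \<le> real (num_allowed H (V - K)) * conductance H K V"
proof -
  define C where "C = conductance (del_edge H u w) {w} (V - K)"
  define N where "N = real (num_allowed H (V - insert w K))"
  have eq: "V - K - {w} = V - insert w K" by auto
  have closed: "real (num_allowed (del_edge H u w) (V - K)) = C * N"
    using num_allowed_del_edge[OF H(1-3), of "V - K" w u] V e unfolding C_def N_def eq by auto
  have "real (num_allowed H (V - K)) = N + C * N"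
    using num_allowed_deletion_contraction[OF H(1,2), of "V - K" w u] V e closed
    unfolding N_def eq by auto
  then have total: "real (num_allowed H (V - K)) = N * (1 + C)" by (simp add: algebra_simps)
  have "N * (conductance H (insert w K) V + C * conductance (del_edge H u w) K V)
      \<le> N * ((1 + C) * conductance H K V)"
    using conductance_edge_step[OF H(1,2) V e] unfolding C_def N_def by (intro mult_left_mono) auto
  then show ?thesis unfolding closed total by (simp add: N_def algebra_simps)
qed

text \<open>Edges of \<open>D\<close> are closed one after another; odds of at least
  \<open>c\<close> cost a factor \<open>c / (1 + c)\<close> each. The conductance bound must hold in
  every intermediate graph, whence the quantification over \<open>H'\<close>.\<close>

lemma num_allowed_remove_edges:
  assumes "finite D" "finite H" "sym H" "irrefl H" "finite W" "0 < c"
    and "\<And>u w. (u, w) \<in> D \<Longrightarrow> (u, w) \<in> H \<and> u \<notin> W \<and> w \<in> W"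
    and "\<And>H' u w. \<lbrakk>H' \<subseteq> H; finite H'; H - H' \<subseteq> D \<union> D\<inverse>; (u, w) \<in> D\<rbrakk> \<Longrightarrow> c \<le> conductance H' {w} W"
  shows "(c / (1 + c)) ^ card D * real (num_allowed H W) \<le> real (num_allowed (H - D - D\<inverse>) W)"
  using assms
proof (induction D arbitrary: H)
  case empty
  then show ?case by simp
next
  case (insert e D)
  obtain u w where e: "e = (u, w)" by fastforce
  let ?H = "del_edge H u w"
  note H = insert.prems(1-3)
  have uw: "(u, w) \<in> H" "u \<notin> W" "w \<in> W" using insert.prems(6)[of u w] e by auto
  have H': "finite ?H" "sym ?H" "irrefl ?H" "?H \<subseteq> H"
    using H sym_del_edge[OF H(2)] by (auto simp: del_edge_def irrefl_def)
  have C: "c \<le> conductance ?H {w} W"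
    by (rule insert.prems(7)[of _ u]) (use H' e in \<open>auto simp: del_edge_def\<close>)
  define N where "N = real (num_allowed H (W - {w}))"
  have closed: "real (num_allowed ?H W) = conductance ?H {w} W * N"
    using num_allowed_del_edge[OF H insert.prems(4)] uw by (simp add: N_def)
  have "real (num_allowed H W) = N + real (num_allowed ?H W)"
    using num_allowed_deletion_contraction[OF H(1,2) insert.prems(4)] uw by (simp add: N_def)
  moreover have "c * N \<le> real (num_allowed ?H W)"
    unfolding closed by (rule mult_right_mono[OF C]) (simp add: N_def)
  ultimately have one: "c / (1 + c) * real (num_allowed H W) \<le> real (num_allowed ?H W)"
    using insert.prems(5) by (simp add: field_simps)
  have IH: "(c / (1 + c)) ^ card D * real (num_allowed ?H W) \<le> real (num_allowed (?H - D - D\<inverse>) W)"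
  proof (rule insert.IH)
    fix a b assume ab: "(a, b) \<in> D"
    have "(a, b) \<in> H \<and> a \<notin> W \<and> b \<in> W" using insert.prems(6)[of a b] ab by auto
    moreover have "(a, b) \<noteq> (u, w)" using ab insert.hyps e by auto
    ultimately show "(a, b) \<in> ?H \<and> a \<notin> W \<and> b \<in> W"
      using uw by (auto simp: del_edge_def)
  next
    fix H' a b assume a: "H' \<subseteq> ?H" "finite H'" "?H - H' \<subseteq> D \<union> D\<inverse>" "(a, b) \<in> D"
    show "c \<le> conductance H' {b} W"
    proof (rule insert.prems(7)[of H' a])
      show "H' \<subseteq> H" using a(1) H'(4) by (rule subset_trans)
      show "H - H' \<subseteq> insert e D \<union> (insert e D)\<inverse>"
        using a(3) unfolding e del_edge_def by blast
    qed (use a in auto)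
  qed (use H' insert.prems insert.hyps in auto)
  have "?H - D - D\<inverse> = H - insert e D - (insert e D)\<inverse>"
    unfolding e del_edge_def by auto
  moreover have "(c / (1 + c)) ^ card (insert e D) * real (num_allowed H W)
      = (c / (1 + c)) ^ card D * (c / (1 + c) * real (num_allowed H W))"
    using insert.hyps by simp
  moreover have "\<dots> \<le> (c / (1 + c)) ^ card D * real (num_allowed ?H W)"
    using one insert.prems(5) by (intro mult_left_mono) auto
  ultimately show ?case using IH by simp
qed

text \<open>Dhar's burning started from \<open>K\<close> and confined to \<open>B\<close>: a site
  burns once its height exceeds the number of its unburnt neighbours. Degrees are those of the
  original graph \<open>G\<close>, whatever edges have been found closed.\<close>

definition burnt :: "('v \<times> 'v) set \<Rightarrow> 'v set \<Rightarrow> 'v set \<Rightarrow> ('v \<Rightarrow> int) \<Rightarrow> 'v set" where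
  "burnt G B K \<zeta> = \<Inter>{S. K \<subseteq> S \<and> (\<forall>y\<in>B. int (card (G `` {y})) < \<zeta> y + int (card (G `` {y} \<inter> S)) \<longrightarrow> y \<in> S)}"

lemma burnt_superset: "K \<subseteq> burnt G B K \<zeta>"
  unfolding burnt_def by auto

lemma burnt_closed:
  assumes "finite G" "y \<in> B" "int (card (G `` {y})) < \<zeta> y + int (card (G `` {y} \<inter> burnt G B K \<zeta>))"
  shows "y \<in> burnt G B K \<zeta>"
  unfolding burnt_def
proof (rule InterI, clarify)
  fix S assume S: "K \<subseteq> S" "\<forall>y\<in>B. int (card (G `` {y})) < \<zeta> y + int (card (G `` {y} \<inter> S)) \<longrightarrow> y \<in> S"
  have "burnt G B K \<zeta> \<subseteq> S" unfolding burnt_def using S by auto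
  then have "card (G `` {y} \<inter> burnt G B K \<zeta>) \<le> card (G `` {y} \<inter> S)"
    using assms(1) by (intro card_mono) (auto simp: finite_Image)
  then show "y \<in> S" using S(2) assms(2,3) by force
qed

lemma burnt_least:
  assumes "K \<subseteq> S"
    and "\<And>y. y \<in> B \<Longrightarrow> int (card (G `` {y})) < \<zeta> y + int (card (G `` {y} \<inter> S)) \<Longrightarrow> y \<in> S"
  shows "burnt G B K \<zeta> \<subseteq> S"
  unfolding burnt_def using assms by auto

lemma burnt_subset: "burnt G B K \<zeta> \<subseteq> K \<union> B"
  by (rule burnt_least) auto

text \<open>Once \<open>w\<close> burns its height is never consulted again, so it may be
  overwritten and \<open>w\<close> moved into the source.\<close>

lemma burnt_insert:
  assumes "finite G" "w \<in> burnt G B K \<zeta>" "\<And>y. y \<notin> insert w K \<Longrightarrow> \<xi> y = \<zeta> y"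
  shows "burnt G B (insert w K) \<xi> = burnt G B K \<zeta>"
proof
  have sup: "insert w K \<subseteq> burnt G B K \<zeta>" "insert w K \<subseteq> burnt G B (insert w K) \<xi>"
    using assms(2) burnt_superset[of K G B \<zeta>] burnt_superset[of "insert w K" G B \<xi>] by auto
  show "burnt G B (insert w K) \<xi> \<subseteq> burnt G B K \<zeta>"
  proof (rule burnt_least)
    show "insert w K \<subseteq> burnt G B K \<zeta>" by (rule sup(1))
    fix y assume y: "y \<in> B" "int (card (G `` {y})) < \<xi> y + int (card (G `` {y} \<inter> burnt G B K \<zeta>))"
    show "y \<in> burnt G B K \<zeta>"
    proof (cases "y \<in> insert w K")
      case True
      then show ?thesis using sup(1) by blast
    next
      case False
      then show ?thesis using y burnt_closed[OF assms(1) y(1)] assms(3)[OF False] by simp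
    qed
  qed
  show "burnt G B K \<zeta> \<subseteq> burnt G B (insert w K) \<xi>"
  proof (rule burnt_least)
    show "K \<subseteq> burnt G B (insert w K) \<xi>" using sup(2) by blast
    fix y assume y: "y \<in> B" "int (card (G `` {y})) < \<zeta> y + int (card (G `` {y} \<inter> burnt G B (insert w K) \<xi>))"
    show "y \<in> burnt G B (insert w K) \<xi>"
    proof (cases "y \<in> insert w K")
      case True
      then show ?thesis using sup(2) by blast
    next
      case False
      then show ?thesis using y burnt_closed[OF assms(1) y(1), of \<xi>] assms(3)[OF False] by simp
    qed
  qed
qed

lemma burnt_trivial:
  assumes "finite G" "\<And>y. y \<in> B - K \<Longrightarrow> \<zeta> y \<le> int (card (G `` {y} - K))"
  shows "burnt G B K \<zeta> = K"
proof
  show "burnt G B K \<zeta> \<subseteq> K"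
  proof (rule burnt_least)
    fix y assume y: "y \<in> B" "int (card (G `` {y})) < \<zeta> y + int (card (G `` {y} \<inter> K))"
    have "card (G `` {y}) = card (G `` {y} - K) + card (G `` {y} \<inter> K)"
      using card_Int_Diff[of "G `` {y}" K] assms(1) by (simp add: finite_Image)
    then show "y \<in> K" using assms(2)[of y] y by (cases "y \<in> K") auto
  qed auto
qed (rule burnt_superset)

text \<open>States of the exploration: \<open>K\<close> is burnt so far, and the edges of \<open>G - H\<close> have been found closed.
  The functional \<open>g\<close> dominates because it is superadditive along the two outcomes of each query.\<close>

lemma exploration_bound:
  fixes F :: "'v set \<Rightarrow> 'v set \<Rightarrow> real" and g :: "('v \<times> 'v) set \<Rightarrow> 'v set \<Rightarrow> real"
  assumes G: "finite G" "sym G" "irrefl G" and V: "finite V" "B \<subseteq> B'" "B' \<subseteq> V"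
    and step: "\<And>H K u w. \<lbrakk>finite H; sym H; irrefl H; K \<subseteq> V; (u, w) \<in> H; u \<in> K; w \<in> V - K\<rbrakk>
        \<Longrightarrow> g H (insert w K) + g (del_edge H u w) K \<le> g H K"
    and final: "\<And>H K. \<lbrakk>H \<subseteq> G; sym H; G - H \<subseteq> K \<times> B \<union> B \<times> K; K0 \<subseteq> K; K \<subseteq> K0 \<union> B;
        \<And>u w. (u, w) \<in> H \<Longrightarrow> u \<in> K \<Longrightarrow> w \<notin> B - K\<rbrakk>
        \<Longrightarrow> (\<Sum>\<zeta>\<in>allowed_confs H (V - K). F K (burnt G B' K \<zeta>)) \<le> g H K"
    and state: "H \<subseteq> G" "sym H" "G - H \<subseteq> K \<times> B \<union> B \<times> K" "K0 \<subseteq> K" "K \<subseteq> K0 \<union> B" "K0 \<subseteq> V"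
  shows "(\<Sum>\<zeta>\<in>allowed_confs H (V - K). F (burnt G B K \<zeta>) (burnt G B' K \<zeta>)) \<le> g H K"
  using state(1-5)
proof (induction "card H + card (V - K)" arbitrary: H K rule: less_induct)
  case less
  note st = less.prems
  have H: "finite H" "sym H" "irrefl H"
    using st G finite_subset by (auto simp: irrefl_def)
  have KV: "K \<subseteq> V" using st(5) state(6) V by blast
  show ?case
  proof (cases "\<exists>u w. (u, w) \<in> H \<and> u \<in> K \<and> w \<in> B - K")
    case False
    have "burnt G B K \<zeta> = K" if "\<zeta> \<in> allowed_confs H (V - K)" for \<zeta>
    proof (rule burnt_trivial[OF G(1)])
      fix y assume y: "y \<in> B - K"
      \<comment> \<open>With no query left, the edges remaining in \<open>H\<close> at
        \<open>y\<close> lead to unburnt sites, so the height bound by the degree in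
        \<open>H\<close> forbids burning.\<close>
      have "H `` {y} \<subseteq> G `` {y} - K"
        using False y st(1) H(2) by (auto dest: symD)
      then have "card (H `` {y}) \<le> card (G `` {y} - K)"
        using G(1) by (intro card_mono) (auto simp: finite_Image)
      moreover have "\<zeta> y \<le> int (card (H `` {y}))"
        using that y V unfolding allowed_confs_def by auto
      ultimately show "\<zeta> y \<le> int (card (G `` {y} - K))" by linarith
    qed
    then have "(\<Sum>\<zeta>\<in>allowed_confs H (V - K). F (burnt G B K \<zeta>) (burnt G B' K \<zeta>))
        = (\<Sum>\<zeta>\<in>allowed_confs H (V - K). F K (burnt G B' K \<zeta>))"
      by (intro sum.cong) auto
    also have "\<dots> \<le> g H K"
      by (rule final) (use st False in auto)
    finally show ?thesis .
  next
    case True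
    then obtain u w where e: "(u, w) \<in> H" "u \<in> K" "w \<in> B - K" by blast
    have w: "w \<in> V - K" "w \<in> B'" "u \<notin> V - K" using e V by auto
    let ?H = "del_edge H u w"
    let ?d = "int (card (H `` {w}))"
    have eq: "V - K - {w} = V - insert w K" by auto
    have split: "(\<Sum>\<zeta>\<in>allowed_confs H (V - K). F (burnt G B K \<zeta>) (burnt G B' K \<zeta>)) =
        (\<Sum>\<zeta>\<in>allowed_confs H (V - insert w K). F (burnt G B K (\<zeta>(w := ?d))) (burnt G B' K (\<zeta>(w := ?d)))) +
        (\<Sum>\<zeta>\<in>allowed_confs ?H (V - K). F (burnt G B K \<zeta>) (burnt G B' K \<zeta>))"
      using sum_allowed_confs_split[OF H(1,2), of "V - K" w u] V(1) w(1) e(1) w(3) unfolding eq by simp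
    have burns: "burnt G A K (\<zeta>(w := ?d)) = burnt G A (insert w K) \<zeta>" if A: "w \<in> A" for A \<zeta>
    proof (rule burnt_insert[symmetric, OF G(1)])
      \<comment> \<open>Edges found closed at \<open>w\<close> all lead to \<open>K\<close>. The
        edge to \<open>u\<close> belongs to both parts, and this overlap is the strict inequality by
        which the maximal height burns.\<close>
      have "G `` {w} = H `` {w} \<union> (G `` {w} \<inter> K)"
        using st(1,3) e(3) by auto
      then have "card (G `` {w}) + card (H `` {w} \<inter> (G `` {w} \<inter> K)) = card (H `` {w}) + card (G `` {w} \<inter> K)"
        using card_Un_Int[of "H `` {w}" "G `` {w} \<inter> K"] G(1) H(1) by (simp add: finite_Image)
      moreover have "u \<in> H `` {w} \<inter> (G `` {w} \<inter> K)" using e H(2) st(1) by (auto dest: symD)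
      then have "0 < card (H `` {w} \<inter> (G `` {w} \<inter> K))"
        using H(1) by (auto simp: card_gt_0_iff finite_Image)
      moreover have "card (G `` {w} \<inter> K) \<le> card (G `` {w} \<inter> burnt G A K (\<zeta>(w := ?d)))"
        using burnt_superset[of K G A "\<zeta>(w := ?d)"] G(1) by (intro card_mono) (auto simp: finite_Image)
      ultimately show "w \<in> burnt G A K (\<zeta>(w := ?d))"
        by (intro burnt_closed[OF G(1) A]) simp
    qed auto
    have openIH: "(\<Sum>\<zeta>\<in>allowed_confs H (V - insert w K). F (burnt G B (insert w K) \<zeta>) (burnt G B' (insert w K) \<zeta>)) \<le> g H (insert w K)"
    proof (rule less.hyps)
      have "card (V - insert w K) < card (V - K)"
        using V(1) w(1) by (intro psubset_card_mono) auto
      then show "card H + card (V - insert w K) < card H + card (V - K)" by simp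
    qed (use st e in auto)
    have closedIH: "(\<Sum>\<zeta>\<in>allowed_confs ?H (V - K). F (burnt G B K \<zeta>) (burnt G B' K \<zeta>)) \<le> g ?H K"
    proof (rule less.hyps)
      have "card ?H < card H"
        using H(1) e unfolding del_edge_def by (intro psubset_card_mono) auto
      then show "card ?H + card (V - K) < card H + card (V - K)" by simp
    qed (use st e sym_del_edge[OF H(2)] in \<open>auto simp: del_edge_def\<close>)
    show ?thesis
      using openIH closedIH step[OF H KV e(1,2) w(1)] unfolding split using burns e(3) w(2) by simp
  qed
qed

section \<open>A discrete Sobolev inequality\<close>

text \<open>Cauchy-Schwarz twice: over the pairs (s, t) to detach \<open>c\<close>, then over
  \<open>u\<close> for fixed \<open>s\<close> and \<open>t\<close> to separate \<open>a\<close> from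
  \<open>b\<close>.\<close>

lemma loomis_whitney:
  fixes a b c :: "nat \<Rightarrow> nat \<Rightarrow> real"
  shows "(\<Sum>s<N. \<Sum>t<N. \<Sum>u<N. a t u * b s u * c s t)\<^sup>2 \<le>
    (\<Sum>t<N. \<Sum>u<N. (a t u)\<^sup>2) * (\<Sum>s<N. \<Sum>u<N. (b s u)\<^sup>2) * (\<Sum>s<N. \<Sum>t<N. (c s t)\<^sup>2)"
proof -
  let ?I = "{..<N} \<times> {..<N}"
  define h where "h = (\<lambda>s t. \<Sum>u<N. a t u * b s u)"
  have "(\<Sum>s<N. \<Sum>t<N. \<Sum>u<N. a t u * b s u * c s t) = (\<Sum>s<N. \<Sum>t<N. h s t * c s t)"
    unfolding h_def by (simp add: sum_distrib_right)
  also have "\<dots> = (\<Sum>p\<in>?I. h (fst p) (snd p) * c (fst p) (snd p))"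
    by (simp add: sum.cartesian_product case_prod_beta)
  finally have "(\<Sum>s<N. \<Sum>t<N. \<Sum>u<N. a t u * b s u * c s t)\<^sup>2 \<le>
      (\<Sum>p\<in>?I. (h (fst p) (snd p))\<^sup>2) * (\<Sum>p\<in>?I. (c (fst p) (snd p))\<^sup>2)"
    using Cauchy_Schwarz_ineq_sum[of "\<lambda>p. h (fst p) (snd p)" "\<lambda>p. c (fst p) (snd p)" ?I] by simp
  also have "\<dots> = (\<Sum>s<N. \<Sum>t<N. (h s t)\<^sup>2) * (\<Sum>s<N. \<Sum>t<N. (c s t)\<^sup>2)"
    by (simp add: sum.cartesian_product case_prod_beta)
  also have "\<dots> \<le> (\<Sum>s<N. \<Sum>t<N. (\<Sum>u<N. (a t u)\<^sup>2) * (\<Sum>u<N. (b s u)\<^sup>2)) * (\<Sum>s<N. \<Sum>t<N. (c s t)\<^sup>2)"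
    unfolding h_def by (intro mult_right_mono sum_mono Cauchy_Schwarz_ineq_sum sum_nonneg zero_le_power2)
  also have "(\<Sum>s<N. \<Sum>t<N. (\<Sum>u<N. (a t u)\<^sup>2) * (\<Sum>u<N. (b s u)\<^sup>2)) =
      (\<Sum>t<N. \<Sum>u<N. (a t u)\<^sup>2) * (\<Sum>s<N. \<Sum>u<N. (b s u)\<^sup>2)"
    by (subst sum_product, subst sum.swap) (rule refl)
  finally show ?thesis .
qed

lemma le_sum_abs_increments:
  fixes g :: "nat \<Rightarrow> real"
  assumes "g N = 0" "s \<le> N"
  shows "g s \<le> (\<Sum>r<N. \<bar>g (Suc r) - g r\<bar>)"
proof -
  have "g s = - (\<Sum>r=s..<N. g (Suc r) - g r)"
    using assms by (simp add: sum_Suc_diff')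
  also have "\<dots> \<le> (\<Sum>r=s..<N. \<bar>g (Suc r) - g r\<bar>)"
    unfolding sum_negf[symmetric] by (rule sum_mono) simp
  also have "\<dots> \<le> (\<Sum>r<N. \<bar>g (Suc r) - g r\<bar>)"
    by (rule sum_mono2) auto
  finally show ?thesis .
qed

lemma abs_diff_power4_le:
  fixes x y :: real
  shows "\<bar>x^4 - y^4\<bar> \<le> \<bar>x - y\<bar> * (2 * (\<bar>x\<bar>^3 + \<bar>y\<bar>^3))"
proof -
  have "x^4 - y^4 = (x - y) * ((x + y) * (x\<^sup>2 + y\<^sup>2))"
    by (simp add: algebra_simps power2_eq_square power4_eq_xxxx)
  then have "\<bar>x^4 - y^4\<bar> = \<bar>x - y\<bar> * (\<bar>x + y\<bar> * (x\<^sup>2 + y\<^sup>2))"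
    by (simp add: abs_mult)
  also have "\<dots> \<le> \<bar>x - y\<bar> * (2 * (\<bar>x\<bar>^3 + \<bar>y\<bar>^3))"
  proof (rule mult_left_mono)
    have "\<bar>x + y\<bar> * (x\<^sup>2 + y\<^sup>2) \<le> (\<bar>x\<bar> + \<bar>y\<bar>) * (\<bar>x\<bar>\<^sup>2 + \<bar>y\<bar>\<^sup>2)"
      by (simp add: abs_triangle_ineq mult_right_mono)
    moreover have "2 * (p^3 + q^3) - (p + q) * (p\<^sup>2 + q\<^sup>2) = (p + q) * (p - q)\<^sup>2" for p q :: real
      by (simp add: algebra_simps power2_eq_square power3_eq_cube)
    moreover have "0 \<le> (\<bar>x\<bar> + \<bar>y\<bar>) * (\<bar>x\<bar> - \<bar>y\<bar>)\<^sup>2" by simp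
    ultimately show "\<bar>x + y\<bar> * (x\<^sup>2 + y\<^sup>2) \<le> 2 * (\<bar>x\<bar>^3 + \<bar>y\<bar>^3)"
      by smt
  qed simp
  finally show ?thesis .
qed

text \<open>A difference of fourth powers is a difference times a cubic, and Cauchy-Schwarz squares
  the cubic into sixth powers. The exponent 4 is chosen so that the quantity to be bounded reappears
  and can be cancelled.\<close>

lemma sum_abs_diff_power4_le:
  fixes x y :: "'i \<Rightarrow> real"
  assumes "(\<Sum>i\<in>I. x i ^ 6) \<le> Q" "(\<Sum>i\<in>I. y i ^ 6) \<le> Q"
  shows "(\<Sum>i\<in>I. \<bar>x i ^ 4 - y i ^ 4\<bar>)\<^sup>2 \<le> 16 * (\<Sum>i\<in>I. (x i - y i)\<^sup>2) * Q"
proof -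
  have "(\<Sum>i\<in>I. \<bar>x i ^ 4 - y i ^ 4\<bar>)\<^sup>2 \<le> (\<Sum>i\<in>I. \<bar>x i - y i\<bar> * (2 * (\<bar>x i\<bar>^3 + \<bar>y i\<bar>^3)))\<^sup>2"
    by (intro power_mono sum_mono abs_diff_power4_le sum_nonneg) simp
  also have "\<dots> \<le> (\<Sum>i\<in>I. \<bar>x i - y i\<bar>\<^sup>2) * (\<Sum>i\<in>I. (2 * (\<bar>x i\<bar>^3 + \<bar>y i\<bar>^3))\<^sup>2)"
    by (rule Cauchy_Schwarz_ineq_sum)
  also have "\<dots> \<le> (\<Sum>i\<in>I. \<bar>x i - y i\<bar>\<^sup>2) * (\<Sum>i\<in>I. 8 * x i ^ 6 + 8 * y i ^ 6)"
  proof (intro mult_left_mono sum_mono sum_nonneg)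
    fix i
    have "(2 * (p + q))\<^sup>2 \<le> 8 * p\<^sup>2 + 8 * q\<^sup>2" for p q :: real
    proof -
      have "8 * p\<^sup>2 + 8 * q\<^sup>2 - (2 * (p + q))\<^sup>2 = 4 * (p - q)\<^sup>2"
        by (simp add: algebra_simps power2_eq_square)
      then show ?thesis using zero_le_power2[of "p - q"] by linarith
    qed
    from this[of "\<bar>x i\<bar>^3" "\<bar>y i\<bar>^3"]
    show "(2 * (\<bar>x i\<bar>^3 + \<bar>y i\<bar>^3))\<^sup>2 \<le> 8 * x i ^ 6 + 8 * y i ^ 6"
      by (simp flip: power_mult)
  qed simp
  also have "(\<Sum>i\<in>I. 8 * x i ^ 6 + 8 * y i ^ 6) = 8 * (\<Sum>i\<in>I. x i ^ 6) + 8 * (\<Sum>i\<in>I. y i ^ 6)"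
    by (simp add: sum.distrib sum_distrib_left)
  also have "(\<Sum>i\<in>I. \<bar>x i - y i\<bar>\<^sup>2) * \<dots> \<le> (\<Sum>i\<in>I. \<bar>x i - y i\<bar>\<^sup>2) * (16 * Q)"
    using assms by (intro mult_left_mono sum_nonneg) auto
  finally show ?thesis by (simp add: mult_ac)
qed

lemma sum_shift_le:
  fixes h :: "nat \<Rightarrow> real"
  assumes "h N = 0" "\<And>s. 0 \<le> h s"
  shows "(\<Sum>s<N. h (Suc s)) \<le> (\<Sum>s<N. h s)"
  using sum.lessThan_Suc_shift[of h N] assms(2)[of 0] assms(1) by simp

text \<open>The Gagliardo-Nirenberg argument: Loomis-Whitney applied to \<open>F\<^sup>4\<close>.\<close>

lemma discrete_sobolev:
  fixes F :: "nat \<Rightarrow> nat \<Rightarrow> nat \<Rightarrow> real"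
  assumes zero: "\<And>s t u. s = N \<or> t = N \<or> u = N \<Longrightarrow> F s t u = 0"
  defines "E \<equiv> (\<Sum>s<N. \<Sum>t<N. \<Sum>u<N. (F (Suc s) t u - F s t u)\<^sup>2 + (F s (Suc t) u - F s t u)\<^sup>2
                   + (F s t (Suc u) - F s t u)\<^sup>2)"
  shows "(\<Sum>s<N. \<Sum>t<N. \<Sum>u<N. F s t u ^ 6) \<le> 4096 * E ^ 3"
proof -
  define Q where "Q = (\<Sum>s<N. \<Sum>t<N. \<Sum>u<N. F s t u ^ 6)"
  define I where "I = {..<N} \<times> {..<N} \<times> {..<N}"
  have I: "(\<Sum>s<N. \<Sum>t<N. \<Sum>u<N. f s t u) = (\<Sum>i\<in>I. f (fst i) (fst (snd i)) (snd (snd i)))"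
    for f :: "nat \<Rightarrow> nat \<Rightarrow> nat \<Rightarrow> real"
    unfolding I_def by (simp add: sum.cartesian_product case_prod_beta)
  define E1 where "E1 = (\<Sum>s<N. \<Sum>t<N. \<Sum>u<N. (F (Suc s) t u - F s t u)\<^sup>2)"
  define E2 where "E2 = (\<Sum>s<N. \<Sum>t<N. \<Sum>u<N. (F s (Suc t) u - F s t u)\<^sup>2)"
  define E3 where "E3 = (\<Sum>s<N. \<Sum>t<N. \<Sum>u<N. (F s t (Suc u) - F s t u)\<^sup>2)"
  have E: "E = E1 + E2 + E3" unfolding E_def E1_def E2_def E3_def by (simp add: sum.distrib)
  have pos: "0 \<le> E1" "0 \<le> E2" "0 \<le> E3" unfolding E1_def E2_def E3_def by (auto intro!: sum_nonneg)
  define G1 where "G1 = (\<lambda>t u. \<Sum>s<N. \<bar>F (Suc s) t u ^ 4 - F s t u ^ 4\<bar>)"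
  define G2 where "G2 = (\<lambda>s u. \<Sum>t<N. \<bar>F s (Suc t) u ^ 4 - F s t u ^ 4\<bar>)"
  define G3 where "G3 = (\<lambda>s t. \<Sum>u<N. \<bar>F s t (Suc u) ^ 4 - F s t u ^ 4\<bar>)"
  have G_nonneg: "0 \<le> G1 t u" "0 \<le> G2 s u" "0 \<le> G3 s t" for s t u
    unfolding G1_def G2_def G3_def by (auto intro!: sum_nonneg)
  have root: "(F s t u)\<^sup>2 \<le> sqrt G" if "F s t u ^ 4 \<le> G" for s t u G
  proof (rule real_le_rsqrt)
    show "((F s t u)\<^sup>2)\<^sup>2 \<le> G" using that by (simp flip: power_mult)
  qed
  have point: "F s t u ^ 6 \<le> sqrt (G1 t u) * sqrt (G2 s u) * sqrt (G3 s t)"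
    if "s < N" "t < N" "u < N" for s t u
  proof -
    have "F s t u ^ 6 = (F s t u)\<^sup>2 * (F s t u)\<^sup>2 * (F s t u)\<^sup>2" by (simp flip: power_add)
    also have "\<dots> \<le> sqrt (G1 t u) * sqrt (G2 s u) * sqrt (G3 s t)"
    proof (intro mult_mono root)
      \<comment> \<open>Each line is followed upwards to index \<open>N\<close>, where
        \<open>F\<close> vanishes. Nothing is asked at index 0: that end is a free boundary.\<close>
      show "F s t u ^ 4 \<le> G1 t u" unfolding G1_def
        by (rule le_sum_abs_increments[where g = "\<lambda>s. F s t u ^ 4"]) (use that zero in auto)
      show "F s t u ^ 4 \<le> G2 s u" unfolding G2_def
        by (rule le_sum_abs_increments[where g = "\<lambda>t. F s t u ^ 4"]) (use that zero in auto)
      show "F s t u ^ 4 \<le> G3 s t" unfolding G3_def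
        by (rule le_sum_abs_increments[where g = "\<lambda>u. F s t u ^ 4"]) (use that zero in auto)
    qed (auto simp: G_nonneg)
    finally show ?thesis .
  qed
  define S1 where "S1 = (\<Sum>t<N. \<Sum>u<N. G1 t u)"
  define S2 where "S2 = (\<Sum>s<N. \<Sum>u<N. G2 s u)"
  define S3 where "S3 = (\<Sum>s<N. \<Sum>t<N. G3 s t)"
  have Q0: "0 \<le> Q" unfolding Q_def by (auto intro!: sum_nonneg)
  have "Q\<^sup>2 \<le> (\<Sum>s<N. \<Sum>t<N. \<Sum>u<N. sqrt (G1 t u) * sqrt (G2 s u) * sqrt (G3 s t))\<^sup>2"
    using Q0 unfolding Q_def by (intro power_mono sum_mono point) auto
  also have "\<dots> \<le> S1 * S2 * S3"
    using loomis_whitney[of "\<lambda>t u. sqrt (G1 t u)" "\<lambda>s u. sqrt (G2 s u)" "\<lambda>s t. sqrt (G3 s t)" N]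
    by (simp add: G_nonneg S1_def S2_def S3_def)
  finally have LW: "Q\<^sup>2 \<le> S1 * S2 * S3" .
  have h: "0 \<le> F s t u ^ 6" for s t u by simp
  have "S1 = (\<Sum>s<N. \<Sum>t<N. \<Sum>u<N. \<bar>F (Suc s) t u ^ 4 - F s t u ^ 4\<bar>)"
  proof -
    have "S1 = (\<Sum>t<N. \<Sum>s<N. \<Sum>u<N. \<bar>F (Suc s) t u ^ 4 - F s t u ^ 4\<bar>)"
      unfolding S1_def G1_def by (intro sum.cong refl sum.swap)
    also have "\<dots> = (\<Sum>s<N. \<Sum>t<N. \<Sum>u<N. \<bar>F (Suc s) t u ^ 4 - F s t u ^ 4\<bar>)"
      by (rule sum.swap)
    finally show ?thesis .
  qed
  moreover have "(\<Sum>s<N. \<Sum>t<N. \<Sum>u<N. F (Suc s) t u ^ 6) \<le> Q"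
  proof -
    have "(\<Sum>s<N. \<Sum>t<N. \<Sum>u<N. F (Suc s) t u ^ 6) \<le> (\<Sum>s<N. \<Sum>t<N. \<Sum>u<N. F s t u ^ 6)"
      by (rule sum_shift_le[where h = "\<lambda>s. \<Sum>t<N. \<Sum>u<N. F s t u ^ 6"]) (use zero in \<open>auto intro!: sum_nonneg\<close>)
    then show ?thesis unfolding Q_def .
  qed
  ultimately have S1: "S1\<^sup>2 \<le> 16 * E1 * Q"
    unfolding E1_def I Q_def by (simp only:) (rule sum_abs_diff_power4_le; simp)
  have "S2 = (\<Sum>s<N. \<Sum>t<N. \<Sum>u<N. \<bar>F s (Suc t) u ^ 4 - F s t u ^ 4\<bar>)"
    unfolding S2_def G2_def by (intro sum.cong refl sum.swap)
  moreover have "(\<Sum>s<N. \<Sum>t<N. \<Sum>u<N. F s (Suc t) u ^ 6) \<le> Q"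
    unfolding Q_def
    by (intro sum_mono sum_shift_le[where h = "\<lambda>t. \<Sum>u<N. F s t u ^ 6" for s]) (use zero in \<open>auto intro!: sum_nonneg\<close>)
  ultimately have S2: "S2\<^sup>2 \<le> 16 * E2 * Q"
    unfolding E2_def I Q_def by (simp only:) (rule sum_abs_diff_power4_le; simp)
  have "S3 = (\<Sum>s<N. \<Sum>t<N. \<Sum>u<N. \<bar>F s t (Suc u) ^ 4 - F s t u ^ 4\<bar>)"
    unfolding S3_def G3_def by simp
  moreover have "(\<Sum>s<N. \<Sum>t<N. \<Sum>u<N. F s t (Suc u) ^ 6) \<le> Q"
    unfolding Q_def
    by (intro sum_mono sum_shift_le[where h = "\<lambda>u. F s t u ^ 6" for s t]) (use zero in auto)
  ultimately have S3: "S3\<^sup>2 \<le> 16 * E3 * Q"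
    unfolding E3_def I Q_def by (simp only:) (rule sum_abs_diff_power4_le; simp)
  \<comment> \<open>Squaring the Loomis-Whitney bound puts \<open>Q\<close> to the fourth power
    against \<open>Q\<close> cubed, so one power survives the cancellation.\<close>
  have "Q ^ 4 = (Q\<^sup>2)\<^sup>2" by simp
  also have "\<dots> \<le> (S1 * S2 * S3)\<^sup>2" using LW by (intro power_mono) auto
  also have "\<dots> = S1\<^sup>2 * S2\<^sup>2 * S3\<^sup>2" by (simp add: power_mult_distrib)
  also have "\<dots> \<le> (16 * E1 * Q) * (16 * E2 * Q) * (16 * E3 * Q)"
    using S1 S2 S3 pos Q0 by (intro mult_mono) auto
  also have "\<dots> \<le> (16 * E * Q) * (16 * E * Q) * (16 * E * Q)"
    using pos Q0 unfolding E by (intro mult_mono) auto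
  also have "\<dots> = 4096 * E ^ 3 * Q ^ 3" by (simp add: power3_eq_cube)
  finally have "Q * Q ^ 3 \<le> (4096 * E ^ 3) * Q ^ 3" by (simp add: power_Suc[symmetric] del: power_Suc)
  moreover have "0 \<le> 4096 * E ^ 3" using pos E by simp
  ultimately have "Q \<le> 4096 * E ^ 3"
    using Q0 by (cases "Q = 0") auto
  then show ?thesis unfolding Q_def .
qed

section \<open>Half-spaces of the lattice\<close>

text \<open>Edges with one end in \<open>V\<close> are included, so each site of \<open>V\<close>
  keeps all its 2d neighbours and those outside serve as root.\<close>

definition lattice_edges :: "'d::finite site set \<Rightarrow> ('d site \<times> 'd site) set" where
  "lattice_edges V = {(y, z). adjacent y z \<and> (y \<in> V \<or> z \<in> V)}"

definition cube :: "'d site \<Rightarrow> nat \<Rightarrow> 'd::finite site set" where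
  "cube x j = {y. \<forall>i. \<bar>y i - x i\<bar> \<le> int j}"

definition cube_face :: "'d site \<Rightarrow> nat \<Rightarrow> 'd::finite site set" where
  "cube_face x j = {y \<in> cube x j. \<exists>i. \<bar>y i - x i\<bar> = int j}"

lemma adjacent_sym: "adjacent x y \<longleftrightarrow> adjacent y x"
  unfolding adjacent_def by (simp add: abs_minus_commute)

lemma adjacent_symD: "adjacent x y \<Longrightarrow> adjacent y x"
  using adjacent_sym by blast

lemma not_adjacent_self: "\<not> adjacent x x"
  unfolding adjacent_def by simp

lemma adjacent_shift:
  assumes "\<bar>s\<bar> = 1"
  shows "adjacent y (y(i := y i + s))"
proof -
  have "(\<Sum>k\<in>UNIV. \<bar>y k - (y(i := y i + s)) k\<bar>) = (\<Sum>k\<in>UNIV. if k = i then 1 else 0)"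
    by (rule sum.cong) (use assms in auto)
  then show ?thesis unfolding adjacent_def by simp
qed

lemma adjacent_iff: "adjacent y z \<longleftrightarrow> (\<exists>i s. \<bar>s\<bar> = 1 \<and> z = y(i := y i + s))"
proof
  assume a: "adjacent y z"
  then have "y \<noteq> z" using not_adjacent_self by auto
  then obtain i where i: "y i \<noteq> z i" by (auto simp: fun_eq_iff)
  have eq: "(\<Sum>k\<in>UNIV. \<bar>y k - z k\<bar>) = \<bar>y i - z i\<bar> + (\<Sum>k\<in>UNIV - {i}. \<bar>y k - z k\<bar>)"
    by (simp add: sum.remove)
  have nn: "0 \<le> (\<Sum>k\<in>UNIV - {i}. \<bar>y k - z k\<bar>)" by (simp add: sum_nonneg)
  have one: "\<bar>y i - z i\<bar> = 1" and "(\<Sum>k\<in>UNIV - {i}. \<bar>y k - z k\<bar>) = 0"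
    using a eq nn i unfolding adjacent_def by linarith+
  then have "\<forall>k\<in>UNIV - {i}. \<bar>y k - z k\<bar> = 0"
    by (subst sum_nonneg_eq_0_iff[symmetric]) auto
  then have "z = y(i := y i + (z i - y i))" by auto
  then show "\<exists>i s. \<bar>s\<bar> = 1 \<and> z = y(i := y i + s)"
    using one by (metis abs_minus_commute)
qed (use adjacent_shift in blast)

lemma neighbours_eq: "{z. adjacent y z} = (\<lambda>(i, s). y(i := y i + s)) ` (UNIV \<times> {1, -1})"
proof -
  have "\<bar>s\<bar> = 1 \<longleftrightarrow> s = 1 \<or> s = -1" for s :: int by linarith
  then show ?thesis unfolding adjacent_iff by (auto simp: image_iff)
qed

lemma card_neighbours: "card {z. adjacent (y :: 'd::finite site) z} = 2 * CARD('d)"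
proof -
  have "inj_on (\<lambda>(i, s). y(i := y i + s)) (UNIV \<times> {1, -1 :: int})"
  proof (rule inj_onI, clarify)
    fix i s i' s'
    assume a: "s \<in> {1, -1 :: int}" "s' \<in> {1, -1 :: int}" "y(i := y i + s) = y(i' := y i' + s')"
    have eq: "(y(i := y i + s)) i = (y(i' := y i' + s')) i" by (simp only: a(3))
    have "i = i'"
    proof (rule ccontr)
      assume "i \<noteq> i'"
      then have "s = 0" using eq by simp
      then show False using a(1) by simp
    qed
    then show "i = i' \<and> s = s'" using eq by simp
  qed
  then show ?thesis unfolding neighbours_eq by (simp add: card_image card_cartesian_product)
qed

lemma finite_neighbours: "finite {z. adjacent y z}"
  unfolding neighbours_eq by simp

lemma finite_lattice_edges:
  assumes "finite V"
  shows "finite (lattice_edges V)"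
proof -
  have "lattice_edges V \<subseteq> (\<Union>y\<in>V. {y} \<times> {z. adjacent y z} \<union> {z. adjacent y z} \<times> {y})"
    unfolding lattice_edges_def by (auto dest: adjacent_symD)
  then show ?thesis
    by (rule finite_subset) (use assms finite_neighbours in auto)
qed

lemma sym_lattice_edges: "sym (lattice_edges V)"
  unfolding lattice_edges_def sym_def by (auto dest: adjacent_symD)

lemma irrefl_lattice_edges: "irrefl (lattice_edges V)"
  unfolding lattice_edges_def irrefl_def using not_adjacent_self by auto

lemma lattice_edges_Image: "y \<in> V \<Longrightarrow> lattice_edges V `` {y} = {z. adjacent y z}"
  unfolding lattice_edges_def by auto

lemma finite_cube: "finite (cube x j)"
proof -
  have "cube x j \<subseteq> (\<Pi>\<^sub>E i\<in>UNIV. {x i - int j .. x i + int j})"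
  proof
    fix y assume "y \<in> cube x j"
    then have "\<bar>y i - x i\<bar> \<le> int j" for i unfolding cube_def by blast
    then have "x i - int j \<le> y i \<and> y i \<le> x i + int j" for i by (smt (verit))
    then show "y \<in> (\<Pi>\<^sub>E i\<in>UNIV. {x i - int j .. x i + int j})" by auto
  qed
  then show ?thesis by (rule finite_subset) (auto intro!: finite_PiE)
qed

text \<open>The energy halves a sum over ordered pairs, whence the factor 2. Only pairs with
  different values have to be edges, which spares those lying outside the support.\<close>

lemma sum_sq_increments_le_energy:
  fixes f :: "'v \<Rightarrow> real"
  assumes "finite H" "finite X" "inj_on \<phi> X"
    and "\<And>x. x \<in> X \<Longrightarrow> f (fst (\<phi> x)) \<noteq> f (snd (\<phi> x)) \<Longrightarrow> \<phi> x \<in> H"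
  shows "(\<Sum>x\<in>X. (f (fst (\<phi> x)) - f (snd (\<phi> x)))\<^sup>2) \<le> 2 * energy H f"
proof -
  let ?Y = "{x \<in> X. f (fst (\<phi> x)) \<noteq> f (snd (\<phi> x))}"
  have "(\<Sum>x\<in>X. (f (fst (\<phi> x)) - f (snd (\<phi> x)))\<^sup>2) = (\<Sum>x\<in>?Y. (f (fst (\<phi> x)) - f (snd (\<phi> x)))\<^sup>2)"
    by (rule sum.mono_neutral_right) (use assms(2) in auto)
  also have "\<dots> = (\<Sum>p\<in>\<phi> ` ?Y. (f (fst p) - f (snd p))\<^sup>2)"
    by (subst sum.reindex) (use assms(3) in \<open>auto intro: inj_on_subset\<close>)
  also have "\<dots> \<le> (\<Sum>p\<in>H. (f (fst p) - f (snd p))\<^sup>2)"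
    by (rule sum_mono2) (use assms in auto)
  finally show ?thesis unfolding energy_eq by (simp add: case_prod_beta)
qed

lemma sum_cube_le:
  fixes e :: "'i \<Rightarrow> real"
  assumes "finite R" "\<And>r. r \<in> R \<Longrightarrow> 0 \<le> e r"
  shows "(\<Sum>r\<in>R. e r ^ 3) \<le> (\<Sum>r\<in>R. e r) ^ 3"
proof -
  have "e r ^ 3 \<le> e r * (\<Sum>r\<in>R. e r)\<^sup>2" if "r \<in> R" for r
  proof -
    have "e r \<le> (\<Sum>r\<in>R. e r)" using assms that by (intro member_le_sum) auto
    then have "(e r)\<^sup>2 \<le> (\<Sum>r\<in>R. e r)\<^sup>2" using assms that by (intro power_mono) auto
    then have "e r * (e r)\<^sup>2 \<le> e r * (\<Sum>r\<in>R. e r)\<^sup>2" using assms that by (intro mult_left_mono) auto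
    then show ?thesis by (simp add: power3_eq_cube power2_eq_square mult.assoc)
  qed
  then have "(\<Sum>r\<in>R. e r ^ 3) \<le> (\<Sum>r\<in>R. e r * (\<Sum>r\<in>R. e r)\<^sup>2)" by (rule sum_mono)
  also have "\<dots> = (\<Sum>r\<in>R. e r) ^ 3"
    by (simp add: sum_distrib_right[symmetric] power3_eq_cube power2_eq_square)
  finally show ?thesis .
qed

text \<open>Three coordinate directions suffice: the bound holds on each three-dimensional slice. The constant is
  \<open>4096 * 6\<^sup>3\<close>, as each direction contributes at most twice the energy.\<close>

lemma halfspace_sobolev:
  fixes f :: "'d::finite site \<Rightarrow> real" and h \<epsilon> :: int
  assumes d: "CARD('d) \<ge> 3" and V: "finite V" "\<And>y. y \<notin> V \<Longrightarrow> f y = 0" and \<epsilon>: "\<bar>\<epsilon>\<bar> = 1"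
    and H: "finite H" "\<And>y z. \<lbrakk>adjacent y z; h \<le> \<epsilon> * y i; h \<le> \<epsilon> * z i; y \<in> V \<or> z \<in> V\<rbrakk> \<Longrightarrow> (y, z) \<in> H"
  shows "(\<Sum>y | y \<in> V \<and> h \<le> \<epsilon> * y i. f y ^ 6) \<le> 884736 * energy H f ^ 3"
proof -
  have "\<exists>p. p \<notin> A" if "card A < CARD('d)" for A :: "'d set"
    using that by (metis UNIV_eq_I less_irrefl)
  \<comment> \<open>Two directions parallel to the bounding hyperplane complete \<open>i\<close> to
    a three-dimensional slice.\<close>
  from this[of "{i}"] obtain p where p: "p \<noteq> i" using d by auto
  from \<open>\<And>A. card A < CARD('d) \<Longrightarrow> \<exists>p. p \<notin> A\<close>[of "{i, p}"] obtain q where "q \<notin> {i, p}"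
    using d p by (auto simp: card_insert_if)
  then have pq: "p \<noteq> q" "p \<noteq> i" "q \<noteq> i" using p by auto
  have \<epsilon>2: "\<epsilon> * \<epsilon> = 1" using \<epsilon> by (metis abs_mult_self_eq mult.right_neutral)
  define M where "M = Suc (nat (\<Sum>y\<in>V. \<Sum>k\<in>UNIV. \<bar>y k\<bar>))"
  have M: "\<bar>y k\<bar> < int M" if "y \<in> V" for y k
  proof -
    have "\<bar>y k\<bar> \<le> (\<Sum>k\<in>UNIV. \<bar>y k\<bar>)" by (rule member_le_sum) auto
    also have "\<dots> \<le> (\<Sum>y\<in>V. \<Sum>k\<in>UNIV. \<bar>y k\<bar>)"
      by (rule member_le_sum[of y V "\<lambda>y. \<Sum>k\<in>UNIV. \<bar>y k\<bar>"]) (use that V in \<open>auto intro!: sum_nonneg\<close>)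
    finally show ?thesis unfolding M_def by linarith
  qed
  \<comment> \<open>Large enough that index \<open>N\<close> falls outside \<open>V\<close> in all
    three directions: \<open>2 * M - M\<close> is already \<open>M\<close>, and
    \<open>h + int N\<close> is at least \<open>2 * M\<close>.\<close>
  define N where "N = 2 * M + nat \<bar>h\<bar>"
  define site where "site = (\<lambda>(r :: 'd site) s t u. r(i := \<epsilon> * (h + int s), p := int t - int M, q := int u - int M))"
  have site_simps: "site r s t u i = \<epsilon> * (h + int s)" "site r s t u p = int t - int M"
      "site r s t u q = int u - int M" "(site r s t u)(i := 0, p := 0, q := 0) = r(i := 0, p := 0, q := 0)"
    for r s t u using pq unfolding site_def by (auto simp: fun_eq_iff)
  have heights: "\<epsilon> * site r s t u i = h + int s" for r s t u
    using \<epsilon>2 by (simp add: site_simps mult.assoc[symmetric])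
  have outside: "site r s t u \<notin> V" if "s = N \<or> t = N \<or> u = N" for r s t u
  proof
    assume a: "site r s t u \<in> V"
    have "\<epsilon> * y \<le> \<bar>y\<bar>" for y using \<epsilon> by (metis abs_ge_self abs_mult mult.left_neutral)
    from this[of "site r s t u i"] have "h + int s < int M"
      using M[OF a, of i] unfolding heights by linarith
    moreover have "\<bar>int t - int M\<bar> < int M" "\<bar>int u - int M\<bar> < int M"
      using M[OF a, of p] M[OF a, of q] unfolding site_simps by auto
    ultimately show False using that unfolding N_def by (elim disjE) linarith+
  qed
  \<comment> \<open>One representative for each slice that meets \<open>V\<close>, its three free
    coordinates set to 0.\<close>
  define R where "R = (\<lambda>y. y(i := 0, p := 0, q := 0)) ` V"
  define I where "I = {..<N} \<times> {..<N} \<times> {..<N}"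
  define X where "X = R \<times> I"
  define st where "st = (\<lambda>(r, s, t, u). site r s t u)"
  have fin: "finite R" "finite X" using V(1) unfolding X_def R_def I_def by auto
  have inj_site: "r = r' \<and> s = s' \<and> t = t' \<and> u = u'"
    if "site r s t u = site r' s' t' u'" "r \<in> R" "r' \<in> R" for r s t u r' s' t' u'
  proof -
    have "r(i := 0, p := 0, q := 0) = r" "r'(i := 0, p := 0, q := 0) = r'"
      using that pq unfolding R_def by (auto simp: fun_eq_iff)
    then have "r = r'" using that(1) site_simps(4) by metis
    moreover have "h + int s = h + int s'" using that(1) heights by metis
    moreover have "int t - int M = int t' - int M" "int u - int M = int u' - int M"
      using that(1) site_simps(2,3) by metis+
    ultimately show ?thesis by simp
  qed
  have inj_st: "inj_on st X"
    unfolding st_def X_def by (rule inj_onI) (auto dest: inj_site)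
  define e where "e = (\<lambda>r. \<Sum>s<N. \<Sum>t<N. \<Sum>u<N. (f (site r (Suc s) t u) - f (site r s t u))\<^sup>2 +
      (f (site r s (Suc t) u) - f (site r s t u))\<^sup>2 + (f (site r s t (Suc u)) - f (site r s t u))\<^sup>2)"
  have e_nonneg: "0 \<le> e r" for r unfolding e_def by (auto intro!: sum_nonneg)
  have flat: "(\<Sum>r\<in>R. \<Sum>s<N. \<Sum>t<N. \<Sum>u<N. g r s t u) = (\<Sum>(r, s, t, u)\<in>X. g r s t u)" for g :: "_ \<Rightarrow> _ \<Rightarrow> _ \<Rightarrow> _ \<Rightarrow> real"
    unfolding X_def I_def by (simp add: sum.cartesian_product)
  have "{y. y \<in> V \<and> h \<le> \<epsilon> * y i} \<subseteq> st ` X"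
  proof clarify
    fix y assume y: "y \<in> V" "h \<le> \<epsilon> * y i"
    let ?s = "nat (\<epsilon> * y i - h)" and ?t = "nat (y p + int M)" and ?u = "nat (y q + int M)"
    have "\<epsilon> * y i \<le> \<bar>y i\<bar>" using \<epsilon> by (metis abs_ge_self abs_mult mult.left_neutral)
    then have "?s < N" "?t < N" "?u < N"
      using M[OF y(1), of i] M[OF y(1), of p] M[OF y(1), of q] y(2) unfolding N_def by linarith+
    moreover have "site (y(i := 0, p := 0, q := 0)) ?s ?t ?u = y"
    proof -
      have "\<epsilon> * (h + int ?s) = y i" using y(2) \<epsilon>2 by (simp add: mult.assoc[symmetric])
      moreover have "int ?t - int M = y p" "int ?u - int M = y q"
        using M[OF y(1), of p] M[OF y(1), of q] by linarith+
      ultimately show ?thesis unfolding site_def by (auto simp: fun_eq_iff)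
    qed
    ultimately show "y \<in> st ` X"
      using y(1) unfolding st_def X_def R_def I_def
      by (intro image_eqI[of _ _ "(y(i := 0, p := 0, q := 0), ?s, ?t, ?u)"]) auto
  qed
  then have "(\<Sum>y | y \<in> V \<and> h \<le> \<epsilon> * y i. f y ^ 6) \<le> (\<Sum>y\<in>st ` X. f y ^ 6)"
    by (intro sum_mono2) (use fin in auto)
  also have "\<dots> = (\<Sum>r\<in>R. \<Sum>s<N. \<Sum>t<N. \<Sum>u<N. f (site r s t u) ^ 6)"
    unfolding flat by (subst sum.reindex[OF inj_st]) (simp add: st_def case_prod_beta)
  also have "\<dots> \<le> (\<Sum>r\<in>R. 4096 * e r ^ 3)"
  proof (rule sum_mono)
    fix r
    show "(\<Sum>s<N. \<Sum>t<N. \<Sum>u<N. f (site r s t u) ^ 6) \<le> 4096 * e r ^ 3"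
      unfolding e_def by (rule discrete_sobolev[where F = "\<lambda>s t u. f (site r s t u)"]) (use V(2) outside in blast)
  qed
  also have "\<dots> \<le> 4096 * (\<Sum>r\<in>R. e r) ^ 3"
    using sum_cube_le[of R e] fin e_nonneg by (simp add: sum_distrib_left[symmetric])
  also have "(\<Sum>r\<in>R. e r) \<le> 6 * energy H f"
  proof -
    have dir: "(\<Sum>(r, s, t, u)\<in>X. (f (site' r s t u) - f (site r s t u))\<^sup>2) \<le> 2 * energy H f"
      if site': "\<And>r s t u. adjacent (site' r s t u) (site r s t u)" "\<And>r s t u. h \<le> \<epsilon> * site' r s t u i"
      for site'
    proof -
      let ?\<phi> = "\<lambda>(r, s, t, u). (site' r s t u, site r s t u)"
      have "(\<Sum>x\<in>X. (f (fst (?\<phi> x)) - f (snd (?\<phi> x)))\<^sup>2) \<le> 2 * energy H f"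
      proof (rule sum_sq_increments_le_energy[OF H(1) fin(2)])
        show "inj_on ?\<phi> X" unfolding X_def by (rule inj_onI) (auto dest: inj_site)
        fix x assume "x \<in> X" and ne: "f (fst (?\<phi> x)) \<noteq> f (snd (?\<phi> x))"
        obtain r s t u where x: "x = (r, s, t, u)" by (cases x)
        have "site' r s t u \<in> V \<or> site r s t u \<in> V" using ne V(2) x by fastforce
        then show "?\<phi> x \<in> H" unfolding x using H(2) site' heights by simp
      qed
      then show ?thesis by (simp add: case_prod_beta)
    qed
    have "site r (Suc s) t u = (site r s t u)(i := site r s t u i + \<epsilon>)"
        "site r s (Suc t) u = (site r s t u)(p := site r s t u p + 1)"
        "site r s t (Suc u) = (site r s t u)(q := site r s t u q + 1)" for r s t u
      using pq unfolding site_def by (auto simp: fun_eq_iff algebra_simps)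
    then have adj: "adjacent (site r (Suc s) t u) (site r s t u)" "adjacent (site r s (Suc t) u) (site r s t u)"
        "adjacent (site r s t (Suc u)) (site r s t u)" for r s t u
      using adjacent_shift[of _ "site r s t u"] \<epsilon> adjacent_sym by (metis abs_one)+
    have "(\<Sum>r\<in>R. e r) = (\<Sum>(r, s, t, u)\<in>X. (f (site r (Suc s) t u) - f (site r s t u))\<^sup>2)
        + (\<Sum>(r, s, t, u)\<in>X. (f (site r s (Suc t) u) - f (site r s t u))\<^sup>2)
        + (\<Sum>(r, s, t, u)\<in>X. (f (site r s t (Suc u)) - f (site r s t u))\<^sup>2)"
      unfolding e_def flat by (simp add: sum.distrib case_prod_beta)
    also have "\<dots> \<le> 2 * energy H f + 2 * energy H f + 2 * energy H f"
      by (intro add_mono dir adj) (simp_all add: heights)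
    finally show ?thesis by simp
  qed
  then have "4096 * (\<Sum>r\<in>R. e r) ^ 3 \<le> 4096 * (6 * energy H f) ^ 3"
    by (intro mult_left_mono power_mono) (auto intro!: sum_nonneg e_nonneg)
  finally show ?thesis by (simp add: power_mult_distrib)
qed

text \<open>Transience of a half-space in quantitative form: the single value 1 at \<open>w\<close>
  enters the Sobolev sum. The Sobolev constant can be reused because an energy below 1 dominates its
  own cube.\<close>

lemma conductance_halfspace:
  fixes V :: "'d::finite site set" and h \<epsilon> :: int
  assumes d: "CARD('d) \<ge> 3" and V: "finite V" "w \<in> V" and \<epsilon>: "\<bar>\<epsilon>\<bar> = 1" "h \<le> \<epsilon> * w i"
    and H: "finite H" "\<And>y z. \<lbrakk>adjacent y z; h \<le> \<epsilon> * y i; h \<le> \<epsilon> * z i; y \<in> V \<or> z \<in> V\<rbrakk> \<Longrightarrow> (y, z) \<in> H"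
  shows "1 / 884736 \<le> conductance H {w} V"
proof (rule conductance_greatest)
  fix f assume f: "f \<in> potentials {w} V"
  have "1 = f w ^ 6" using f by (simp add: potentials_def)
  also have "\<dots> \<le> (\<Sum>y | y \<in> V \<and> h \<le> \<epsilon> * y i. f y ^ 6)"
    by (rule member_le_sum) (use V \<epsilon> in auto)
  also have "\<dots> \<le> 884736 * energy H f ^ 3"
    by (rule halfspace_sobolev[OF d V(1) _ \<epsilon>(1) H]) (use f in \<open>auto simp: potentials_def\<close>)
  finally have one: "1 \<le> 884736 * energy H f ^ 3" .
  show "1 / 884736 \<le> energy H f"
  proof (rule ccontr)
    assume small: "\<not> 1 / 884736 \<le> energy H f"
    then have "energy H f ^ 3 \<le> energy H f ^ 1"
      by (intro power_decreasing) (use energy_nonneg[of H f] in auto)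
    then show False using one small by simp
  qed
qed (use V H in auto)

text \<open>A step out of the cube crosses one face; the last conclusion puts its end in the
  half-space beyond that face.\<close>

lemma adjacent_leaves_cube:
  assumes "adjacent u w" "u \<in> cube x j" "w \<notin> cube x j"
  obtains i \<epsilon> where "\<bar>\<epsilon>\<bar> = 1" "u i = x i + \<epsilon> * int j" "w = u(i := u i + \<epsilon>)" "\<epsilon> * x i + int j + 1 \<le> \<epsilon> * w i"
proof -
  obtain i s where s: "\<bar>s\<bar> = 1" "w = u(i := u i + s)"
    using assms(1) unfolding adjacent_iff by blast
  have u: "\<bar>u k - x k\<bar> \<le> int j" for k using assms(2) unfolding cube_def by blast
  obtain k where k: "\<not> \<bar>w k - x k\<bar> \<le> int j" using assms(3) unfolding cube_def by blast
  have "k = i" using k u[of k] s(2) by (cases "k = i") auto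
  then have far: "\<not> \<bar>u i + s - x i\<bar> \<le> int j" using k s(2) by simp
  from s(1) have "s = 1 \<or> s = -1" by linarith
  then have "u i = x i + s * int j" "s * x i + int j + 1 \<le> s * w i"
    using far u[of i] s(2) by auto
  then show ?thesis using that s by blast
qed

lemma adjacent_leaves_cube_sphere:
  assumes "adjacent u w" "u \<in> cube x j" "w \<notin> cube x j"
  shows "u \<in> cube_face x j"
proof -
  obtain i \<epsilon> where "\<bar>\<epsilon>\<bar> = 1" "u i = x i + \<epsilon> * int j"
    by (rule adjacent_leaves_cube[OF assms])
  then have "\<bar>u i - x i\<bar> = int j" by (simp add: abs_mult)
  then show ?thesis using assms(2) unfolding cube_face_def by blast
qed

text \<open>Exploration alters edges only inside the cube, so this is what keeps the half-spaces
  intact.\<close>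

lemma halfspace_disjoint_cube:
  assumes "y \<in> cube x j" "\<bar>\<epsilon>\<bar> = 1"
  shows "\<not> \<epsilon> * x i + int j + 1 \<le> \<epsilon> * y i"
proof -
  have "\<bar>y i - x i\<bar> \<le> int j" using assms(1) unfolding cube_def by blast
  moreover have "\<epsilon> * (y i - x i) \<le> \<bar>y i - x i\<bar>"
    using assms(2) by (metis abs_ge_self abs_mult mult.left_neutral)
  ultimately show ?thesis by (simp add: algebra_simps)
qed

text \<open>Let \<open>f\<close> be a potential equal to 1 on \<open>K\<close>. At each site of
  \<open>K\<close> on a face, either \<open>f\<close> drops by at least 1/2 along the outward edge,
  or the outer neighbour has a value of at least 1/2 and is charged to the Sobolev sum beyond that
  face. Summing over the 2d faces bounds the number of such sites by a function of the
  energy.\<close>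

lemma conductance_cube_face:
  fixes V :: "'d::finite site set"
  assumes d: "CARD('d) \<ge> 3" and V: "finite V" "K \<subseteq> V" and L: "0 < L"
    and H: "finite H" "\<And>y z. \<lbrakk>adjacent y z; y \<in> V \<or> z \<in> V; \<not> (y \<in> cube x j \<and> z \<in> cube x j)\<rbrakk> \<Longrightarrow> (y, z) \<in> H"
    and k: "2 * real CARD('d) * (8 * L + 64 * 884736 * L ^ 3) \<le> real k" "k \<le> card (K \<inter> cube_face x j)"
  shows "L \<le> conductance H K V"
proof (rule conductance_greatest)
  fix f assume f: "f \<in> potentials K V"
  define e where "e = energy H f"
  have f0: "f y = 0" if "y \<notin> V" for y using f that unfolding potentials_def by auto
  have finK: "finite K" using V finite_subset by blast
  define A where "A = (\<lambda>(i, \<epsilon>). {a \<in> K \<inter> cube x j. a i = x i + \<epsilon> * int j})"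
  have face: "real (card (A (i, \<epsilon>))) \<le> 8 * e + 64 * 884736 * e ^ 3" if \<epsilon>: "\<bar>\<epsilon>\<bar> = 1" for i \<epsilon>
  proof -
    let ?A = "A (i, \<epsilon>)"
    let ?s = "\<lambda>a. a(i := a i + \<epsilon>)"
    let ?h = "\<epsilon> * x i + int j + 1"
    have finA: "finite ?A" using finK unfolding A_def by auto
    have out: "?h \<le> \<epsilon> * ?s a i" if "a \<in> ?A" for a
    proof -
      have "\<epsilon> * \<epsilon> = 1" using \<epsilon> by (metis abs_mult_self_eq mult.right_neutral)
      then show ?thesis using that unfolding A_def by (simp add: algebra_simps) (simp add: mult.assoc[symmetric])
    qed
    have notbox: "?s a \<notin> cube x j" if "a \<in> ?A" for a
      using out[OF that] halfspace_disjoint_cube[OF _ \<epsilon>] by blast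
    have inj: "inj_on ?s ?A"
    proof (rule inj_onI)
      fix a b assume "a \<in> ?A" "b \<in> ?A" and eq: "?s a = ?s b"
      have "a m = b m" for m using fun_cong[OF eq, of m] by (cases "m = i") auto
      then show "a = b" by auto
    qed
    \<comment> \<open>The threshold 1/2 gives the weights: 4 is 2 squared and 64 is 2 to the sixth
      power.\<close>
    have one: "1 \<le> 4 * (1 - b)\<^sup>2 + 64 * b ^ 6" for b :: real
    proof (cases "b \<ge> 1/2")
      case True
      then have "(1/2) ^ 6 \<le> b ^ 6" by (intro power_mono) auto
      then have "1 \<le> 64 * b ^ 6" by (simp add: power_divide)
      then show ?thesis by (intro add_increasing) auto
    next
      case False
      then have "(1/2)\<^sup>2 \<le> (1 - b)\<^sup>2" by (intro power_mono) auto
      then have "1 \<le> 4 * (1 - b)\<^sup>2" by (simp add: power_divide)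
      then show ?thesis by (intro add_increasing2) auto
    qed
    have "real (card ?A) = (\<Sum>a\<in>?A. 1)" by simp
    also have "\<dots> \<le> (\<Sum>a\<in>?A. 4 * (f a - f (?s a))\<^sup>2 + 64 * f (?s a) ^ 6)"
    proof (rule sum_mono)
      fix a assume "a \<in> ?A"
      then have "f a = 1" using f unfolding A_def potentials_def by auto
      then show "1 \<le> 4 * (f a - f (?s a))\<^sup>2 + 64 * f (?s a) ^ 6" using one by simp
    qed
    also have "\<dots> = 4 * (\<Sum>a\<in>?A. (f a - f (?s a))\<^sup>2) + 64 * (\<Sum>a\<in>?A. f (?s a) ^ 6)"
      by (simp add: sum.distrib sum_distrib_left)
    also have "(\<Sum>a\<in>?A. (f a - f (?s a))\<^sup>2) \<le> 2 * e"
    proof -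
      have "(\<Sum>a\<in>?A. (f (fst (a, ?s a)) - f (snd (a, ?s a)))\<^sup>2) \<le> 2 * energy H f"
      proof (rule sum_sq_increments_le_energy[OF H(1) finA])
        show "inj_on (\<lambda>a. (a, ?s a)) ?A" by (rule inj_onI) simp
        fix a assume a: "a \<in> ?A"
        then have "a \<in> V" using V(2) unfolding A_def by auto
        then show "(a, ?s a) \<in> H" using H(2) adjacent_shift[OF \<epsilon>] notbox[OF a] by blast
      qed
      then show ?thesis by (simp add: e_def)
    qed
    also have "(\<Sum>a\<in>?A. f (?s a) ^ 6) \<le> (\<Sum>y | y \<in> V \<and> ?h \<le> \<epsilon> * y i. f y ^ 6)"
    proof -
      have "(\<Sum>a\<in>?A. f (?s a) ^ 6) = (\<Sum>y\<in>?s ` ?A. f y ^ 6)"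
        by (rule sum.reindex_cong[OF inj, symmetric]) auto
      also have "\<dots> = (\<Sum>y\<in>?s ` ?A \<inter> V. f y ^ 6)"
        by (rule sum.mono_neutral_right) (use finA f0 in auto)
      also have "\<dots> \<le> (\<Sum>y | y \<in> V \<and> ?h \<le> \<epsilon> * y i. f y ^ 6)"
        by (rule sum_mono2) (use V(1) out in auto)
      finally show ?thesis .
    qed
    also have "(\<Sum>y | y \<in> V \<and> ?h \<le> \<epsilon> * y i. f y ^ 6) \<le> 884736 * e ^ 3"
      unfolding e_def
    proof (rule halfspace_sobolev[OF d V(1) f0 \<epsilon> H(1)])
      fix y z assume a: "adjacent y z" "?h \<le> \<epsilon> * y i" "?h \<le> \<epsilon> * z i" "y \<in> V \<or> z \<in> V"
      then have "y \<notin> cube x j" using halfspace_disjoint_cube[OF _ \<epsilon>] by blast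
      then show "(y, z) \<in> H" using H(2) a by blast
    qed
    finally show ?thesis by simp
  qed
  let ?I = "(UNIV :: 'd set) \<times> {1, -1 :: int}"
  have "K \<inter> cube_face x j \<subseteq> \<Union> (A ` ?I)"
  proof
    fix a assume a: "a \<in> K \<inter> cube_face x j"
    then obtain i where i: "\<bar>a i - x i\<bar> = int j" unfolding cube_face_def by blast
    then have "a i = x i + 1 * int j \<or> a i = x i + (-1) * int j" by linarith
    then have "a \<in> A (i, 1) \<or> a \<in> A (i, -1)" using a unfolding A_def cube_face_def by auto
    then show "a \<in> \<Union> (A ` ?I)" by auto
  qed
  then have "card (K \<inter> cube_face x j) \<le> card (\<Union> (A ` ?I))"
    by (intro card_mono) (use finK in \<open>auto simp: A_def\<close>)
  also have "\<dots> \<le> (\<Sum>p\<in>?I. card (A p))" by (rule card_UN_le) simp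
  finally have "k \<le> (\<Sum>p\<in>?I. card (A p))" using k(2) by linarith
  then have "real k \<le> real (\<Sum>p\<in>?I. card (A p))" by (simp only: of_nat_le_iff)
  also have "\<dots> = (\<Sum>p\<in>?I. real (card (A p)))" by simp
  also have "\<dots> \<le> (\<Sum>p\<in>?I. 8 * e + 64 * 884736 * e ^ 3)"
    by (rule sum_mono) (use face in auto)
  also have "\<dots> = 2 * real CARD('d) * (8 * e + 64 * 884736 * e ^ 3)"
    by (simp add: card_cartesian_product)
  finally have upper: "2 * real CARD('d) * (8 * L + 64 * 884736 * L ^ 3) \<le> 2 * real CARD('d) * (8 * e + 64 * 884736 * e ^ 3)"
    using k(1) by linarith
  show "L \<le> energy H f"
  proof (rule ccontr)
    assume "\<not> L \<le> energy H f"
    then have "e < L" "0 \<le> e" using energy_nonneg by (auto simp: e_def)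
    then have "e ^ 3 < L ^ 3" by (intro power_strict_mono) auto
    then have "8 * e + 64 * 884736 * e ^ 3 < 8 * L + 64 * 884736 * L ^ 3" using \<open>e < L\<close> by linarith
    then have "2 * real CARD('d) * (8 * e + 64 * 884736 * e ^ 3) < 2 * real CARD('d) * (8 * L + 64 * 884736 * L ^ 3)"
      using d by (intro mult_strict_left_mono) auto
    then show False using upper by linarith
  qed
qed (use V H in auto)

section \<open>The burnt set of a site rarely reaches far\<close>

lemma cube_mono: "j \<le> k \<Longrightarrow> cube x j \<subseteq> cube x k"
  unfolding cube_def by auto (meson of_nat_le_iff order_trans)

lemma centre_in_cube: "x \<in> cube x j"
  unfolding cube_def by auto

lemma cube_face_Suc_disjoint: "cube_face x (Suc j) \<inter> cube x j = {}"
proof -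
  have "\<bar>y i - x i\<bar> \<noteq> int (Suc j)" if "y \<in> cube x j" for y i
  proof -
    have "\<bar>y i - x i\<bar> \<le> int j" using that unfolding cube_def by blast
    then show ?thesis by simp
  qed
  then show ?thesis unfolding cube_face_def by blast
qed

text \<open>Here \<open>x\<close> belongs to the root: in a wave it topples first and acts as the
  source of the burning.\<close>

abbreviation centre_confs :: "'d::finite site set \<Rightarrow> 'd site \<Rightarrow> 'd config set" where
  "centre_confs V x \<equiv> allowed_confs (lattice_edges V) (V - {x})"

abbreviation front :: "'d::finite site set \<Rightarrow> 'd site \<Rightarrow> nat \<Rightarrow> 'd config \<Rightarrow> 'd site set" where
  "front V x j \<zeta> \<equiv> burnt (lattice_edges V) (cube x j \<inter> (V - {x})) {x} \<zeta>"

text \<open>At radius 0 the face is \<open>{x}\<close>, so every configuration is counted as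
  alive.\<close>

definition alive :: "'d::finite site set \<Rightarrow> 'd site \<Rightarrow> nat \<Rightarrow> nat" where
  "alive V x j = card {\<zeta> \<in> centre_confs V x. front V x j \<zeta> \<inter> cube_face x j \<noteq> {}}"

context
  fixes V :: "'d::finite site set" and x :: "'d site"
  assumes d: "CARD('d) \<ge> 3" and V: "finite V" "x \<in> V"
begin

lemma lattice_edges_graph: "finite (lattice_edges V)" "sym (lattice_edges V)" "irrefl (lattice_edges V)"
  using finite_lattice_edges[OF V(1)] sym_lattice_edges irrefl_lattice_edges by auto

lemma front_subset: "front V x j \<zeta> \<subseteq> cube x j"
  using burnt_subset[of "lattice_edges V" "cube x j \<inter> (V - {x})" "{x}" \<zeta>] centre_in_cube[of x j] by auto

lemma finite_centre_confs: "finite (centre_confs V x)"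
  by (rule finite_allowed_confs) (use V in auto)

text \<open>Finding the front queries only edges with both ends in the cube; all others are still
  present, whatever the state.\<close>

lemma state_edges:
  assumes "lattice_edges V - H \<subseteq> K \<times> (cube x j \<inter> (V - {x})) \<union> (cube x j \<inter> (V - {x})) \<times> K" "K \<subseteq> {x} \<union> (cube x j \<inter> (V - {x}))"
    and "adjacent y z" "y \<in> V \<or> z \<in> V" "\<not> (y \<in> cube x j \<and> z \<in> cube x j)"
  shows "(y, z) \<in> H"
proof -
  have "(y, z) \<in> lattice_edges V" using assms unfolding lattice_edges_def by auto
  moreover have "K \<subseteq> cube x j" using assms(2) centre_in_cube by fastforce
  ultimately show ?thesis using assms(1,5) by blast
qed

text \<open>Markov's inequality for the stopped supermartingale: a final state with \<open>k\<close>
  sites on the surface has conductance at least \<open>L\<close>, and the initial value is the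
  number of recurrent configurations on \<open>V\<close>.\<close>

lemma many_sphere_sites_rare:
  assumes L: "0 < L" and k: "2 * real CARD('d) * (8 * L + 64 * 884736 * L ^ 3) \<le> real k"
  shows "L * real (card {\<zeta> \<in> centre_confs V x. k \<le> card (front V x j \<zeta> \<inter> cube_face x j)}) \<le> real (num_allowed (lattice_edges V) V)"
proof -
  let ?B = "cube x j \<inter> (V - {x})"
  let ?F = "\<lambda>S S'. L * of_bool (k \<le> card (S \<inter> cube_face x j))"
  let ?g = "\<lambda>H K. real (num_allowed H (V - K)) * conductance H K V"
  have "(\<Sum>\<zeta>\<in>centre_confs V x. ?F (front V x j \<zeta>) (front V x j \<zeta>)) \<le> ?g (lattice_edges V) {x}"
  proof (rule exploration_bound[where F = ?F and g = ?g and ?K0.0 = "{x}" and B = ?B and B' = ?B])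
    fix H K u w
    assume "finite H" "sym H" "irrefl H" "K \<subseteq> V" "(u, w) \<in> H" "u \<in> K" "w \<in> V - K"
    then show "?g H (insert w K) + ?g (del_edge H u w) K \<le> ?g H K"
      using num_allowed_conductance_step[OF _ _ _ V(1)] by blast
  next
    fix H K
    assume st: "H \<subseteq> lattice_edges V" "lattice_edges V - H \<subseteq> K \<times> ?B \<union> ?B \<times> K" "{x} \<subseteq> K" "K \<subseteq> {x} \<union> ?B"
    have KV: "K \<subseteq> V" using st(4) V(2) by auto
    have finH: "finite H" using st(1) lattice_edges_graph(1) finite_subset by blast
    have "L * of_bool (k \<le> card (K \<inter> cube_face x j)) \<le> conductance H K V"
    proof (cases "k \<le> card (K \<inter> cube_face x j)")
      case True
      then show ?thesis
        using conductance_cube_face[OF d V(1) KV L finH state_edges[OF st(2,4)] k] by simp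
    next
      case False
      then show ?thesis using conductance_nonneg[OF finH V(1) KV] by simp
    qed
    then have "real (num_allowed H (V - K)) * (L * of_bool (k \<le> card (K \<inter> cube_face x j))) \<le> ?g H K"
      by (intro mult_left_mono) auto
    then show "(\<Sum>\<zeta>\<in>allowed_confs H (V - K). ?F K (burnt (lattice_edges V) ?B K \<zeta>)) \<le> ?g H K"
      by simp
  qed (use lattice_edges_graph V in auto)
  moreover have "?g (lattice_edges V) {x} = real (num_allowed (lattice_edges V) V)"
    using num_allowed_eq_conductance[OF lattice_edges_graph V] by simp
  moreover have "(\<Sum>\<zeta>\<in>centre_confs V x. ?F (front V x j \<zeta>) (front V x j \<zeta>)) = L * real (card {\<zeta> \<in> centre_confs V x. k \<le> card (front V x j \<zeta> \<inter> cube_face x j)})"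
  proof -
    have "(\<Sum>\<zeta>\<in>centre_confs V x. ?F (front V x j \<zeta>) (front V x j \<zeta>)) = L * (\<Sum>\<zeta>\<in>centre_confs V x. of_bool (k \<le> card (front V x j \<zeta> \<inter> cube_face x j)))"
      by (simp add: sum_distrib_left)
    also have "(\<Sum>\<zeta>\<in>centre_confs V x. of_bool (k \<le> card (front V x j \<zeta> \<inter> cube_face x j))) =
        real (card {\<zeta> \<in> centre_confs V x. k \<le> card (front V x j \<zeta> \<inter> cube_face x j)})"
      using finite_centre_confs by (simp add: sum_of_bool_eq Int_def)
    finally show ?thesis .
  qed
  ultimately show ?thesis by simp
qed

text \<open>Each edge leaving the cube is closed with conditional probability at least \<open>c / (1 + c) = 1 / 884737\<close>, where
  \<open>c = 1 / 884736\<close> bounds the conductance from its endpoint through a half-space.\<close>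

lemma burning_stops:
  assumes P: "\<And>S. P S \<Longrightarrow> card (S \<inter> cube_face x j) \<le> k"
  defines "\<delta> \<equiv> (1 / 884737 :: real) ^ (2 * CARD('d) * k)"
  shows "real (card {\<zeta> \<in> centre_confs V x. P (front V x j \<zeta>) \<and> front V x (Suc j) \<zeta> \<noteq> front V x j \<zeta>}) \<le> (1 - \<delta>) * real (card {\<zeta> \<in> centre_confs V x. P (front V x j \<zeta>)})"
proof -
  let ?B = "cube x j \<inter> (V - {x})" and ?B' = "cube x (Suc j) \<inter> (V - {x})"
  \<comment> \<open>The sum of this signed weight over each final state is at most 0, which is the
    claim conditioned on the front. With \<open>g = 0\<close> the superadditivity is
    trivial.\<close>
  let ?F = "\<lambda>S S'. of_bool (P S \<and> S' \<noteq> S) - (1 - \<delta>) * of_bool (P S)"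
  have "(\<Sum>\<zeta>\<in>centre_confs V x. ?F (front V x j \<zeta>) (front V x (Suc j) \<zeta>)) \<le> 0"
  proof (rule exploration_bound[where F = ?F and g = "\<lambda>_ _. 0" and ?K0.0 = "{x}" and B = ?B and B' = ?B'])
    show "?B \<subseteq> ?B'" using cube_mono[of j "Suc j" x] by auto
  next
    fix H K
    assume st: "H \<subseteq> lattice_edges V" "sym H" "lattice_edges V - H \<subseteq> K \<times> ?B \<union> ?B \<times> K" "{x} \<subseteq> K" "K \<subseteq> {x} \<union> ?B"
      and closed: "\<And>u w. (u, w) \<in> H \<Longrightarrow> u \<in> K \<Longrightarrow> w \<notin> ?B - K"
    have K: "K \<subseteq> V" "K \<subseteq> cube x j" using st(5) V(2) centre_in_cube by auto
    have H: "finite H" "irrefl H" using st(1) lattice_edges_graph finite_subset by (auto simp: irrefl_def)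
    have finK: "finite K" using K(1) V(1) finite_subset by blast
    let ?W = "V - K"
    show "(\<Sum>\<zeta>\<in>allowed_confs H ?W. ?F K (burnt (lattice_edges V) ?B' K \<zeta>)) \<le> 0"
    proof (cases "P K")
      case False
      then show ?thesis by simp
    next
      case True
      \<comment> \<open>No query is left inside the smaller cube, so these edges all cross its
        surface.\<close>
      define D where "D = {(u, w) \<in> H. u \<in> K \<and> w \<in> ?B' - K}"
      have D_adj: "adjacent u w \<and> u \<in> cube x j \<and> w \<notin> cube x j" if "(u, w) \<in> D" for u w
        using that closed[of u w] st(1) K unfolding D_def lattice_edges_def by auto
      have finD: "finite D" using H(1) by (rule rev_finite_subset) (auto simp: D_def)
      have "D \<subseteq> Sigma (K \<inter> cube_face x j) (\<lambda>u. {w. adjacent u w})"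
        using D_adj adjacent_leaves_cube_sphere unfolding D_def by blast
      then have "card D \<le> card (Sigma (K \<inter> cube_face x j) (\<lambda>u. {w. adjacent u w}))"
        using finK by (intro card_mono finite_SigmaI finite_neighbours) auto
      also have "\<dots> = card (K \<inter> cube_face x j) * (2 * CARD('d))"
        using finK by (subst card_SigmaI) (auto simp: card_neighbours finite_neighbours)
      also have "\<dots> \<le> k * (2 * CARD('d))" using P[OF True] by (rule mult_right_mono) simp
      finally have cardD: "card D \<le> 2 * CARD('d) * k" by (simp add: mult.commute)
      have "(1 / 884736 / (1 + 1 / 884736)) ^ card D * real (num_allowed H ?W) \<le> real (num_allowed (H - D - D\<inverse>) ?W)"
      proof (rule num_allowed_remove_edges[OF finD H(1) st(2) H(2)])
        fix u w assume "(u, w) \<in> D"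
        then show "(u, w) \<in> H \<and> u \<notin> ?W \<and> w \<in> ?W" unfolding D_def by auto
      next
        fix H' u w assume H': "H' \<subseteq> H" "finite H'" "H - H' \<subseteq> D \<union> D\<inverse>" and uw: "(u, w) \<in> D"
        obtain i \<epsilon> where i: "\<bar>\<epsilon>\<bar> = 1" "\<epsilon> * x i + int j + 1 \<le> \<epsilon> * w i"
          using adjacent_leaves_cube[of u w x j] D_adj[OF uw] by metis
        show "1 / 884736 \<le> conductance H' {w} ?W"
        proof (rule conductance_halfspace[where i = i and \<epsilon> = \<epsilon> and h = "\<epsilon> * x i + int j + 1", OF d])
          fix y z assume a: "adjacent y z" "\<epsilon> * x i + int j + 1 \<le> \<epsilon> * y i" "\<epsilon> * x i + int j + 1 \<le> \<epsilon> * z i"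
            "y \<in> ?W \<or> z \<in> ?W"
          have out: "y \<notin> cube x j" "z \<notin> cube x j" using halfspace_disjoint_cube[OF _ i(1)] a by blast+
          have "(y, z) \<in> H" by (rule state_edges[OF st(3,5) a(1)]) (use a out in auto)
          moreover have "(y, z) \<notin> D \<union> D\<inverse>" using D_adj out by auto
          ultimately show "(y, z) \<in> H'" using H'(3) by auto
        qed (use uw V i H'(2) in \<open>auto simp: D_def\<close>)
      qed (use V in auto)
      moreover have "\<delta> \<le> (1 / 884736 / (1 + 1 / 884736)) ^ card D"
        unfolding \<delta>_def using power_decreasing[OF cardD, of "1 / 884737 :: real"] by simp
      ultimately have survive: "\<delta> * real (num_allowed H ?W) \<le> real (num_allowed (H - D - D\<inverse>) ?W)"
        using mult_right_mono[of \<delta> _ "real (num_allowed H ?W)"] by fastforce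
      have fin: "finite (allowed_confs H ?W)" by (rule finite_allowed_confs) (use V in auto)
      \<comment> \<open>Allowed configurations of the graph without \<open>D\<close> are exactly
        suited to stopping: they are allowed for \<open>H\<close>, and their smaller height bound
        lets nothing burn from \<open>K\<close>.\<close>
      have stop: "\<zeta> \<in> allowed_confs H ?W \<and> burnt (lattice_edges V) ?B' K \<zeta> = K" if \<zeta>: "\<zeta> \<in> allowed_confs (H - D - D\<inverse>) ?W" for \<zeta>
      proof
        let ?H = "H - D - D\<inverse>"
        have le: "card (?H `` {y}) \<le> card (H `` {y})" for y
          using H(1) by (intro card_mono) (auto simp: finite_Image)
        have "?H `` {y} \<inter> F = H `` {y} \<inter> F" if "y \<in> F" "F \<subseteq> ?W" for y F
          using that unfolding D_def by auto
        then have "allowed H ?W \<zeta>"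
          using \<zeta> unfolding allowed_confs_def allowed_def by (simp; metis)
        moreover have "\<zeta> y \<le> int (card (H `` {y}))" if "y \<in> ?W" for y
          using \<zeta> that le[of y] unfolding allowed_confs_def by force
        ultimately show "\<zeta> \<in> allowed_confs H ?W" using \<zeta> unfolding allowed_confs_def by auto
        show "burnt (lattice_edges V) ?B' K \<zeta> = K"
        proof (rule burnt_trivial[OF lattice_edges_graph(1)])
          fix y assume y: "y \<in> ?B' - K"
          have "?H `` {y} \<subseteq> lattice_edges V `` {y} - K"
            using y st(1,2) unfolding D_def by (auto dest: symD)
          then have "card (?H `` {y}) \<le> card (lattice_edges V `` {y} - K)"
            using lattice_edges_graph(1) by (intro card_mono) (auto simp: finite_Image)
          moreover have "\<zeta> y \<le> int (card (?H `` {y}))" using \<zeta> y unfolding allowed_confs_def by auto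
          ultimately show "\<zeta> y \<le> int (card (lattice_edges V `` {y} - K))" by linarith
        qed
      qed
      let ?N = "{\<zeta> \<in> allowed_confs H ?W. burnt (lattice_edges V) ?B' K \<zeta> \<noteq> K}"
      have "card ?N + num_allowed (H - D - D\<inverse>) ?W = card (?N \<union> allowed_confs (H - D - D\<inverse>) ?W)"
        by (rule card_Un_disjoint[symmetric]) (use fin stop V in \<open>auto intro: finite_allowed_confs\<close>)
      also have "\<dots> \<le> num_allowed H ?W" by (rule card_mono[OF fin]) (use stop in auto)
      finally have "real (card ?N) \<le> (1 - \<delta>) * real (num_allowed H ?W)"
        using survive by (simp add: algebra_simps)
      moreover have "(\<Sum>\<zeta>\<in>allowed_confs H ?W. ?F K (burnt (lattice_edges V) ?B' K \<zeta>)) = real (card ?N) - (1 - \<delta>) * real (num_allowed H ?W)"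
        using True fin by (simp add: sum_subtractf sum_of_bool_eq Int_def mult.commute)
      ultimately show ?thesis by simp
    qed
  qed (use lattice_edges_graph V in auto)
  moreover have "(\<Sum>\<zeta>\<in>centre_confs V x. ?F (front V x j \<zeta>) (front V x (Suc j) \<zeta>)) =
      real (card {\<zeta> \<in> centre_confs V x. P (front V x j \<zeta>) \<and> front V x (Suc j) \<zeta> \<noteq> front V x j \<zeta>}) - (1 - \<delta>) * real (card {\<zeta> \<in> centre_confs V x. P (front V x j \<zeta>)})"
  proof -
    have "(\<Sum>\<zeta>\<in>centre_confs V x. ?F (front V x j \<zeta>) (front V x (Suc j) \<zeta>)) =
      (\<Sum>\<zeta>\<in>centre_confs V x. of_bool (P (front V x j \<zeta>) \<and> front V x (Suc j) \<zeta> \<noteq> front V x j \<zeta>)) - (1 - \<delta>) * (\<Sum>\<zeta>\<in>centre_confs V x. of_bool (P (front V x j \<zeta>)))"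
      by (simp add: sum_subtractf sum_distrib_left)
    then show ?thesis using finite_centre_confs by (simp add: sum_of_bool_eq Int_def)
  qed
  ultimately show ?thesis by simp
qed

text \<open>The fire leaves the cube only through its surface: a site outside has no burnt neighbour
  when the front misses the face, and a height within the degree cannot burn unaided.\<close>

lemma burnt_confined:
  assumes "\<zeta> \<in> centre_confs V x" "front V x j \<zeta> \<inter> cube_face x j = {}" "B \<subseteq> V - {x}"
  shows "burnt (lattice_edges V) B {x} \<zeta> \<subseteq> front V x j \<zeta>"
proof (rule burnt_least[OF burnt_superset])
  fix y assume y: "y \<in> B" "int (card (lattice_edges V `` {y})) < \<zeta> y + int (card (lattice_edges V `` {y} \<inter> front V x j \<zeta>))"
  show "y \<in> front V x j \<zeta>"
  proof (cases "y \<in> cube x j")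
    case True
    then show ?thesis using y assms(3) by (intro burnt_closed[OF lattice_edges_graph(1)]) auto
  next
    case False
    have "z \<in> cube_face x j" if "z \<in> lattice_edges V `` {y}" "z \<in> cube x j" for z
      by (rule adjacent_leaves_cube_sphere[OF _ that(2) False])
        (use that(1) in \<open>auto simp: lattice_edges_def dest: adjacent_symD\<close>)
    then have "lattice_edges V `` {y} \<inter> front V x j \<zeta> = {}" using assms(2) front_subset[of j \<zeta>] by blast
    moreover have "\<zeta> y \<le> int (card (lattice_edges V `` {y}))" using assms(1,3) y(1) unfolding allowed_confs_def by auto
    ultimately show ?thesis using y(2) by simp
  qed
qed

text \<open>Configurations with at least \<open>k\<close> surface sites are all let through; of the
  other alive ones at most the fraction \<open>1 - \<delta>\<close> continues. Adding up leaves
  weight \<open>\<delta>\<close> on the exceptional ones.\<close>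

lemma alive_Suc:
  assumes L: "0 < L" and k: "2 * real CARD('d) * (8 * L + 64 * 884736 * L ^ 3) \<le> real k"
  defines "\<delta> \<equiv> (1 / 884737 :: real) ^ (2 * CARD('d) * k)"
  shows "real (alive V x (Suc j)) \<le> (1 - \<delta>) * real (alive V x j) + \<delta> * (real (num_allowed (lattice_edges V) V) / L)"
proof -
  let ?S = "cube_face x j"
  let ?bad = "{\<zeta> \<in> centre_confs V x. k \<le> card (front V x j \<zeta> \<inter> ?S)}"
  let ?P = "\<lambda>S. card (S \<inter> ?S) \<le> k \<and> \<not> k \<le> card (S \<inter> ?S) \<and> S \<inter> ?S \<noteq> {}"
  let ?good = "{\<zeta> \<in> centre_confs V x. ?P (front V x j \<zeta>)}"
  let ?move = "{\<zeta> \<in> centre_confs V x. ?P (front V x j \<zeta>) \<and> front V x (Suc j) \<zeta> \<noteq> front V x j \<zeta>}"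
  have fin: "finite ?bad" "finite ?good" "finite ?move" using finite_centre_confs by auto
  have "0 < 2 * real CARD('d) * (8 * L + 64 * 884736 * L ^ 3)"
    using L by (intro mult_pos_pos add_pos_pos) auto
  \<comment> \<open>With \<open>k\<close> positive, every exceptional configuration is
    alive.\<close>
  then have "0 < k" using k by (metis less_le_trans of_nat_0_less_iff)
  then have "card (?bad \<union> ?good) = alive V x j"
    unfolding alive_def by (intro arg_cong[where f = card]) auto
  moreover have "card (?bad \<union> ?good) = card ?bad + card ?good"
    by (rule card_Un_disjoint) (use fin in auto)
  ultimately have sum: "real (alive V x j) = real (card ?bad) + real (card ?good)" by simp
  have "{\<zeta> \<in> centre_confs V x. front V x (Suc j) \<zeta> \<inter> cube_face x (Suc j) \<noteq> {}} \<subseteq> ?bad \<union> ?move"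
  proof
    fix \<zeta> assume "\<zeta> \<in> {\<zeta> \<in> centre_confs V x. front V x (Suc j) \<zeta> \<inter> cube_face x (Suc j) \<noteq> {}}"
    then have \<zeta>: "\<zeta> \<in> centre_confs V x" "front V x (Suc j) \<zeta> \<inter> cube_face x (Suc j) \<noteq> {}" by blast+
    have "\<not> front V x (Suc j) \<zeta> \<subseteq> front V x j \<zeta>"
      using \<zeta>(2) front_subset[of j \<zeta>] cube_face_Suc_disjoint[of x j] by blast
    moreover from this have "front V x j \<zeta> \<inter> ?S \<noteq> {}"
      using burnt_confined[OF \<zeta>(1), of j "cube x (Suc j) \<inter> (V - {x})"] by auto
    ultimately show "\<zeta> \<in> ?bad \<union> ?move"
      using \<zeta>(1) by (cases "k \<le> card (front V x j \<zeta> \<inter> ?S)") auto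
  qed
  then have "alive V x (Suc j) \<le> card (?bad \<union> ?move)"
    unfolding alive_def using fin by (intro card_mono) auto
  also have "\<dots> \<le> card ?bad + card ?move" by (rule card_Un_le)
  finally have "real (alive V x (Suc j)) \<le> real (card ?bad) + real (card ?move)" by linarith
  also have "real (card ?move) \<le> (1 - \<delta>) * real (card ?good)"
    unfolding \<delta>_def by (rule burning_stops) auto
  also have "(1 - \<delta>) * real (card ?good) = (1 - \<delta>) * real (alive V x j) - (1 - \<delta>) * real (card ?bad)"
    unfolding sum by (simp add: algebra_simps)
  finally have "real (alive V x (Suc j)) \<le> (1 - \<delta>) * real (alive V x j) + \<delta> * real (card ?bad)"
    by (simp add: algebra_simps)
  moreover have "real (card ?bad) \<le> real (num_allowed (lattice_edges V) V) / L"
    using many_sphere_sites_rare[OF L k, of j] L by (simp add: field_simps)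
  then have "\<delta> * real (card ?bad) \<le> \<delta> * (real (num_allowed (lattice_edges V) V) / L)"
    by (rule mult_left_mono) (simp add: \<delta>_def)
  ultimately show ?thesis by linarith
qed

text \<open>The two counts differ by the conductance from \<open>x\<close>, which a half-space
  through \<open>x\<close> bounds below; its direction is arbitrary.\<close>

lemma num_allowed_minus_centre: "real (num_allowed (lattice_edges V) (V - {x})) \<le> 884736 * real (num_allowed (lattice_edges V) V)"
proof -
  have "1 / 884736 \<le> conductance (lattice_edges V) {x} V"
    by (rule conductance_halfspace[OF d V, where \<epsilon> = 1 and h = "x undefined" and i = undefined])
      (use lattice_edges_graph in \<open>auto simp: lattice_edges_def\<close>)
  then have "1 / 884736 * real (num_allowed (lattice_edges V) (V - {x})) \<le> real (num_allowed (lattice_edges V) V)"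
    unfolding num_allowed_eq_conductance[OF lattice_edges_graph V] by (intro mult_right_mono) auto
  then show ?thesis by simp
qed

text \<open>\<open>1 / L\<close> is the fixed point of the recursion, so only the excess over it has
  to decay.\<close>

lemma alive_bound:
  assumes L: "0 < L" and k: "2 * real CARD('d) * (8 * L + 64 * 884736 * L ^ 3) \<le> real k"
  defines "\<delta> \<equiv> (1 / 884737 :: real) ^ (2 * CARD('d) * k)"
  shows "real (alive V x n) \<le> ((1 - \<delta>) ^ n * 884736 + 1 / L) * real (num_allowed (lattice_edges V) V)"
proof (induction n)
  case 0
  have "alive V x 0 \<le> num_allowed (lattice_edges V) (V - {x})"
    unfolding alive_def by (rule card_mono[OF finite_centre_confs]) auto
  then have "real (alive V x 0) \<le> 884736 * real (num_allowed (lattice_edges V) V)"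
    using num_allowed_minus_centre by linarith
  moreover have "0 \<le> 1 / L * real (num_allowed (lattice_edges V) V)" using L by simp
  ultimately show ?case by (simp add: algebra_simps)
next
  case (Suc n)
  have \<delta>: "0 \<le> 1 - \<delta>" unfolding \<delta>_def by (simp add: power_le_one)
  have "real (alive V x (Suc n)) \<le> (1 - \<delta>) * real (alive V x n) + \<delta> * (real (num_allowed (lattice_edges V) V) / L)"
    unfolding \<delta>_def by (rule alive_Suc[OF L k])
  also have "\<dots> \<le> (1 - \<delta>) * (((1 - \<delta>) ^ n * 884736 + 1 / L) * real (num_allowed (lattice_edges V) V)) + \<delta> * (real (num_allowed (lattice_edges V) V) / L)"
    using mult_left_mono[OF Suc.IH \<delta>] by simp
  also have "\<dots> = ((1 - \<delta>) ^ Suc n * 884736 + 1 / L) * real (num_allowed (lattice_edges V) V)"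
    by (simp add: algebra_simps add_divide_distrib diff_divide_distrib)
  finally show ?case .
qed

lemma card_not_confined_le_alive:
  "card {\<zeta> \<in> centre_confs V x. \<not> burnt (lattice_edges V) (V - {x}) {x} \<zeta> \<subseteq> cube x n} \<le> alive V x n"
  unfolding alive_def
proof (rule card_mono)
  show "{\<zeta> \<in> centre_confs V x. \<not> burnt (lattice_edges V) (V - {x}) {x} \<zeta> \<subseteq> cube x n} \<subseteq> {\<zeta> \<in> centre_confs V x. front V x n \<zeta> \<inter> cube_face x n \<noteq> {}}"
    using burnt_confined[of _ n "V - {x}"] front_subset by blast
qed (use finite_centre_confs in auto)

end

lemma burnt_far_rare:
  fixes x :: "'d::finite site"
  assumes d: "CARD('d) \<ge> 3" and e: "0 < (e :: real)"
  obtains n where "\<And>V. finite V \<Longrightarrow> x \<in> V \<Longrightarrow>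
    real (card {\<zeta> \<in> allowed_confs (lattice_edges V) (V - {x}). \<not> burnt (lattice_edges V) (V - {x}) {x} \<zeta> \<subseteq> cube x n})
      \<le> e * real (num_allowed (lattice_edges V) V)"
proof -
  \<comment> \<open>Half of \<open>e\<close> goes to \<open>1 / L\<close> and half to the decaying
    term. \<open>L\<close>, \<open>k\<close>, \<open>\<delta>\<close> and \<open>n\<close> are fixed
    in this order, none depending on \<open>V\<close>.\<close>
  define L where "L = 2 / e"
  have L: "0 < L" using e by (simp add: L_def)
  obtain k :: nat where k: "2 * real CARD('d) * (8 * L + 64 * 884736 * L ^ 3) \<le> real k"
    using real_arch_simple by blast
  define \<delta> where "\<delta> = (1 / 884737 :: real) ^ (2 * CARD('d) * k)"
  have "0 < \<delta>" "\<delta> \<le> 1" unfolding \<delta>_def by (auto simp: power_le_one)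
  then obtain n where n: "(1 - \<delta>) ^ n < e / 2 / 884736"
    using real_arch_pow_inv[of "e / 2 / 884736" "1 - \<delta>"] e by auto
  show ?thesis
  proof (rule that[of n])
    fix V assume V: "finite V" "x \<in> V"
    have "real (card {\<zeta> \<in> allowed_confs (lattice_edges V) (V - {x}). \<not> burnt (lattice_edges V) (V - {x}) {x} \<zeta> \<subseteq> cube x n})
       \<le> ((1 - \<delta>) ^ n * 884736 + 1 / L) * real (num_allowed (lattice_edges V) V)"
      using card_not_confined_le_alive[OF d V, of n] alive_bound[OF d V L k, of n] unfolding \<delta>_def by linarith
    also have "\<dots> \<le> e * real (num_allowed (lattice_edges V) V)"
      by (rule mult_right_mono) (use n in \<open>auto simp: L_def\<close>)
    finally show "real (card {\<zeta> \<in> allowed_confs (lattice_edges V) (V - {x}). \<not> burnt (lattice_edges V) (V - {x}) {x} \<zeta> \<subseteq> cube x n})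
      \<le> e * real (num_allowed (lattice_edges V) V)" .
  qed
qed

section \<open>Abelian property and stabilization\<close>

lemma topple_commute: "topple V z (topple V w \<xi>) = topple V w (topple V z \<xi>)"
  unfolding topple_def by (auto simp: fun_eq_iff)

lemma topple_add: "topple V z (\<lambda>y. \<xi> y + n y) = (\<lambda>y. topple V z \<xi> y + n y)"
  unfolding topple_def by (auto simp: fun_eq_iff)

lemma topple_other_ge: "y \<noteq> z \<Longrightarrow> \<xi> y \<le> topple V z \<xi> y"
  unfolding topple_def Lap_def by auto

lemma legal_seq_append:
  "legal_seq V \<xi> zs \<xi>' \<Longrightarrow> legal_seq V \<xi>' ws \<sigma> \<Longrightarrow> legal_seq V \<xi> (zs @ ws) \<sigma>"
  by (induction rule: legal_seq.induct) (auto intro: legal_seq.cons)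

lemma legal_seq_add:
  "legal_seq V \<xi> zs \<xi>' \<Longrightarrow> (\<And>y. 0 \<le> n y) \<Longrightarrow> legal_seq V (\<lambda>y. \<xi> y + n y) zs (\<lambda>y. \<xi>' y + n y)"
proof (induction rule: legal_seq.induct)
  case (nil \<xi>)
  show ?case by (rule legal_seq.nil)
next
  case (cons z \<xi> zs \<xi>')
  have "2 * int CARD('a) < \<xi> z + n z" using cons.hyps(2) cons.prems[of z] by linarith
  then show ?case
    using cons by (intro legal_seq.cons) (auto simp: topple_add)
qed

lemma stable_legal_seq:
  assumes "stable V \<xi>" "legal_seq V \<xi> zs \<xi>'"
  shows "zs = [] \<and> \<xi>' = \<xi>"
  using assms(2,1) by (cases rule: legal_seq.cases) (force simp: stable_def)+

text \<open>An unstable site only gains grains until it topples, so a stabilizing sequence must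
  topple \<open>z\<close> at some point; that toppling commutes past the earlier ones.\<close>

lemma legal_seq_move_front:
  assumes "legal_seq V \<xi> ws \<sigma>" "stable V \<sigma>" "z \<in> V" "2 * int CARD('d) < \<xi> z"
  shows "\<exists>ws'. mset ws = mset (z # ws') \<and> legal_seq V (topple V z (\<xi> :: 'd::finite config)) ws' \<sigma>"
  using assms
proof (induction rule: legal_seq.induct)
  case (nil \<xi>)
  then show ?case by (force simp: stable_def)
next
  case (cons w \<xi> ws \<sigma>)
  show ?case
  proof (cases "w = z")
    case True
    then show ?thesis using cons.hyps by auto
  next
    case False
    have "2 * int CARD('d) < topple V w \<xi> z"
      using topple_other_ge[of z w \<xi> V] False cons.prems(3) by fastforce
    then obtain ws' where ws': "mset ws = mset (z # ws')" "legal_seq V (topple V z (topple V w \<xi>)) ws' \<sigma>"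
      using cons.IH cons.prems by blast
    have "2 * int CARD('d) < topple V z \<xi> w"
      using topple_other_ge[of w z \<xi> V] False cons.hyps(2) by fastforce
    then have "legal_seq V (topple V z \<xi>) (w # ws') \<sigma>"
      using ws'(2) cons.hyps(1) by (intro legal_seq.cons) (auto simp: topple_commute)
    then show ?thesis using ws'(1) by (intro exI[of _ "w # ws'"]) auto
  qed
qed

text \<open>Least action: what has been toppled legally is part of every stabilization. Uniqueness,
  the peeling of waves and monotonicity in the volume all rest on this.\<close>

lemma legal_seq_extend:
  fixes \<xi> :: "'d::finite config"
  assumes "legal_seq V \<xi> zs \<xi>'" "legal_seq V \<xi> ws \<sigma>" "stable V \<sigma>"
  shows "\<exists>vs. legal_seq V \<xi>' vs \<sigma> \<and> mset ws = mset (zs @ vs)"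
  using assms
proof (induction arbitrary: ws rule: legal_seq.induct)
  case (nil \<xi>)
  then show ?case by auto
next
  case (cons z \<xi> zs \<xi>')
  obtain ws' where ws': "mset ws = mset (z # ws')" "legal_seq V (topple V z \<xi>) ws' \<sigma>"
    using legal_seq_move_front[OF cons.prems cons.hyps(1,2)] by blast
  obtain vs where "legal_seq V \<xi>' vs \<sigma>" "mset ws' = mset (zs @ vs)"
    using cons.IH[OF ws'(2) cons.prems(2)] by blast
  then show ?case using ws'(1) by auto
qed

lemma stabilization_unique:
  fixes \<xi> :: "'d::finite config"
  assumes "legal_seq V \<xi> zs \<xi>'" "stable V \<xi>'" "legal_seq V \<xi> ws \<sigma>" "stable V \<sigma>"
  shows "\<sigma> = \<xi>' \<and> mset ws = mset zs"
  using legal_seq_extend[OF assms(1,3,4)] stable_legal_seq[OF assms(2)] by auto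

lemma stab_eq:
  assumes "legal_seq V \<xi> zs \<sigma>" "stable V \<sigma>"
  shows "stab V \<xi> = \<sigma>"
  unfolding stab_def
proof (rule the_equality)
  show "\<exists>zs. legal_seq V \<xi> zs \<sigma> \<and> stable V \<sigma>" using assms by blast
next
  fix \<xi>' assume "\<exists>zs. legal_seq V \<xi> zs \<xi>' \<and> stable V \<xi>'"
  then show "\<xi>' = \<sigma>" using stabilization_unique[OF assms] by blast
qed

lemma NV_eq:
  assumes "legal_seq V ((restr V \<eta>)(x := restr V \<eta> x + 1)) zs \<sigma>" "stable V \<sigma>"
  shows "NV V x y \<eta> = count_list zs y"
  unfolding NV_def
proof (rule the_equality)
  show "\<exists>zs' \<xi>'. legal_seq V ((restr V \<eta>)(x := restr V \<eta> x + 1)) zs' \<xi>' \<and> stable V \<xi>' \<and> count_list zs' y = count_list zs y"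
    using assms by blast
next
  fix n assume "\<exists>zs' \<xi>'. legal_seq V ((restr V \<eta>)(x := restr V \<eta> x + 1)) zs' \<xi>' \<and> stable V \<xi>' \<and> count_list zs' y = n"
  then obtain zs' \<xi>' where "legal_seq V ((restr V \<eta>)(x := restr V \<eta> x + 1)) zs' \<xi>'" "stable V \<xi>'" "count_list zs' y = n"
    by blast
  then show "n = count_list zs y"
    using stabilization_unique[OF assms, of zs' \<xi>'] by (metis count_mset)
qed

lemma legal_seq_nonneg:
  fixes \<xi> :: "'d::finite config"
  assumes "legal_seq V \<xi> zs \<xi>'" "\<And>y. 0 \<le> \<xi> y"
  shows "0 \<le> \<xi>' y"
  using assms
proof (induction arbitrary: y rule: legal_seq.induct)
  case (cons z \<xi> zs \<xi>')
  have "0 \<le> topple V z \<xi> y" for y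
  proof (cases "y = z")
    case True
    then show ?thesis using cons.hyps(2) by (simp add: topple_def Lap_def)
  next
    case False
    then show ?thesis using topple_other_ge[of y z \<xi> V] cons.prems[of y] by linarith
  qed
  then show ?case using cons.IH by blast
qed

lemma sum_neighbours:
  fixes g :: "'d::finite site \<Rightarrow> int"
  shows "(\<Sum>y | adjacent z y. g y) = (\<Sum>k\<in>UNIV. g (z(k := z k + 1)) + g (z(k := z k - 1)))"
proof -
  have inj: "inj_on (\<lambda>(i, s). z(i := z i + s)) (UNIV \<times> {1, -1 :: int})"
  proof (rule eq_card_imp_inj_on)
    show "card ((\<lambda>(i, s). z(i := z i + s)) ` (UNIV \<times> {1, -1 :: int})) = card (UNIV \<times> {1, -1 :: int} :: ('d \<times> int) set)"
      unfolding neighbours_eq[symmetric] card_neighbours by (simp add: card_cartesian_product)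
  qed simp
  have "(\<Sum>y | adjacent z y. g y) = (\<Sum>(i, s)\<in>UNIV \<times> {1, -1}. g (z(i := z i + s)))"
    unfolding neighbours_eq by (subst sum.reindex[OF inj]) (simp add: case_prod_beta)
  also have "\<dots> = (\<Sum>i\<in>UNIV. \<Sum>s\<in>{1, -1}. g (z(i := z i + s)))"
    by (rule sum.cartesian_product[symmetric])
  finally show ?thesis by simp
qed

text \<open>Termination: the parabola \<open>M\<^sup>2 - y\<^sub>i\<^sup>2\<close> is a strictly superharmonic weight that is nonnegative on
  \<open>V\<close> and its neighbours.\<close>

lemma superharmonic_weight:
  fixes V :: "'d::finite site set"
  assumes "finite V"
  obtains g :: "'d site \<Rightarrow> int" where "\<And>y. y \<in> V \<Longrightarrow> 0 \<le> g y" "\<And>z. z \<in> V \<Longrightarrow> 1 \<le> (\<Sum>y\<in>V. Lap z y * g y)"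
proof -
  fix i :: 'd
  define M where "M = (\<Sum>y\<in>V. \<bar>y i\<bar>) + 1"
  have M: "\<bar>y i\<bar> + 1 \<le> M" if "y \<in> V" for y
    unfolding M_def using member_le_sum[OF that, of "\<lambda>y. \<bar>y i\<bar>"] assms by simp
  define g :: "'d site \<Rightarrow> int" where "g = (\<lambda>y. M\<^sup>2 - (y i)\<^sup>2)"
  have g_nonneg: "0 \<le> g y" if "\<bar>y i\<bar> \<le> M" for y
    unfolding g_def using that by (simp add: abs_le_square_iff[symmetric])
  have near: "0 \<le> g y" if zy: "z \<in> V" "adjacent z y" for y z
  proof (rule g_nonneg)
    obtain k s where "\<bar>s\<bar> = 1" "y = z(k := z k + s)" using zy(2) unfolding adjacent_iff by blast
    then show "\<bar>y i\<bar> \<le> M" using M[OF that(1)] by (cases "k = i") auto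
  qed
  have "1 \<le> (\<Sum>y\<in>V. Lap z y * g y)" if z: "z \<in> V" for z
  proof -
    have "(\<Sum>y\<in>V. Lap z y * g y) = 2 * int CARD('d) * g z - (\<Sum>y\<in>V \<inter> {y. adjacent z y}. g y)"
    proof -
      have "(\<Sum>y\<in>V. Lap z y * g y) = (\<Sum>y\<in>V. (if y = z then 2 * int CARD('d) * g z else 0) - (if adjacent z y then g y else 0))"
        by (rule sum.cong) (auto simp: Lap_def not_adjacent_self)
      also have "\<dots> = 2 * int CARD('d) * g z - (\<Sum>y\<in>V. if adjacent z y then g y else 0)"
        using z assms by (simp add: sum_subtractf)
      also have "(\<Sum>y\<in>V. if adjacent z y then g y else 0) = (\<Sum>y\<in>V \<inter> {y. adjacent z y}. g y)"
        using assms by (simp add: sum.If_cases)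
      finally show ?thesis .
    qed
    moreover have "(\<Sum>y\<in>V \<inter> {y. adjacent z y}. g y) \<le> (\<Sum>y | adjacent z y. g y)"
      by (rule sum_mono2) (use near[OF z] finite_neighbours in auto)
    \<comment> \<open>The second difference of a square is 2, and only direction \<open>i\<close>
      contributes.\<close>
    moreover have "(\<Sum>y | adjacent z y. g y) = (\<Sum>k\<in>UNIV. 2 * g z - (if k = i then 2 else 0))"
      unfolding sum_neighbours g_def by (rule sum.cong) (auto simp: power2_eq_square algebra_simps)
    moreover have "\<dots> = 2 * int CARD('d) * g z - 2"
      by (simp add: sum_subtractf)
    ultimately show ?thesis by linarith
  qed
  moreover have "0 \<le> g y" if "y \<in> V" for y
    using g_nonneg M[OF that] by simp
  ultimately show ?thesis using that by blast
qed

text \<open>Each toppling lowers the weighted mass by at least 1, while heights, and with them the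
  mass, stay nonnegative.\<close>

lemma stabilizes:
  fixes \<xi> :: "'d::finite config"
  assumes V: "finite V" and "\<And>y. 0 \<le> \<xi> y"
  shows "\<exists>zs \<sigma>. legal_seq V \<xi> zs \<sigma> \<and> stable V \<sigma>"
proof -
  obtain g :: "'d site \<Rightarrow> int" where g: "\<And>y. y \<in> V \<Longrightarrow> 0 \<le> g y" "\<And>z. z \<in> V \<Longrightarrow> 1 \<le> (\<Sum>y\<in>V. Lap z y * g y)"
    by (rule superharmonic_weight[OF V]) blast
  show ?thesis using assms(2)
  proof (induction "nat (\<Sum>y\<in>V. \<xi> y * g y)" arbitrary: \<xi> rule: less_induct)
    case less
    show ?case
    proof (cases "stable V \<xi>")
      case True
      then show ?thesis using legal_seq.nil by blast
    next
      case False
      then obtain z where z: "z \<in> V" "2 * int CARD('d) < \<xi> z" unfolding stable_def by force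
      have one: "legal_seq V \<xi> [z] (topple V z \<xi>)"
        using z by (intro legal_seq.cons legal_seq.nil) auto
      have nn: "0 \<le> topple V z \<xi> y" for y
        by (rule legal_seq_nonneg[OF one less.prems])
      have "(\<Sum>y\<in>V. topple V z \<xi> y * g y) = (\<Sum>y\<in>V. \<xi> y * g y) - (\<Sum>y\<in>V. Lap z y * g y)"
        unfolding sum_subtractf[symmetric] by (rule sum.cong) (auto simp: topple_def algebra_simps)
      moreover have "0 \<le> (\<Sum>y\<in>V. topple V z \<xi> y * g y)"
        using nn g(1) by (intro sum_nonneg) auto
      ultimately have "nat (\<Sum>y\<in>V. topple V z \<xi> y * g y) < nat (\<Sum>y\<in>V. \<xi> y * g y)"
        using g(2)[OF z(1)] by linarith
      then obtain zs \<sigma> where "legal_seq V (topple V z \<xi>) zs \<sigma>" "stable V \<sigma>"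
        using less.hyps[of "topple V z \<xi>"] nn by blast
      then show ?thesis using legal_seq_append[OF one] by blast
    qed
  qed
qed

lemma legal_seq_distinct_result:
  fixes \<xi> :: "'d::finite config"
  assumes "legal_seq V \<xi> zs \<xi>'" "distinct zs" "y \<in> V"
  shows "\<xi>' y = \<xi> y - (if y \<in> set zs then 2 * int CARD('d) else 0) + int (card ({z. adjacent y z} \<inter> set zs))"
  using assms
proof (induction rule: legal_seq.induct)
  case (nil \<xi>)
  then show ?case by simp
next
  case (cons z \<xi> zs \<xi>')
  have "card ({w. adjacent y w} \<inter> set (z # zs)) = card ({w. adjacent y w} \<inter> set zs) + (if adjacent y z then 1 else 0)"
    using cons.prems(1) by (auto simp: Int_insert_right)
  then show ?case
    using cons.IH cons.prems not_adjacent_self[of y] adjacent_sym[of y z]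
    by (auto simp: topple_def Lap_def)
qed

lemma legal_seq_outside:
  "legal_seq V \<xi> zs \<xi>' \<Longrightarrow> y \<notin> V \<Longrightarrow> \<xi>' y = \<xi> y"
  by (induction rule: legal_seq.induct) (auto simp: topple_def)

text \<open>Apply the criterion to \<open>F - {z}\<close>: a neighbour of \<open>z\<close> gains one
  grain, which pays for putting \<open>z\<close> back into \<open>F\<close>. For
  \<open>F = {z}\<close> the toppled site still has positive height.\<close>

lemma allowed_topple:
  fixes \<xi> :: "'d::finite config"
  assumes "allowed (lattice_edges V) V \<xi>" "z \<in> V" "2 * int CARD('d) < \<xi> z" "finite V"
  shows "allowed (lattice_edges V) V (topple V z \<xi>)"
  unfolding allowed_def
proof (intro allI impI, elim conjE)
  fix F assume F: "F \<subseteq> V" "F \<noteq> {}"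
  let ?nb = "\<lambda>y. lattice_edges V `` {y}"
  have fin: "finite (?nb y \<inter> S)" for y S
    using finite_lattice_edges[OF assms(4)] by (simp add: finite_Image)
  show "\<exists>y\<in>F. int (card (?nb y \<inter> F)) < topple V z \<xi> y"
  proof (cases "F - {z} = {}")
    case True
    then have "F = {z}" using F by auto
    moreover have "?nb z \<inter> {z} = {}" using irrefl_lattice_edges by (auto simp: irrefl_def)
    ultimately show ?thesis using assms(2,3) by (auto simp: topple_def Lap_def)
  next
    case False
    then obtain y where y: "y \<in> F" "y \<noteq> z" "int (card (?nb y \<inter> (F - {z}))) < \<xi> y"
      using assms(1) F unfolding allowed_def by (metis Diff_iff Diff_subset empty_iff insertCI order_trans)
    have "card (?nb y \<inter> F) \<le> card (?nb y \<inter> (F - {z})) + (if adjacent z y then 1 else 0)"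
    proof (cases "adjacent z y")
      case True
      have "?nb y \<inter> F \<subseteq> insert z (?nb y \<inter> (F - {z}))" by auto
      then have "card (?nb y \<inter> F) \<le> card (insert z (?nb y \<inter> (F - {z})))" using fin by (intro card_mono) auto
      also have "\<dots> \<le> Suc (card (?nb y \<inter> (F - {z})))" using fin by (simp add: card_insert_if)
      finally show ?thesis using True by simp
    next
      case False
      then have "?nb y \<inter> F = ?nb y \<inter> (F - {z})"
        unfolding lattice_edges_def by (auto dest: adjacent_symD)
      then show ?thesis by simp
    qed
    moreover have "topple V z \<xi> y = \<xi> y + (if adjacent z y then 1 else 0)"
      using y F by (auto simp: topple_def Lap_def)
    ultimately show ?thesis using y by (intro bexI[of _ y]) auto
  qed
qed

lemma allowed_legal_seq:
  "legal_seq V \<xi> zs \<xi>' \<Longrightarrow> finite V \<Longrightarrow> allowed (lattice_edges V) V \<xi> \<Longrightarrow> allowed (lattice_edges V) V \<xi>'"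
  by (induction rule: legal_seq.induct) (auto intro: allowed_topple)

text \<open>Burning is toppling: if \<open>\<xi>\<close> holds, beyond \<open>\<zeta>\<close>, one
  grain for each neighbour in \<open>K\<close>, then a site becomes unstable exactly when the
  burning rule applies to \<open>K\<close> and the sites toppled so far.\<close>

lemma burning_sequence:
  fixes \<xi> :: "'d::finite config"
  assumes V: "finite V" "B \<subseteq> V" "B \<inter> K = {}"
    and \<xi>: "\<And>y. y \<in> B \<Longrightarrow> \<zeta> y + int (card (lattice_edges V `` {y} \<inter> K)) \<le> \<xi> y"
  obtains zs \<xi>' where "legal_seq V \<xi> zs \<xi>'" "distinct zs" "set zs = burnt (lattice_edges V) B K \<zeta> - K"
proof -
  let ?nb = "\<lambda>y. lattice_edges V `` {y}"
  let ?T = "burnt (lattice_edges V) B K \<zeta>"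
  have finG: "finite (lattice_edges V)" by (rule finite_lattice_edges[OF V(1)])
  have fin: "finite (?nb y \<inter> S)" for y S using finG by (simp add: finite_Image)
  have TK: "?T - K \<subseteq> B" using burnt_subset[of "lattice_edges V" B K \<zeta>] by auto
  then have finT: "finite (?T - K)" using V(1,2) by (meson finite_subset)
  have "\<exists>zs \<xi>'. legal_seq V \<xi> zs \<xi>' \<and> distinct zs \<and> set zs \<subseteq> ?T - K \<and> length zs = n" if "n \<le> card (?T - K)" for n
    using that
  proof (induction n)
    case 0
    then show ?case using legal_seq.nil by auto
  next
    case (Suc n)
    then obtain zs \<xi>' where zs: "legal_seq V \<xi> zs \<xi>'" "distinct zs" "set zs \<subseteq> ?T - K" "length zs = n"
      by auto
    \<comment> \<open>While burnt sites are missing from the list, \<open>K\<close> together with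
      the list is not closed under burning, and a violating site can topple next.\<close>
    have "\<not> ?T \<subseteq> K \<union> set zs"
    proof
      assume "?T \<subseteq> K \<union> set zs"
      then have "?T - K \<subseteq> set zs" by auto
      then have "card (?T - K) \<le> card (set zs)" by (intro card_mono) auto
      then show False using zs Suc.prems by (simp add: distinct_card)
    qed
    then obtain y where y: "y \<in> B" "int (card (?nb y)) < \<zeta> y + int (card (?nb y \<inter> (K \<union> set zs)))" "y \<notin> K \<union> set zs"
      using burnt_least[of K "K \<union> set zs" B "lattice_edges V" \<zeta>] by auto
    have yV: "y \<in> V" using y(1) V by auto
    have "K \<union> set zs \<subseteq> ?T" using zs(3) burnt_superset[of K "lattice_edges V" B \<zeta>] by auto
    then have "card (?nb y \<inter> (K \<union> set zs)) \<le> card (?nb y \<inter> ?T)" using fin by (intro card_mono) auto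
    then have yT: "y \<in> ?T" using y(2) by (intro burnt_closed[OF finG y(1)]) linarith
    have "card (?nb y \<inter> (K \<union> set zs)) \<le> card (?nb y \<inter> K) + card (?nb y \<inter> set zs)"
      unfolding Int_Un_distrib by (rule card_Un_le)
    moreover have "\<xi>' y = \<xi> y + int (card (?nb y \<inter> set zs))"
      using legal_seq_distinct_result[OF zs(1,2) yV] y(3) by (simp add: lattice_edges_Image[OF yV])
    moreover have "card (?nb y) = 2 * CARD('d)"
      by (simp add: lattice_edges_Image[OF yV] card_neighbours)
    ultimately have "2 * int CARD('d) < \<xi>' y" using \<xi>[OF y(1)] y(2) by linarith
    then have "legal_seq V \<xi>' [y] (topple V y \<xi>')" using yV by (intro legal_seq.cons legal_seq.nil)
    then have "legal_seq V \<xi> (zs @ [y]) (topple V y \<xi>')" using legal_seq_append zs(1) by blast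
    moreover have "distinct (zs @ [y])" "set (zs @ [y]) \<subseteq> ?T - K" "length (zs @ [y]) = Suc n"
      using zs y yT by auto
    ultimately show ?case by blast
  qed
  then obtain zs \<xi>' where zs: "legal_seq V \<xi> zs \<xi>'" "distinct zs" "set zs \<subseteq> ?T - K" "length zs = card (?T - K)"
    by blast
  have "set zs = ?T - K"
    by (rule card_subset_eq[OF finT zs(3)]) (use zs distinct_card in metis)
  then show ?thesis using that zs by blast
qed

section \<open>Recurrent configurations are the allowed ones\<close>

definition recurrent_confs :: "'d::finite site set \<Rightarrow> 'd config set" where
  "recurrent_confs V = allowed_confs (lattice_edges V) V"

definition add_stab :: "'d::finite site set \<Rightarrow> 'd config \<Rightarrow> 'd config \<Rightarrow> 'd config" where
  "add_stab V n \<xi> = stab V (\<lambda>y. \<xi> y + n y)"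

lemma addop_eq_add_stab: "addop x V \<xi> = add_stab V (\<lambda>y. of_bool (y = x)) \<xi>"
  unfolding addop_def add_stab_def by (rule arg_cong[where f = "stab V"]) auto

lemma add_stab_legal:
  fixes \<xi> :: "'d::finite config"
  assumes "finite V" "\<And>y. 0 \<le> \<xi> y" "\<And>y. 0 \<le> n y"
  obtains zs where "legal_seq V (\<lambda>y. \<xi> y + n y) zs (add_stab V n \<xi>)" "stable V (add_stab V n \<xi>)"
proof -
  obtain zs \<sigma> where "legal_seq V (\<lambda>y. \<xi> y + n y) zs \<sigma>" "stable V \<sigma>"
    using stabilizes[OF assms(1), of "\<lambda>y. \<xi> y + n y"] assms(2,3) by (metis add_nonneg_nonneg)
  moreover from this have "add_stab V n \<xi> = \<sigma>" unfolding add_stab_def by (rule stab_eq)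
  ultimately show ?thesis using that by blast
qed

lemma add_stab_nonneg:
  assumes "finite V" "\<And>y. 0 \<le> \<xi> y" "\<And>y. 0 \<le> n y"
  shows "0 \<le> add_stab V n \<xi> y"
proof -
  obtain zs where "legal_seq V (\<lambda>y. \<xi> y + n y) zs (add_stab V n \<xi>)"
    by (rule add_stab_legal[OF assms])
  then show ?thesis by (rule legal_seq_nonneg) (use assms in auto)
qed

text \<open>The Abelian property: stabilizing the first batch is a legal beginning for both batches
  together.\<close>

lemma add_stab_add_stab:
  assumes "finite V" "\<And>y. 0 \<le> \<xi> y" "\<And>y. 0 \<le> n y" "\<And>y. 0 \<le> m y"
  shows "add_stab V m (add_stab V n \<xi>) = add_stab V (\<lambda>y. n y + m y) \<xi>"
proof -
  let ?\<sigma> = "add_stab V n \<xi>"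
  obtain zs where zs: "legal_seq V (\<lambda>y. \<xi> y + n y) zs ?\<sigma>"
    by (rule add_stab_legal[OF assms(1-3)])
  obtain ws where ws: "legal_seq V (\<lambda>y. ?\<sigma> y + m y) ws (add_stab V m ?\<sigma>)" "stable V (add_stab V m ?\<sigma>)"
    by (rule add_stab_legal[OF assms(1) add_stab_nonneg[OF assms(1-3)] assms(4)])
  have "legal_seq V (\<lambda>y. (\<xi> y + n y) + m y) (zs @ ws) (add_stab V m ?\<sigma>)"
    by (rule legal_seq_append[OF legal_seq_add[OF zs] ws(1)]) (use assms in auto)
  then have "stab V (\<lambda>y. (\<xi> y + n y) + m y) = add_stab V m ?\<sigma>"
    using ws(2) by (rule stab_eq)
  then show ?thesis unfolding add_stab_def[of V "\<lambda>y. n y + m y"] by (simp add: add.assoc)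
qed

lemma recurrent_confs_iff:
  "\<eta> \<in> recurrent_confs V \<longleftrightarrow>
    (\<forall>y. y \<notin> V \<longrightarrow> \<eta> y = 0) \<and> (\<forall>y\<in>V. \<eta> y \<le> 2 * int CARD('d)) \<and> allowed (lattice_edges V) V (\<eta> :: 'd::finite config)"
  unfolding recurrent_confs_def allowed_confs_def by (auto simp: lattice_edges_Image card_neighbours)

lemma recurrent_confs_nonneg: "\<eta> \<in> recurrent_confs V \<Longrightarrow> 0 \<le> \<eta> y"
  using allowed_pos[of "lattice_edges V" V \<eta> y] by (cases "y \<in> V") (auto simp: recurrent_confs_iff)

lemma recurrent_confs_OmegaV: "recurrent_confs V \<subseteq> OmegaV V"
  using allowed_pos by (fastforce simp: recurrent_confs_iff OmegaV_def)

lemma finite_recurrent_confs: "finite V \<Longrightarrow> finite (recurrent_confs V)"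
  unfolding recurrent_confs_def by (rule finite_allowed_confs)

lemma add_stab_recurrent:
  assumes V: "finite V" and \<eta>: "\<eta> \<in> recurrent_confs V" and n: "\<And>y. 0 \<le> n y" "\<And>y. y \<notin> V \<Longrightarrow> n y = 0"
  shows "add_stab V n \<eta> \<in> recurrent_confs V"
proof -
  obtain zs where zs: "legal_seq V (\<lambda>y. \<eta> y + n y) zs (add_stab V n \<eta>)" "stable V (add_stab V n \<eta>)"
    by (rule add_stab_legal[OF V recurrent_confs_nonneg[OF \<eta>] n(1)])
  have "allowed (lattice_edges V) V (\<lambda>y. \<eta> y + n y)"
    by (rule allowed_mono[of _ V \<eta>]) (use \<eta> n in \<open>auto simp: recurrent_confs_iff\<close>)
  then have "allowed (lattice_edges V) V (add_stab V n \<eta>)"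
    by (rule allowed_legal_seq[OF zs(1) V])
  then show ?thesis
    using zs(2) legal_seq_outside[OF zs(1)] \<eta> n by (auto simp: recurrent_confs_iff stable_def)
qed

text \<open>Dhar's burning test: a nonempty unburnt remainder would be a forbidden set.\<close>

lemma burnt_recurrent:
  assumes V: "finite V" and \<eta>: "allowed (lattice_edges V) V \<eta>"
  shows "burnt (lattice_edges V) V (- V) \<eta> = UNIV"
proof (rule ccontr)
  let ?T = "burnt (lattice_edges V) V (- V) \<eta>"
  assume "?T \<noteq> UNIV"
  moreover have "- V \<subseteq> ?T" by (rule burnt_superset)
  ultimately have "- ?T \<subseteq> V" "- ?T \<noteq> {}" by auto
  then obtain y where y: "y \<in> - ?T" "int (card (lattice_edges V `` {y} \<inter> - ?T)) < \<eta> y"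
    using \<eta> unfolding allowed_def by blast
  have "card (lattice_edges V `` {y}) = card (lattice_edges V `` {y} \<inter> ?T) + card (lattice_edges V `` {y} - ?T)"
    by (rule card_Int_Diff) (simp add: finite_Image finite_lattice_edges V)
  then have "int (card (lattice_edges V `` {y})) < \<eta> y + int (card (lattice_edges V `` {y} \<inter> ?T))"
    using y(2) by (simp add: Diff_eq)
  then have "y \<in> ?T"
    using y(1) \<open>- ?T \<subseteq> V\<close> by (intro burnt_closed finite_lattice_edges V) auto
  then show False using y(1) by simp
qed

text \<open>The grains that \<open>V\<close> would receive if the root toppled once.\<close>

definition boundary_grains :: "'d::finite site set \<Rightarrow> 'd config" where
  "boundary_grains V = (\<lambda>y. if y \<in> V then int (card ({z. adjacent y z} - V)) else 0)"

text \<open>The whole of \<open>V\<close> burns from outside, so every site topples exactly once and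
  gets back, from neighbours or boundary grains, the 2d grains it gave.\<close>

lemma add_boundary_grains:
  assumes V: "finite V" and \<eta>: "\<eta> \<in> recurrent_confs V"
  shows "add_stab V (boundary_grains V) \<eta> = \<eta>"
proof -
  obtain zs \<xi>' where zs: "legal_seq V (\<lambda>y. \<eta> y + boundary_grains V y) zs \<xi>'" "distinct zs"
      "set zs = burnt (lattice_edges V) V (- V) \<eta> - (- V)"
    by (rule burning_sequence[of V V "- V" \<eta> "\<lambda>y. \<eta> y + boundary_grains V y"])
      (use V in \<open>auto simp: boundary_grains_def lattice_edges_Image Diff_eq\<close>)
  have set_zs: "set zs = V" using zs(3) burnt_recurrent[OF V] \<eta> by (auto simp: recurrent_confs_iff)
  have "\<xi>' y = \<eta> y" for y
  proof (cases "y \<in> V")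
    case True
    have "card {z. adjacent y z} = card ({z. adjacent y z} \<inter> V) + card ({z. adjacent y z} - V)"
      by (rule card_Int_Diff[OF finite_neighbours])
    then show ?thesis
      using legal_seq_distinct_result[OF zs(1,2) True] True set_zs by (simp add: boundary_grains_def card_neighbours)
  next
    case False
    then show ?thesis using legal_seq_outside[OF zs(1) False] by (simp add: boundary_grains_def)
  qed
  then have "\<xi>' = \<eta>" by auto
  moreover have "stable V \<eta>" using \<eta> by (auto simp: recurrent_confs_iff stable_def)
  ultimately show ?thesis using zs(1) unfolding add_stab_def by (intro stab_eq) auto
qed

text \<open>Heights are at least 1, so 2d extra grains make \<open>y\<close> unstable, and one
  toppling trades them for a grain at each neighbour in \<open>V\<close>.\<close>

lemma add_full_site:
  assumes V: "finite V" and \<eta>: "\<eta> \<in> recurrent_confs V" and y: "y \<in> V"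
  shows "add_stab V (\<lambda>z. 2 * int CARD('d) * of_bool (z = y)) \<eta>
    = add_stab V (\<lambda>z. of_bool (z \<in> V \<and> adjacent y z)) (\<eta> :: 'd::finite config)"
proof -
  let ?n = "\<lambda>z. of_bool (z \<in> V \<and> adjacent y z) :: int"
  let ?m = "\<lambda>z. \<eta> z + 2 * int CARD('d) * of_bool (z = y)"
  obtain zs where zs: "legal_seq V (\<lambda>z. \<eta> z + ?n z) zs (add_stab V ?n \<eta>)" "stable V (add_stab V ?n \<eta>)"
    by (rule add_stab_legal[OF V recurrent_confs_nonneg[OF \<eta>], of ?n]) auto
  have "topple V y ?m = (\<lambda>z. \<eta> z + ?n z)"
  proof
    fix z show "topple V y ?m z = \<eta> z + ?n z"
      using y not_adjacent_self[of y] by (cases "z = y") (auto simp: topple_def Lap_def)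
  qed
  moreover have "2 * int CARD('d) < ?m y"
    using allowed_pos[of "lattice_edges V" V \<eta> y] \<eta> y by (auto simp: recurrent_confs_iff)
  ultimately have "legal_seq V ?m (y # zs) (add_stab V ?n \<eta>)"
    using zs(1) y by (intro legal_seq.cons) auto
  then show ?thesis unfolding add_stab_def[of V "\<lambda>z. 2 * int CARD('d) * of_bool (z = y)"] using zs(2) by (rule stab_eq)
qed

lemma addop_recurrent:
  "finite V \<Longrightarrow> \<eta> \<in> recurrent_confs V \<Longrightarrow> x \<in> V \<Longrightarrow> addop x V \<eta> \<in> recurrent_confs V"
  unfolding addop_eq_add_stab by (rule add_stab_recurrent) auto

text \<open>Adding \<open>n\<close> factors through adding one grain at \<open>y\<close>, so
  injectivity of the composite passes to that first factor.\<close>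

lemma inj_addop_of_add_stab:
  assumes V: "finite V" and inj: "inj_on (add_stab V n) (recurrent_confs V)"
    and n: "\<And>z. 0 \<le> n z" "1 \<le> n y"
  shows "inj_on (addop y V) (recurrent_confs V)"
proof (rule inj_onI)
  fix \<eta> \<eta>' assume \<eta>: "\<eta> \<in> recurrent_confs V" "\<eta>' \<in> recurrent_confs V" and eq: "addop y V \<eta> = addop y V \<eta>'"
  let ?m = "\<lambda>z. n z - of_bool (z = y)"
  have "add_stab V ?m (addop y V \<xi>) = add_stab V n \<xi>" if "\<xi> \<in> recurrent_confs V" for \<xi>
    using add_stab_add_stab[OF V, of \<xi> "\<lambda>z. of_bool (z = y)" ?m] recurrent_confs_nonneg[OF that] n
    by (auto simp: addop_eq_add_stab)
  then have "add_stab V n \<eta> = add_stab V n \<eta>'" using \<eta> eq by metis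
  then show "\<eta> = \<eta>'" using inj \<eta> by (auto dest: inj_onD)
qed

lemma inj_add_stab_multiple:
  assumes V: "finite V" "y \<in> V" and inj: "inj_on (addop y V) (recurrent_confs V)"
  shows "inj_on (add_stab V (\<lambda>z. int k * of_bool (z = y))) (recurrent_confs V)"
proof (induction k)
  case 0
  have "add_stab V (\<lambda>z. 0) \<eta> = \<eta>" if "\<eta> \<in> recurrent_confs V" for \<eta>
    unfolding add_stab_def using that
    by (intro stab_eq[of _ _ "[]"]) (auto simp: legal_seq.nil recurrent_confs_iff stable_def)
  then show ?case by (auto intro: inj_onI)
next
  case (Suc k)
  let ?a = "\<lambda>k. add_stab V (\<lambda>z. int k * of_bool (z = y))"
  have step: "?a (Suc k) \<eta> = ?a k (addop y V \<eta>)" if "\<eta> \<in> recurrent_confs V" for \<eta>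
    using add_stab_add_stab[OF V(1), of \<eta> "\<lambda>z. of_bool (z = y)" "\<lambda>z. int k * of_bool (z = y)"] recurrent_confs_nonneg[OF that]
    by (simp add: addop_eq_add_stab algebra_simps)
  show ?case
  proof (rule inj_onI)
    fix \<eta> \<eta>' assume a: "\<eta> \<in> recurrent_confs V" "\<eta>' \<in> recurrent_confs V" "?a (Suc k) \<eta> = ?a (Suc k) \<eta>'"
    then have "?a k (addop y V \<eta>) = ?a k (addop y V \<eta>')" using step by metis
    then have "addop y V \<eta> = addop y V \<eta>'"
      using Suc.IH addop_recurrent[OF V(1) _ V(2)] a by (blast dest: inj_onD)
    then show "\<eta> = \<eta>'" using inj a by (blast dest: inj_onD)
  qed
qed

text \<open>Adding the boundary grains is the identity, so addition at boundary sites is injective; toppling once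
  expresses the \<open>2d\<close>-th power of an addition operator through its neighbours, which propagates
  injectivity inwards.\<close>

lemma inj_addop:
  fixes V :: "'d::finite site set"
  assumes V: "finite V" "y \<in> V"
  shows "inj_on (addop y V) (recurrent_confs V)"
proof -
  fix i :: 'd
  \<comment> \<open>Walk in direction \<open>i\<close> until \<open>V\<close> is left.
    \<open>n\<close> need not be the first exit, since a neighbour outside \<open>V\<close> settles
    the matter at once.\<close>
  have main: "y \<in> V \<Longrightarrow> y(i := y i + int n) \<notin> V \<Longrightarrow> inj_on (addop y V) (recurrent_confs V)" for n y
  proof (induction n arbitrary: y)
    case 0
    then show ?case by simp
  next
    case (Suc n)
    let ?z = "y(i := y i + 1)"
    have adj: "adjacent y ?z" by (rule adjacent_shift) simp
    show ?case
    proof (cases "?z \<in> V")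
      case False
      have "{z. adjacent y z} - V \<noteq> {}" using adj False by auto
      then have "1 \<le> int (card ({z. adjacent y z} - V))"
        using finite_neighbours[of y] by (simp add: Suc_le_eq card_gt_0_iff)
      then have "1 \<le> boundary_grains V y" using Suc.prems(1) by (simp add: boundary_grains_def)
      moreover have "inj_on (add_stab V (boundary_grains V)) (recurrent_confs V)"
        by (rule inj_onI) (simp add: add_boundary_grains[OF V(1)])
      ultimately show ?thesis
        by (intro inj_addop_of_add_stab[OF V(1)]) (auto simp: boundary_grains_def)
    next
      case True
      have "inj_on (addop ?z V) (recurrent_confs V)"
      proof (rule Suc.IH[OF True])
        have "?z(i := ?z i + int n) = y(i := y i + int (Suc n))" by (auto simp: fun_eq_iff)
        show "?z(i := ?z i + int n) \<notin> V" unfolding \<open>?z(i := ?z i + int n) = _\<close> by (rule Suc.prems(2))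
      qed
      then have "inj_on (add_stab V (\<lambda>z. int (2 * CARD('d)) * of_bool (z = ?z))) (recurrent_confs V)"
        by (rule inj_add_stab_multiple[OF V(1) True])
      then have "inj_on (add_stab V (\<lambda>z. of_bool (z \<in> V \<and> adjacent ?z z))) (recurrent_confs V)"
        using add_full_site[OF V(1) _ True] by (simp add: inj_on_def)
      then show ?thesis
        by (rule inj_addop_of_add_stab[OF V(1)]) (use adj Suc.prems(1) adjacent_symD in auto)
    qed
  qed
  define M where "M = (\<Sum>z\<in>V. \<bar>z i\<bar>) + \<bar>y i\<bar> + 1"
  have "y(i := y i + int (nat M)) \<notin> V"
  proof
    assume a: "y(i := y i + int (nat M)) \<in> V"
    have "\<bar>(y(i := y i + int (nat M))) i\<bar> \<le> (\<Sum>z\<in>V. \<bar>z i\<bar>)"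
      by (rule member_le_sum[OF a, of "\<lambda>z. \<bar>z i\<bar>"]) (use V in auto)
    moreover have "0 \<le> M" unfolding M_def by (simp add: sum_nonneg)
    ultimately show False unfolding M_def by simp
  qed
  then show ?thesis by (rule main[OF V(2)])
qed

section \<open>Recurrent states of the Markov chain\<close>

definition max_conf :: "'d::finite site set \<Rightarrow> 'd config" where
  "max_conf V = (\<lambda>y. if y \<in> V then 2 * int CARD('d) else 0)"

text \<open>A site of \<open>F\<close> with the largest coordinate in some direction has a neighbour
  outside \<open>F\<close>.\<close>

lemma max_conf_recurrent:
  fixes V :: "'d::finite site set"
  assumes "finite V"
  shows "max_conf V \<in> recurrent_confs V"
proof -
  fix i :: 'd
  have "\<exists>y\<in>F. int (card (lattice_edges V `` {y} \<inter> F)) < max_conf V y" if F: "F \<subseteq> V" "F \<noteq> {}" for F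
  proof -
    have "finite F" using F(1) assms by (rule finite_subset)
    then have "Max ((\<lambda>y. y i) ` F) \<in> (\<lambda>y. y i) ` F" using F(2) by (intro Max_in) auto
    then obtain y where y: "y \<in> F" "y i = Max ((\<lambda>y. y i) ` F)" by auto
    have "y(i := y i + 1) \<notin> F"
    proof
      assume a: "y(i := y i + 1) \<in> F"
      have "(y(i := y i + 1)) i \<le> Max ((\<lambda>y. y i) ` F)"
        by (rule Max_ge[OF finite_imageI[OF \<open>finite F\<close>] imageI[OF a, of "\<lambda>y. y i"]])
      then have "(y(i := y i + 1)) i \<le> y i" unfolding y(2)[symmetric] .
      then show False by simp
    qed
    moreover have "adjacent y (y(i := y i + 1))" by (rule adjacent_shift) simp
    ultimately have "{z. adjacent y z} \<inter> F \<subset> {z. adjacent y z}" by blast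
    then have "card ({z. adjacent y z} \<inter> F) < 2 * CARD('d)"
      using psubset_card_mono[OF finite_neighbours] card_neighbours by metis
    moreover have "y \<in> V" using y F by auto
    ultimately show ?thesis using y by (intro bexI[of _ y]) (auto simp: max_conf_def lattice_edges_Image)
  qed
  then show ?thesis unfolding recurrent_confs_iff allowed_def by (auto simp: max_conf_def)
qed

lemma chain_step_iff: "(\<xi>, \<xi>') \<in> chain_step V \<longleftrightarrow> \<xi> \<in> OmegaV V \<and> (\<exists>x\<in>V. \<xi>' = addop x V \<xi>)"
  unfolding chain_step_def by auto

text \<open>Missing grains are filled in one by one, and no toppling occurs on the way.\<close>

lemma chain_reaches_max_conf:
  fixes \<xi> :: "'d::finite config"
  assumes V: "finite V" and "\<xi> \<in> OmegaV V"
  shows "(\<xi>, max_conf V) \<in> (chain_step V)\<^sup>*"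
  using assms(2)
proof (induction "nat (\<Sum>y\<in>V. 2 * int CARD('d) - \<xi> y)" arbitrary: \<xi> rule: less_induct)
  case less
  show ?case
  proof (cases "\<exists>y\<in>V. \<xi> y < 2 * int CARD('d)")
    case False
    then have "\<xi> = max_conf V"
      using less.prems by (fastforce simp: max_conf_def OmegaV_def)
    then show ?thesis by simp
  next
    case True
    then obtain y where y: "y \<in> V" "\<xi> y < 2 * int CARD('d)" by blast
    let ?\<xi> = "\<xi>(y := \<xi> y + 1)"
    have Om: "?\<xi> \<in> OmegaV V" using less.prems y by (auto simp: OmegaV_def)
    have "stab V ?\<xi> = ?\<xi>"
      by (rule stab_eq[of _ _ "[]"]) (use Om in \<open>auto simp: legal_seq.nil stable_def OmegaV_def\<close>)
    then have step: "(\<xi>, ?\<xi>) \<in> chain_step V"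
      using less.prems y(1) by (auto simp: chain_step_iff addop_def intro!: bexI[of _ y])
    have "(\<Sum>z\<in>V. 2 * int CARD('d) - ?\<xi> z) < (\<Sum>z\<in>V. 2 * int CARD('d) - \<xi> z)"
      by (rule sum_strict_mono_ex1) (use V y in auto)
    moreover have "0 \<le> (\<Sum>z\<in>V. 2 * int CARD('d) - ?\<xi> z)"
      using Om by (intro sum_nonneg) (auto simp: OmegaV_def)
    ultimately have "nat (\<Sum>z\<in>V. 2 * int CARD('d) - ?\<xi> z) < nat (\<Sum>z\<in>V. 2 * int CARD('d) - \<xi> z)" by linarith
    then have "(?\<xi>, max_conf V) \<in> (chain_step V)\<^sup>*" using less.hyps Om by blast
    then show ?thesis by (rule converse_rtrancl_into_rtrancl[OF step])
  qed
qed

lemma chain_recurrent_closed: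
  assumes "finite V" "(\<xi>, \<xi>') \<in> (chain_step V)\<^sup>*" "\<xi> \<in> recurrent_confs V"
  shows "\<xi>' \<in> recurrent_confs V"
  using assms(2,3)
proof (induction rule: rtrancl_induct)
  case (step \<xi>' \<xi>'')
  then show ?case using addop_recurrent[OF assms(1)] by (auto simp: chain_step_iff)
qed

text \<open>Pigeonhole: the states reachable after the step contain the injective image of
  themselves together with \<open>\<xi>\<close>, so \<open>\<xi>\<close> must be among them.\<close>

lemma chain_step_reversible:
  assumes V: "finite V" and \<xi>: "\<xi> \<in> recurrent_confs V" "x \<in> V"
  shows "(addop x V \<xi>, \<xi>) \<in> (chain_step V)\<^sup>*"
proof -
  define S where "S = {\<tau>. (addop x V \<xi>, \<tau>) \<in> (chain_step V)\<^sup>*}"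
  have S: "S \<subseteq> recurrent_confs V"
    unfolding S_def using chain_recurrent_closed[OF V] addop_recurrent[OF V \<xi>] by blast
  have fin: "finite S" using S finite_recurrent_confs[OF V] by (rule finite_subset)
  have "addop x V ` insert \<xi> S \<subseteq> S"
  proof (rule image_subsetI)
    fix \<tau> assume "\<tau> \<in> insert \<xi> S"
    then show "addop x V \<tau> \<in> S"
    proof
      assume "\<tau> \<in> S"
      moreover have "(\<tau>, addop x V \<tau>) \<in> chain_step V"
        using \<open>\<tau> \<in> S\<close> S recurrent_confs_OmegaV \<xi>(2) by (fastforce simp: chain_step_iff)
      ultimately show ?thesis unfolding S_def by auto
    qed (auto simp: S_def)
  qed
  then have "card (addop x V ` insert \<xi> S) \<le> card S" using fin by (intro card_mono)
  moreover have "inj_on (addop x V) (insert \<xi> S)"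
    by (rule inj_on_subset[OF inj_addop[OF V \<xi>(2)]]) (use S \<xi> in auto)
  then have "card (addop x V ` insert \<xi> S) = card (insert \<xi> S)" by (rule card_image)
  ultimately have "card (insert \<xi> S) \<le> card S" by linarith
  then have "\<xi> \<in> S" using fin by (auto simp: card_insert_if split: if_splits)
  then show ?thesis unfolding S_def by simp
qed

lemma Rec_eq:
  fixes V :: "'d::finite site set"
  assumes V: "finite V"
  shows "Rec V = recurrent_confs V"
proof
  show "Rec V \<subseteq> recurrent_confs V"
  proof
    fix \<eta> assume \<eta>: "\<eta> \<in> Rec V"
    then have "(\<eta>, max_conf V) \<in> (chain_step V)\<^sup>*"
      using chain_reaches_max_conf[OF V] by (auto simp: Rec_def)
    then have "(max_conf V, \<eta>) \<in> (chain_step V)\<^sup>*" using \<eta> by (auto simp: Rec_def)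
    then show "\<eta> \<in> recurrent_confs V"
      by (rule chain_recurrent_closed[OF V _ max_conf_recurrent[OF V]])
  qed
  show "recurrent_confs V \<subseteq> Rec V"
  proof
    fix \<eta> assume \<eta>: "\<eta> \<in> recurrent_confs V"
    have "(\<xi>, \<eta>) \<in> (chain_step V)\<^sup>*" if "(\<eta>, \<xi>) \<in> (chain_step V)\<^sup>*" for \<xi>
      using that
    proof (induction rule: rtrancl_induct)
      case (step \<xi> \<xi>')
      have "\<xi> \<in> recurrent_confs V" by (rule chain_recurrent_closed[OF V step.hyps(1) \<eta>])
      then have "(\<xi>', \<xi>) \<in> (chain_step V)\<^sup>*"
        using step.hyps(2) chain_step_reversible[OF V] by (auto simp: chain_step_iff)
      then show ?case using step.IH by (rule rtrancl_trans)
    qed simp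
    then show "\<eta> \<in> Rec V" using \<eta> recurrent_confs_OmegaV by (auto simp: Rec_def)
  qed
qed

section \<open>Waves\<close>

lemma burnt_cong: "(\<And>y. y \<in> B \<Longrightarrow> \<zeta> y = \<xi> y) \<Longrightarrow> burnt G B K \<zeta> = burnt G B K \<xi>"
  unfolding burnt_def by simp

text \<open>The moment at which a wave is emitted: \<open>x\<close> is just above the threshold and
  every other site is stable.\<close>

definition prewave :: "'d::finite site set \<Rightarrow> 'd site \<Rightarrow> 'd config \<Rightarrow> bool" where
  "prewave V x \<xi> \<longleftrightarrow> (\<forall>y. y \<notin> V \<longrightarrow> \<xi> y = 0) \<and> \<xi> x = 2 * int CARD('d) + 1 \<and>
     (\<forall>y\<in>V - {x}. \<xi> y \<le> 2 * int CARD('d)) \<and> allowed (lattice_edges V) V \<xi>"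

abbreviation wave_set :: "'d::finite site set \<Rightarrow> 'd site \<Rightarrow> 'd config \<Rightarrow> 'd site set" where
  "wave_set V x \<xi> \<equiv> burnt (lattice_edges V) (V - {x}) {x} \<xi>"

text \<open>Let \<open>x\<close> topple once and then every site burnt from it. Sites left unburnt
  stay stable by closedness, burnt ones regain at most the 2d grains they lost, and so does
  \<open>x\<close>, which therefore ends at most where it began.\<close>

lemma wave:
  fixes \<xi> :: "'d::finite config"
  assumes V: "finite V" "x \<in> V" and \<xi>: "prewave V x \<xi>"
  obtains zs \<xi>' where "legal_seq V \<xi> zs \<xi>'" "zs \<noteq> []" "set zs = wave_set V x \<xi>"
    "stable V \<xi>' \<or> prewave V x \<xi>'"
proof -
  let ?T = "wave_set V x \<xi>"
  have finG: "finite (lattice_edges V)" by (rule finite_lattice_edges[OF V(1)])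
  have high: "2 * int CARD('d) < \<xi> x" using \<xi> by (simp add: prewave_def)
  have start: "\<xi> y + int (card (lattice_edges V `` {y} \<inter> {x})) \<le> topple V x \<xi> y" if "y \<in> V - {x}" for y
  proof -
    have "lattice_edges V `` {y} \<inter> {x} = (if adjacent x y then {x} else {})"
      using that adjacent_sym[of x y] by (auto simp: lattice_edges_def)
    then show ?thesis using that by (auto simp: topple_def Lap_def)
  qed
  obtain ws \<xi>' where ws: "legal_seq V (topple V x \<xi>) ws \<xi>'" "distinct ws" "set ws = ?T - {x}"
    by (rule burning_sequence[of V "V - {x}" "{x}" \<xi> "topple V x \<xi>"]) (use V start in auto)
  have seq: "legal_seq V \<xi> (x # ws) \<xi>'" by (rule legal_seq.cons[OF V(2) high ws(1)])
  have "x \<in> ?T" using burnt_superset[of "{x}" "lattice_edges V" "V - {x}" \<xi>] by auto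
  then have set_zs: "set (x # ws) = ?T" "distinct (x # ws)" using ws by auto
  have result: "\<xi>' y = \<xi> y - (if y \<in> ?T then 2 * int CARD('d) else 0) + int (card ({z. adjacent y z} \<inter> ?T))"
    if "y \<in> V" for y
    using legal_seq_distinct_result[OF seq set_zs(2) that] unfolding set_zs(1) .
  have le: "card ({z. adjacent y z} \<inter> ?T) \<le> 2 * CARD('d)" for y
    unfolding card_neighbours[of y, symmetric] by (rule card_mono[OF finite_neighbours]) auto
  have low: "\<xi>' y \<le> 2 * int CARD('d)" if y: "y \<in> V - {x}" for y
  proof (cases "y \<in> ?T")
    case True
    then show ?thesis using result[of y] le[of y] y \<xi> by (force simp: prewave_def)
  next
    case False
    have "\<not> int (card (lattice_edges V `` {y})) < \<xi> y + int (card (lattice_edges V `` {y} \<inter> ?T))"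
      using burnt_closed[OF finG y, of \<xi> "{x}"] False by blast
    then show ?thesis using result[of y] False y by (simp add: lattice_edges_Image card_neighbours)
  qed
  have "\<xi>' x \<le> 2 * int CARD('d) + 1"
    using result[OF V(2)] \<open>x \<in> ?T\<close> le[of x] \<xi> by (simp add: prewave_def)
  moreover have "prewave V x \<xi>'" if "\<xi>' x = 2 * int CARD('d) + 1"
    using that low legal_seq_outside[OF seq] allowed_legal_seq[OF seq V(1)] \<xi> by (simp add: prewave_def)
  moreover have "stable V \<xi>'" if "\<xi>' x \<le> 2 * int CARD('d)"
    unfolding stable_def using that low by (metis Diff_iff singletonD)
  ultimately have "stable V \<xi>' \<or> prewave V x \<xi>'" by linarith
  then show ?thesis using that seq set_zs(1) by blast
qed

text \<open>Peel waves off the avalanche until one leaves \<open>C\<close>. By least action the rest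
  still stabilizes to the same \<open>\<sigma>\<close>, and a pending toppling at \<open>y\<close>
  means that the configuration is not yet stable.\<close>

lemma far_wave_exists:
  fixes \<xi> :: "'d::finite config"
  assumes V: "finite V" "x \<in> V"
    and "prewave V x \<xi>" "legal_seq V \<xi> ws \<sigma>" "stable V \<sigma>" "y \<in> set ws" "y \<notin> C"
  shows "\<exists>\<xi>'. prewave V x \<xi>' \<and> stab V \<xi>' = \<sigma> \<and> \<not> wave_set V x \<xi>' \<subseteq> C"
  using assms(3-6)
proof (induction "length ws" arbitrary: \<xi> ws rule: less_induct)
  case less
  show ?case
  proof (cases "wave_set V x \<xi> \<subseteq> C")
    case False
    then show ?thesis using less.prems stab_eq by blast
  next
    case True
    obtain zs \<xi>' where zs: "legal_seq V \<xi> zs \<xi>'" "zs \<noteq> []" "set zs = wave_set V x \<xi>" "stable V \<xi>' \<or> prewave V x \<xi>'"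
      by (rule wave[OF V less.prems(1)])
    obtain vs where vs: "legal_seq V \<xi>' vs \<sigma>" "mset ws = mset (zs @ vs)"
      using legal_seq_extend[OF zs(1) less.prems(2,3)] by blast
    have "y \<notin> set zs" using True zs(3) assms(7) by auto
    then have y: "y \<in> set vs" using less.prems(4) mset_eq_setD[OF vs(2)] by auto
    then have "\<not> stable V \<xi>'" using stable_legal_seq[OF _ vs(1)] by auto
    then have "prewave V x \<xi>'" using zs(4) by blast
    moreover have "length vs < length ws" using mset_eq_length[OF vs(2)] zs(2) by auto
    ultimately show ?thesis using less.hyps[of vs \<xi>'] vs(1) less.prems(3) y by blast
  qed
qed

lemma restr_OmegaV: "\<eta> \<in> OmegaV V \<Longrightarrow> restr V \<eta> = \<eta>"
  unfolding restr_def OmegaV_def by auto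

lemma stabilization_restr:
  fixes \<eta> :: "'d::finite config"
  assumes "finite V" "\<And>y. y \<in> V \<Longrightarrow> 0 \<le> \<eta> y"
  obtains zs \<sigma> where "legal_seq V ((restr V \<eta>)(x := restr V \<eta> x + 1)) zs \<sigma>" "stable V \<sigma>"
proof -
  have "0 \<le> ((restr V \<eta>)(x := restr V \<eta> x + 1)) y" for y
    using assms(2)[of y] assms(2)[of x] unfolding restr_def by auto
  then show ?thesis using stabilizes[OF assms(1)] that by blast
qed

lemma card_far_avalanche_le:
  fixes V :: "'d::finite site set"
  assumes V: "finite V" "x \<in> V"
  shows "card {\<eta> \<in> Rec V. \<exists>y. y \<notin> C \<and> 0 < NV V x y \<eta>} \<le>
    card {\<zeta> \<in> allowed_confs (lattice_edges V) (V - {x}). \<not> wave_set V x \<zeta> \<subseteq> C}"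
proof -
  let ?A = "{\<eta> \<in> Rec V. \<exists>y. y \<notin> C \<and> 0 < NV V x y \<eta>}"
  have ex: "\<exists>\<xi>. prewave V x \<xi> \<and> stab V \<xi> = addop x V \<eta> \<and> \<not> wave_set V x \<xi> \<subseteq> C" if \<eta>: "\<eta> \<in> ?A" for \<eta>
  proof -
    have rec: "\<eta> \<in> recurrent_confs V" using \<eta> Rec_eq[OF V(1)] by auto
    then have restr: "restr V \<eta> = \<eta>" using recurrent_confs_OmegaV restr_OmegaV by blast
    let ?\<xi> = "\<eta>(x := \<eta> x + 1)"
    obtain zs \<sigma> where zs: "legal_seq V ?\<xi> zs \<sigma>" "stable V \<sigma>"
      using stabilization_restr[OF V(1), of \<eta> x] recurrent_confs_nonneg[OF rec] unfolding restr by blast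
    have NV: "NV V x y \<eta> = count_list zs y" for y
      by (rule NV_eq) (use zs restr in auto)
    obtain y where "y \<notin> C" "0 < NV V x y \<eta>" using \<eta> by blast
    then have y: "y \<notin> C" "y \<in> set zs" using NV[of y] by (auto intro: ccontr)
    then have "\<not> stable V ?\<xi>" using stable_legal_seq[OF _ zs(1)] by auto
    then have "\<eta> x = 2 * int CARD('d)"
      using rec V(2) by (force simp: stable_def recurrent_confs_iff split: if_splits)
    moreover have "allowed (lattice_edges V) V ?\<xi>"
      by (rule allowed_mono[of _ V \<eta>]) (use rec in \<open>auto simp: recurrent_confs_iff\<close>)
    ultimately have "prewave V x ?\<xi>" using rec V(2) by (auto simp: prewave_def recurrent_confs_iff)
    from far_wave_exists[OF V this zs y(2,1)]
    show ?thesis using stab_eq[OF zs] by (simp add: addop_def)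
  qed
  \<comment> \<open>Which far wave is chosen does not matter: all waves of an avalanche share the
    final configuration, and that determines \<open>\<eta>\<close>.\<close>
  define w where "w = (\<lambda>\<eta>. SOME \<xi>. prewave V x \<xi> \<and> stab V \<xi> = addop x V \<eta> \<and> \<not> wave_set V x \<xi> \<subseteq> C)"
  have w: "prewave V x (w \<eta>) \<and> stab V (w \<eta>) = addop x V \<eta> \<and> \<not> wave_set V x (w \<eta>) \<subseteq> C" if "\<eta> \<in> ?A" for \<eta>
    unfolding w_def by (rule someI_ex[OF ex[OF that]])
  \<comment> \<open>Erasing the height at \<open>x\<close> loses nothing, since every wave starts
    from the same height there.\<close>
  let ?f = "\<lambda>\<eta>. (w \<eta>)(x := 0)"
  show ?thesis
  proof (rule card_inj_on_le[where f = ?f])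
    show "inj_on ?f ?A"
    proof (rule inj_onI)
      fix \<eta> \<eta>' assume a: "\<eta> \<in> ?A" "\<eta>' \<in> ?A" "?f \<eta> = ?f \<eta>'"
      have "w \<eta> y = w \<eta>' y" for y
      proof (cases "y = x")
        case True
        then show ?thesis using w[OF a(1)] w[OF a(2)] by (simp add: prewave_def)
      next
        case False
        then show ?thesis using fun_cong[OF a(3), of y] by simp
      qed
      then have "w \<eta> = w \<eta>'" by auto
      then have "addop x V \<eta> = addop x V \<eta>'" using w[OF a(1)] w[OF a(2)] by simp
      then show "\<eta> = \<eta>'"
        using inj_addop[OF V] a Rec_eq[OF V(1)] by (auto dest: inj_onD)
    qed
    show "?f ` ?A \<subseteq> {\<zeta> \<in> allowed_confs (lattice_edges V) (V - {x}). \<not> wave_set V x \<zeta> \<subseteq> C}"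
    proof (rule image_subsetI)
      fix \<eta> assume "\<eta> \<in> ?A"
      note w = w[OF this]
      have "wave_set V x (?f \<eta>) = wave_set V x (w \<eta>)" by (rule burnt_cong) auto
      moreover have "allowed (lattice_edges V) (V - {x}) (?f \<eta>)"
        by (rule allowed_mono[of _ V "w \<eta>"]) (use w in \<open>auto simp: prewave_def\<close>)
      ultimately show "?f \<eta> \<in> {\<zeta> \<in> allowed_confs (lattice_edges V) (V - {x}). \<not> wave_set V x \<zeta> \<subseteq> C}"
        using w by (auto simp: allowed_confs_def prewave_def lattice_edges_Image card_neighbours)
    qed
    show "finite {\<zeta> \<in> allowed_confs (lattice_edges V) (V - {x}). \<not> wave_set V x \<zeta> \<subseteq> C}"
      using finite_allowed_confs[of "V - {x}" "lattice_edges V"] V(1) by simp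
  qed
qed

section \<open>Monotonicity in the volume\<close>

text \<open>On \<open>W\<close> a toppling acts alike in both volumes, and sites of the larger one
  outside \<open>W\<close> merely collect grains.\<close>

lemma legal_seq_mono:
  assumes "legal_seq W \<xi> zs \<xi>'" "W \<subseteq> V" "\<And>y. y \<in> W \<Longrightarrow> \<xi> y \<le> \<tau> y"
  shows "\<exists>\<tau>'. legal_seq V \<tau> zs \<tau>'"
  using assms(1,3)
proof (induction arbitrary: \<tau> rule: legal_seq.induct)
  case (nil \<xi>)
  then show ?case using legal_seq.nil by blast
next
  case (cons z \<xi> zs \<xi>')
  have "topple W z \<xi> y \<le> topple V z \<tau> y" if "y \<in> W" for y
    using that assms(2) cons.prems[OF that] by (auto simp: topple_def)
  then obtain \<tau>' where "legal_seq V (topple V z \<tau>) zs \<tau>'" using cons.IH by blast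
  moreover have "z \<in> V" using cons.hyps(1) assms(2) by auto
  ultimately show ?case
    using cons.hyps(2) cons.prems[OF cons.hyps(1)] legal_seq.cons[of z V \<tau> zs \<tau>'] by fastforce
qed

lemma NV_mono:
  fixes \<eta> :: "'d::finite config"
  assumes V: "finite V" "W \<subseteq> V" "x \<in> W" and \<eta>: "\<And>y. y \<in> V \<Longrightarrow> 0 \<le> \<eta> y"
  shows "NV W x y \<eta> \<le> NV V x y \<eta>"
proof -
  obtain zs \<sigma> where zs: "legal_seq W ((restr W \<eta>)(x := restr W \<eta> x + 1)) zs \<sigma>" "stable W \<sigma>"
    using stabilization_restr[OF finite_subset[OF V(2,1)], of \<eta> x] V(2) \<eta> by blast
  obtain ws \<tau> where ws: "legal_seq V ((restr V \<eta>)(x := restr V \<eta> x + 1)) ws \<tau>" "stable V \<tau>"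
    using stabilization_restr[OF V(1), of \<eta> x] \<eta> by blast
  have le: "((restr W \<eta>)(x := restr W \<eta> x + 1)) y \<le> ((restr V \<eta>)(x := restr V \<eta> x + 1)) y" if "y \<in> W" for y
    using that V(2,3) by (auto simp: restr_def)
  obtain \<tau>' where "legal_seq V ((restr V \<eta>)(x := restr V \<eta> x + 1)) zs \<tau>'"
    using legal_seq_mono[OF zs(1) V(2) le] by blast
  then obtain vs where "mset ws = mset (zs @ vs)" using legal_seq_extend[OF _ ws] by blast
  then have "count_list ws y = count_list (zs @ vs) y" by (metis count_mset)
  then show ?thesis using NV_eq[OF zs, of y] NV_eq[OF ws, of y] by simp
qed

section \<open>Passage to infinite volume\<close>

lemma far_avalanche_prob_le:
  fixes x :: "'d::finite site"
  assumes d: "CARD('d) \<ge> 3" and e: "0 < (e :: real)"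
  obtains n where "\<And>V. finite V \<Longrightarrow> x \<in> V \<Longrightarrow>
    measure (muV V) {\<eta>. \<exists>y. y \<notin> cube x n \<and> 0 < NV V x y \<eta>} \<le> e"
proof -
  obtain n where n: "\<And>V. finite V \<Longrightarrow> x \<in> V \<Longrightarrow>
    real (card {\<zeta> \<in> allowed_confs (lattice_edges V) (V - {x}). \<not> wave_set V x \<zeta> \<subseteq> cube x n})
      \<le> e * real (num_allowed (lattice_edges V) V)"
    using burnt_far_rare[OF d e] by blast
  show ?thesis
  proof (rule that[of n])
    fix V assume V: "finite V" "x \<in> V"
    have fin: "finite (Rec V)" "Rec V \<noteq> {}"
      using finite_recurrent_confs[OF V(1)] max_conf_recurrent[OF V(1)] Rec_eq[OF V(1)] by auto
    have "real (card {\<eta> \<in> Rec V. \<exists>y. y \<notin> cube x n \<and> 0 < NV V x y \<eta>}) \<le> e * real (card (Rec V))"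
      using card_far_avalanche_le[OF V, of "cube x n"] n[OF V] Rec_eq[OF V(1)]
      unfolding recurrent_confs_def by simp
    then show "measure (muV V) {\<eta>. \<exists>y. y \<notin> cube x n \<and> 0 < NV V x y \<eta>} \<le> e"
      unfolding muV_def measure_pmf_of_set[OF fin(2,1)]
      using fin by (simp add: Int_def divide_le_eq card_gt_0_iff)
  qed
qed

lemma open_restr:
  fixes Y :: "'d::finite config set"
  assumes "finite W"
  shows "open {\<eta>. restr W \<eta> \<in> Y}"
proof (subst open_subopen, clarify)
  fix \<eta> assume \<eta>: "restr W \<eta> \<in> Y"
  let ?U = "\<Inter>z\<in>W. (\<lambda>\<eta>'. \<eta>' z) -` {\<eta> z}"
  have "open ((\<lambda>\<eta>' :: 'd config. \<eta>' z) -` {\<eta> z})" for z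
    by (rule open_vimage[OF discrete_topology_class.open_discrete continuous_on_product_coordinates])
  then have "open ?U" using assms by (intro open_INT) auto
  moreover have "restr W \<eta>' = restr W \<eta>" if "\<eta>' \<in> ?U" for \<eta>'
    using that by (auto simp: restr_def)
  ultimately show "\<exists>T. open T \<and> \<eta> \<in> T \<and> T \<subseteq> {\<eta>. restr W \<eta> \<in> Y}"
  proof (intro exI[of _ ?U] conjI)
    show "?U \<subseteq> {\<eta>. restr W \<eta> \<in> Y}"
      using \<open>\<And>\<eta>'. \<eta>' \<in> ?U \<Longrightarrow> restr W \<eta>' = restr W \<eta>\<close> \<eta> by (metis (mono_tags) mem_Collect_eq subsetI)
  qed auto
qed

text \<open>Heights are discrete, so the indicator of a local event is a continuous test function
  and weak convergence applies to it directly.\<close>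

lemma clopen_local_event:
  fixes S :: "'d::finite config set"
  assumes "finite W" "\<And>\<eta> \<eta>'. restr W \<eta> = restr W \<eta>' \<Longrightarrow> \<eta> \<in> S \<longleftrightarrow> \<eta>' \<in> S"
  shows "open S" "closed S"
proof -
  have 1: "\<eta> \<in> S" if "restr W \<eta> \<in> restr W ` S" for \<eta> using that assms(2) by blast
  have 2: "\<eta> \<notin> S" if "restr W \<eta> \<in> restr W ` (- S)" for \<eta> using that assms(2) by blast
  have "{\<eta>. restr W \<eta> \<in> restr W ` S} = S" using 1 by blast
  then show "open S" using open_restr[OF assms(1), of "restr W ` S"] by simp
  have "{\<eta>. restr W \<eta> \<in> restr W ` (- S)} = - S" using 2 by blast
  then show "closed S" unfolding closed_def using open_restr[OF assms(1), of "restr W ` (- S)"] by simp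
qed

lemma continuous_on_indicator_clopen:
  assumes "open S" "closed S"
  shows "continuous_on UNIV (indicator S :: 'a::topological_space \<Rightarrow> real)"
proof (subst continuous_on_open_vimage[OF open_UNIV], intro allI impI)
  fix B :: "real set"
  have "indicator S -` B \<inter> UNIV = (if 1 \<in> B then S else {}) \<union> (if 0 \<in> B then - S else {})"
  proof (rule set_eqI)
    fix a show "a \<in> indicator S -` B \<inter> UNIV \<longleftrightarrow> a \<in> (if 1 \<in> B then S else {}) \<union> (if 0 \<in> B then - S else {})"
      by (cases "a \<in> S") simp_all
  qed
  then show "open (indicator S -` B \<inter> UNIV)" using assms by auto
qed

text \<open>The window \<open>W\<close> stays fixed while \<open>V\<close> grows, so a bound for the
  \<open>V\<close> containing \<open>W\<close> is an eventual bound along the net.\<close>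

lemma sandpile_limit_local_event_le:
  fixes \<mu> :: "'d::finite config measure"
  assumes \<mu>: "sandpile_limit \<mu>" and W: "finite W"
    and S: "\<And>\<eta> \<eta>'. restr W \<eta> = restr W \<eta>' \<Longrightarrow> \<eta> \<in> S \<longleftrightarrow> \<eta>' \<in> S"
    and e: "\<And>V. finite V \<Longrightarrow> W \<subseteq> V \<Longrightarrow> measure (muV V) S \<le> e"
  shows "measure \<mu> S \<le> e"
proof -
  have clopen: "open S" "closed S" using clopen_local_event[OF W S] by blast+
  have sets: "sets \<mu> = sets borel" and "prob_space \<mu>" using \<mu> by (auto simp: sandpile_limit_def)
  then have S_sets: "S \<in> sets \<mu>" using clopen by simp
  let ?f = "indicator S :: 'd config \<Rightarrow> real"
  have "bounded (range ?f)" by (rule boundedI[of _ 1]) (auto split: split_indicator)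
  then have cont: "continuous_on UNIV ?f \<and> bounded (range ?f)"
    using continuous_on_indicator_clopen[OF clopen] by blast
  have "\<forall>f :: 'd config \<Rightarrow> real. continuous_on UNIV f \<and> bounded (range f) \<longrightarrow>
        ((\<lambda>V. \<integral>\<xi>. f \<xi> \<partial>muV V) \<longlongrightarrow> (\<integral>\<eta>. f \<eta> \<partial>\<mu>)) (finite_subsets_at_top UNIV)"
    using \<mu> unfolding sandpile_limit_def by (elim conjE)
  from this[THEN spec, THEN mp, OF cont]
  have "((\<lambda>V. \<integral>\<xi>. ?f \<xi> \<partial>muV V) \<longlongrightarrow> (\<integral>\<eta>. ?f \<eta> \<partial>\<mu>)) (finite_subsets_at_top UNIV)" .
  moreover have "(\<integral>\<xi>. ?f \<xi> \<partial>muV V) = measure (muV V) S" for V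
    unfolding muV_def by simp
  moreover have "(\<integral>\<eta>. ?f \<eta> \<partial>\<mu>) = measure \<mu> S"
    using S_sets sets_eq_imp_space_eq[OF sets] by simp
  ultimately have lim: "((\<lambda>V. measure (muV V) S) \<longlongrightarrow> measure \<mu> S) (finite_subsets_at_top UNIV)" by simp
  have "eventually (\<lambda>V. measure (muV V) S \<le> e) (finite_subsets_at_top UNIV)"
    unfolding eventually_finite_subsets_at_top using W e by (intro exI[of _ W]) auto
  then show ?thesis by (rule tendsto_upperbound[OF lim]) simp
qed

lemma Omega_nonneg: "\<eta> \<in> Omega \<Longrightarrow> 0 \<le> \<eta> y"
  unfolding Omega_def by (auto dest!: spec[of _ y])

lemma Ntop_pos_iff: "0 < Ntop x y \<eta> \<longleftrightarrow> (\<exists>V. finite V \<and> x \<in> V \<and> 0 < NV V x y \<eta>)"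
  unfolding Ntop_def less_SUP_iff by (auto simp: zero_enat_def)

lemma finite_subset_cube:
  fixes x :: "'d::finite site"
  assumes "finite S"
  obtains n where "S \<subseteq> cube x n"
proof (rule that)
  define n where "n = nat (\<Sum>y\<in>S. \<Sum>i\<in>UNIV. \<bar>y i - x i\<bar>)"
  have "\<bar>z i - x i\<bar> \<le> int n" if z: "z \<in> S" for z i
  proof -
    have "\<bar>z i - x i\<bar> \<le> (\<Sum>i\<in>UNIV. \<bar>z i - x i\<bar>)"
      by (rule member_le_sum[where f = "\<lambda>i. \<bar>z i - x i\<bar>"]) auto
    also have "\<dots> \<le> (\<Sum>y\<in>S. \<Sum>i\<in>UNIV. \<bar>y i - x i\<bar>)"
      by (rule member_le_sum[OF z, where f = "\<lambda>z. \<Sum>i\<in>UNIV. \<bar>z i - x i\<bar>"])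
        (use assms in \<open>auto intro!: sum_nonneg\<close>)
    finally show ?thesis unfolding n_def by linarith
  qed
  then show "S \<subseteq> cube x n" unfolding cube_def by blast
qed

text \<open>Replaces the supremum over all volumes by an increasing sequence of local events, which
  gives measurability and allows continuity from below.\<close>

lemma cluster_eq_UN_cube:
  fixes \<eta> :: "'d::finite config"
  assumes "\<eta> \<in> Omega"
  shows "cluster x \<eta> = (\<Union>m. {y. 0 < NV (cube x m) x y \<eta>})"
proof (intro equalityI subsetI)
  fix y assume "y \<in> cluster x \<eta>"
  then obtain V where V: "finite V" "x \<in> V" "0 < NV V x y \<eta>"
    unfolding cluster_def Ntop_pos_iff by blast
  obtain m where "V \<subseteq> cube x m" using finite_subset_cube[OF V(1)] by blast
  then have "NV V x y \<eta> \<le> NV (cube x m) x y \<eta>"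
    by (rule NV_mono[OF finite_cube _ V(2)]) (use assms Omega_nonneg \<open>V \<subseteq> cube x m\<close> in auto)
  then show "y \<in> (\<Union>m. {y. 0 < NV (cube x m) x y \<eta>})" using V(3) by (intro UN_I[of m]) auto
next
  fix y assume "y \<in> (\<Union>m. {y. 0 < NV (cube x m) x y \<eta>})"
  then show "y \<in> cluster x \<eta>"
    unfolding cluster_def Ntop_pos_iff using finite_cube centre_in_cube by blast
qed

text \<open>An avalanche that leaves the cube of radius \<open>n\<close> in infinite volume does so in some finite cube
  of radius \<open>m\<close>; the latter events are local and increase with \<open>m\<close>.\<close>

theorem theorem3p2:
  fixes \<mu> :: "'d::finite config measure" and x :: "'d site"
  assumes "CARD('d) \<ge> 3"
    and "sandpile_limit \<mu>"
  shows "{\<eta> \<in> Omega. finite (cluster x \<eta>)} \<in> sets \<mu>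
         \<and> measure \<mu> {\<eta> \<in> Omega. finite (cluster x \<eta>)} = 1"
proof -
  interpret prob_space \<mu> using assms(2) by (simp add: sandpile_limit_def)
  have sets: "sets \<mu> = sets borel" and "emeasure \<mu> Omega = 1"
    using assms(2) by (auto simp: sandpile_limit_def)
  \<comment> \<open>Measurability comes from the mass: a set that is not measurable has
    \<open>emeasure\<close> 0 by convention.\<close>
  then have Omega: "Omega \<in> sets \<mu>" "prob Omega = 1"
    using emeasure_notin_sets[of Omega \<mu>] by (fastforce simp: emeasure_eq_measure)+
  define E where "E = (\<lambda>V n. {\<eta> :: 'd config. \<exists>y. y \<notin> cube x n \<and> 0 < NV V x y \<eta>})"
  \<comment> \<open>Intersecting with \<open>Omega\<close> supplies the nonnegative heights on which
    monotonicity in the volume relies.\<close>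
  define U where "U = (\<lambda>n. \<Union>m. E (cube x m) n \<inter> Omega)"
  have local_E: "\<eta> \<in> E W n \<longleftrightarrow> \<eta>' \<in> E W n" if "restr W \<eta> = restr W \<eta>'" for W n \<eta> \<eta>'
    using that unfolding E_def NV_def by simp
  have E_sets: "E (cube x m) n \<in> sets \<mu>" for m n
    using clopen_local_event(1)[OF finite_cube local_E] sets by simp
  have U_sets: "U n \<in> sets \<mu>" for n
    unfolding U_def using E_sets Omega(1) by auto
  have E_mono: "E W n \<inter> S \<subseteq> E V n" if "finite V" "W \<subseteq> V" "x \<in> W" "\<And>\<eta> y. \<eta> \<in> S \<Longrightarrow> y \<in> V \<Longrightarrow> 0 \<le> \<eta> y" for W V n S
  proof
    fix \<eta> assume \<eta>: "\<eta> \<in> E W n \<inter> S"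
    then obtain y where "y \<notin> cube x n" "0 < NV W x y \<eta>" unfolding E_def by blast
    moreover have "NV W x y \<eta> \<le> NV V x y \<eta>" by (rule NV_mono[OF that(1-3)]) (use \<eta> that(4) in blast)
    ultimately show "\<eta> \<in> E V n" unfolding E_def by (auto intro: less_le_trans)
  qed
  have good: "finite (cluster x \<eta>) \<longleftrightarrow> (\<exists>n. \<eta> \<notin> U n)" if \<eta>: "\<eta> \<in> Omega" for \<eta>
  proof -
    have "\<eta> \<notin> U n \<longleftrightarrow> cluster x \<eta> \<subseteq> cube x n" for n
      unfolding cluster_eq_UN_cube[OF \<eta>] U_def E_def using \<eta> by blast
    moreover have "finite (cluster x \<eta>) \<longleftrightarrow> (\<exists>n. cluster x \<eta> \<subseteq> cube x n)"
    proof
      assume "finite (cluster x \<eta>)"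
      then show "\<exists>n. cluster x \<eta> \<subseteq> cube x n" using finite_subset_cube by blast
    qed (meson finite_cube finite_subset)
    ultimately show ?thesis by simp
  qed
  have small: "\<exists>n. prob (U n) \<le> e" if e: "0 < e" for e
  proof -
    obtain n where n: "\<And>V. finite V \<Longrightarrow> x \<in> V \<Longrightarrow> measure (muV V) (E V n) \<le> e"
      unfolding E_def by (rule far_avalanche_prob_le[OF assms(1) e]) blast
    have "prob (E (cube x m) n \<inter> Omega) \<le> e" for m
    proof -
      have "prob (E (cube x m) n) \<le> e"
      proof (rule sandpile_limit_local_event_le[OF assms(2) finite_cube local_E])
        fix V assume V: "finite V" "cube x m \<subseteq> V"
        have Rec: "Rec V = recurrent_confs V" "finite (Rec V)" "Rec V \<noteq> {}"
          using finite_recurrent_confs[OF V(1)] max_conf_recurrent[OF V(1)] Rec_eq[OF V(1)] by auto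
        \<comment> \<open>The avalanche in the fixed cube is dominated by the one in
          \<open>V\<close>, to which the bound uniform in \<open>V\<close> applies.\<close>
        have "Rec V \<inter> E (cube x m) n \<subseteq> Rec V \<inter> E V n"
          using E_mono[OF V centre_in_cube, of "Rec V" n] recurrent_confs_nonneg unfolding Rec(1) by blast
        then have "measure (muV V) (E (cube x m) n) \<le> measure (muV V) (E V n)"
          unfolding muV_def measure_pmf_of_set[OF Rec(3,2)]
          by (intro divide_right_mono of_nat_mono card_mono) (use Rec in auto)
        also have "\<dots> \<le> e" using n[OF V(1)] V(2) centre_in_cube by blast
        finally show "measure (muV V) (E (cube x m) n) \<le> e" .
      qed
      moreover have "prob (E (cube x m) n \<inter> Omega) \<le> prob (E (cube x m) n)"
        using E_sets by (intro finite_measure_mono) auto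
      ultimately show ?thesis by linarith
    qed
    moreover have "(\<lambda>m. prob (E (cube x m) n \<inter> Omega)) \<longlonglongrightarrow> prob (U n)"
      unfolding U_def
    proof (rule finite_Lim_measure_incseq)
      show "range (\<lambda>m. E (cube x m) n \<inter> Omega) \<subseteq> sets \<mu>" using E_sets Omega(1) by auto
      show "incseq (\<lambda>m. E (cube x m) n \<inter> Omega)"
      proof (rule monoI)
        fix m m' :: nat assume "m \<le> m'"
        have "E (cube x m) n \<inter> Omega \<subseteq> E (cube x m') n"
          by (rule E_mono[OF finite_cube cube_mono[OF \<open>m \<le> m'\<close>] centre_in_cube])
            (rule Omega_nonneg)
        then show "E (cube x m) n \<inter> Omega \<subseteq> E (cube x m') n \<inter> Omega" by auto
      qed
    qed
    ultimately have "prob (U n) \<le> e" by (intro LIMSEQ_le_const2) auto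
    then show ?thesis by blast
  qed
  let ?A = "{\<eta> \<in> Omega. finite (cluster x \<eta>)}"
  have A_eq: "?A = Omega - (\<Inter>n. U n)" using good by auto
  have I_sets: "(\<Inter>n. U n) \<in> sets \<mu>" using U_sets by auto
  have "prob (\<Inter>n. U n) \<le> e" if e: "0 < e" for e
  proof -
    obtain n where "prob (U n) \<le> e" using small[OF e] by blast
    moreover have "prob (\<Inter>n. U n) \<le> prob (U n)" by (rule finite_measure_mono) (use U_sets in auto)
    ultimately show ?thesis by linarith
  qed
  then have "prob (\<Inter>n. U n) = 0"
    by (metis antisym_conv2 dense measure_nonneg not_less)
  moreover have "(\<Inter>n. U n) \<subseteq> Omega" unfolding U_def by auto
  ultimately have "prob ?A = 1"
    unfolding A_eq using finite_measure_Diff[OF Omega(1) I_sets] Omega(2) by simp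
  then show ?thesis unfolding A_eq using Omega(1) I_sets by auto
qed

end
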